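(* The following is a complete list, up to isomorphism, of the connected binary split matroids on at least two elements (that is, a matroid on at least two elements is connected, binary and split if and only if it is isomorphic to a matroid in the list): (a) matroids obtained by adding (possibly zero) parallel copies to an element of $U_{r-1,r}$, for any $r\ge 2$; (b) loopless rank-2 matroids with exactly three parallel classes, and their duals; (c) the connected binary (sparse) paving matroids of rank and corank at least three, namely $M(K_4)$, $F_7$, $F_7^*$, $AG(3,2)$.
   Context: All matroids are on finite ground sets. $U_{k,n}$ is the uniform matroid of rank $k$ on $n$ elements. A matroid is binary if it is representable over the field $GF(2)$. The corank of $M$ is the rank of its dual $M^*$. Two non-loop elements $e,f$ are parallel if $r_M(\{e,f\})=1$; a parallel class of a loopless matroid is a flat of rank one. In (a), all added copies are parallel to one single element of $U_{r-1,r}$. $M$ is connected if any two distinct elements lie in a common circuit. A matroid of rank $r$ is paving if every circuit has size at least $r$; it is sparse paving if both it and its dual are paving. $M(K_4)$ is the cycle matroid of the complete graph on 4 vertices; $F_7$ is the Fano matroid, i.e. the matroid of the 7 nonzero vectors of $GF(2)^3$, and $F_7^*$ its dual; $AG(3,2)$ is the rank-4 binary affine geometry on the 8 points of $GF(2)^3$ (affine independence over $GF(2)$). Split matroid: Let $M$ be a matroid on $S$ with rank function $r_M$ and rank $r=r_M(S)$. The base polytope $P(M)\subseteq\mathbb{R}^S$ is the convex hull of the characteristic vectors of the bases of $M$, and $\Delta(r,S)$ is the convex hull of all 0-1 vectors in $\mathbb{R}^S$ with exactly $r$ ones. For a flat $F$, let $H(F)=\{x\in\mathbb{R}^S\mid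 x(F)=r_M(F)\}$, where $x(F)=\sum_{e\in F}x_e$; $P(M)\cap H(F)$ is the face of $P(M)$ defined by $F$. A flat $F$ is a flacet if it defines a facet of $P(M)$ and is inclusionwise minimal among the flats defining this face. A split of a polytope $P$ is a subdivision of $P$ without new vertices that has exactly two maximal cells; the affine span of the intersection of the two cells is its split hyperplane. Two splits of $P$ are compatible if their split hyperplanes do not meet in a relative interior point of $P$. A flacet $F$ is a split flacet if $H(F)$ defines a split of $\Delta(r,S)$. $M$ is a split matroid if its split flacets form a compatible system (i.e. pairwise compatible) of splits of the polytope obtained by intersecting the affine hull of $P(M)$ with the unit cube $[0,1]^S$. For connected $M$ the following known description of these notions may be used (a flat is proper if it has nonzero rank and is not equal to $S$): the split flacets of $M$ are exactly the proper flats $F$ with $|F|\ge 2$ such that $M|F$ and $M/F$ are both connected, and for distinct split flacets $F,G$ the corresponding splits are compatible if and only if $|F\cap G|+r_M(S)\le r_M(F)+r_M(G)$. Thus a connected matroid is a split matroid if and only if this inequality holds for all pairs of distinct split flacets $F,G$. *)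

theory Defs
  imports "HOL-Analysis.Cartesian_Space" "HOL-Library.Z2"
begin

record 'a indep_system =
  ground :: "'a set"
  indeps :: "'a set set"

definition matroid :: "'a indep_system \<Rightarrow> bool" where
  "matroid M \<longleftrightarrow>
     finite (ground M) \<and> indeps M \<subseteq> Pow (ground M) \<and> {} \<in> indeps M \<and>
     (\<forall>I\<in>indeps M. \<forall>J. J \<subseteq> I \<longrightarrow> J \<in> indeps M) \<and>
     (\<forall>I\<in>indeps M. \<forall>J\<in>indeps M. card I < card J \<longrightarrow>
        (\<exists>e\<in>J - I. insert e I \<in> indeps M))"

definition matroid_iso :: "'a indep_system \<Rightarrow> 'b indep_system \<Rightarrow> bool" where
  "matroid_iso M N \<longleftrightarrow>
     (\<exists>f. bij_betw f (ground M) (ground N) \<and>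
          (\<forall>X. X \<subseteq> ground M \<longrightarrow> (X \<in> indeps M \<longleftrightarrow> f ` X \<in> indeps N)))"

definition rk :: "'a indep_system \<Rightarrow> 'a set \<Rightarrow> nat" where
  "rk M X = Max (card ` {I \<in> indeps M. I \<subseteq> X})"

definition basis :: "'a indep_system \<Rightarrow> 'a set \<Rightarrow> bool" where
  "basis M B \<longleftrightarrow> B \<in> indeps M \<and> (\<forall>I\<in>indeps M. B \<subseteq> I \<longrightarrow> I = B)"

definition circuit :: "'a indep_system \<Rightarrow> 'a set \<Rightarrow> bool" where
  "circuit M C \<longleftrightarrow>
     C \<subseteq> ground M \<and> C \<notin> indeps M \<and> (\<forall>D. D \<subset> C \<longrightarrow> D \<in> indeps M)"

definition flat :: "'a indep_system \<Rightarrow> 'a set \<Rightarrow> bool" where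
  "flat M F \<longleftrightarrow> F \<subseteq> ground M \<and> (\<forall>e\<in>ground M - F. rk M F < rk M (insert e F))"

definition dual :: "'a indep_system \<Rightarrow> 'a indep_system" where
  "dual M = \<lparr>ground = ground M,
             indeps = {I. I \<subseteq> ground M \<and> (\<exists>B. basis M B \<and> I \<inter> B = {})}\<rparr>"

definition corank :: "'a indep_system \<Rightarrow> nat" where
  "corank M = rk (dual M) (ground M)"

definition restriction :: "'a indep_system \<Rightarrow> 'a set \<Rightarrow> 'a indep_system" where
  "restriction M F = \<lparr>ground = ground M \<inter> F, indeps = {I \<in> indeps M. I \<subseteq> F}\<rparr>"

text \<open>The rank function of the contraction of \<open>F\<close> is \<open>X \<mapsto> rk M (X \<union> F) - rk M F\<close>.\<close>

definition contraction :: "'a indep_system \<Rightarrow> 'a set \<Rightarrow> 'a indep_system" where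
  "contraction M F =
     \<lparr>ground = ground M - F,
      indeps = {I. I \<subseteq> ground M - F \<and> rk M (I \<union> F) = card I + rk M F}\<rparr>"

definition matroid_connected :: "'a indep_system \<Rightarrow> bool" where
  "matroid_connected M \<longleftrightarrow>
     (\<forall>e\<in>ground M. \<forall>f\<in>ground M. e \<noteq> f \<longrightarrow> (\<exists>C. circuit M C \<and> e \<in> C \<and> f \<in> C))"

definition paving :: "'a indep_system \<Rightarrow> bool" where
  "paving M \<longleftrightarrow> (\<forall>C. circuit M C \<longrightarrow> rk M (ground M) \<le> card C)"

definition sparse_paving :: "'a indep_system \<Rightarrow> bool" where
  "sparse_paving M \<longleftrightarrow> paving M \<and> paving (dual M)"

definition loopless :: "'a indep_system \<Rightarrow> bool" where
  "loopless M \<longleftrightarrow> (\<forall>e\<in>ground M. rk M {e} = 1)"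

definition parallel_classes :: "'a indep_system \<Rightarrow> 'a set set" where
  "parallel_classes M = {F. flat M F \<and> rk M F = 1}"


text \<open>
  Linear independence of the family \<open>(v e)\<close>, \<open>e \<in> X\<close>, of vectors in the \<open>d\<close>-dimensional coordinate
  space over a field; only the coordinates \<open>v e i\<close> with \<open>i < d\<close> matter. The number \<open>d\<close> has to be
  an ordinary variable because representability quantifies over it.
\<close>

definition lin_indep_family :: "nat \<Rightarrow> ('a \<Rightarrow> nat \<Rightarrow> 'f::field) \<Rightarrow> 'a set \<Rightarrow> bool" where
  "lin_indep_family d v X \<longleftrightarrow>
     (\<forall>c. (\<forall>i<d. (\<Sum>e\<in>X. c e * v e i) = 0) \<longrightarrow> (\<forall>e\<in>X. c e = 0))"

definition representation :: "'a indep_system \<Rightarrow> nat \<Rightarrow> ('a \<Rightarrow> nat \<Rightarrow> 'f::field) \<Rightarrow> bool" where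
  "representation M d v \<longleftrightarrow>
     (\<forall>X. X \<subseteq> ground M \<longrightarrow> (X \<in> indeps M \<longleftrightarrow> lin_indep_family d v X))"

definition binary :: "'a indep_system \<Rightarrow> bool" where
  "binary M \<longleftrightarrow> (\<exists>d (v :: 'a \<Rightarrow> nat \<Rightarrow> bit). representation M d v)"


text \<open>
  Split flacets and split matroids. By definition, these notions refer to the base polytope: a
  split flacet is a flacet whose hyperplane defines a split of the hypersimplex, and a matroid is
  split if its split flacets form a compatible system of splits. The two definitions below are the
  known description of these notions for connected matroids, and they are meaningful for connected
  matroids only.
\<close>

definition split_flacet :: "'a indep_system \<Rightarrow> 'a set \<Rightarrow> bool" where
  "split_flacet M F \<longleftrightarrow>
     flat M F \<and> rk M F \<noteq> 0 \<and> F \<noteq> ground M \<and> 2 \<le> card F \<and>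
     matroid_connected (restriction M F) \<and> matroid_connected (contraction M F)"

definition split_matroid :: "'a indep_system \<Rightarrow> bool" where
  "split_matroid M \<longleftrightarrow>
     (\<forall>F G. split_flacet M F \<and> split_flacet M G \<and> F \<noteq> G \<longrightarrow>
        card (F \<inter> G) + rk M (ground M) \<le> rk M F + rk M G)"


definition uniform_matroid :: "nat \<Rightarrow> nat \<Rightarrow> nat indep_system" where
  "uniform_matroid k n = \<lparr>ground = {..<n}, indeps = {I. I \<subseteq> {..<n} \<and> card I \<le> k}\<rparr>"

text \<open>
  The elements of \<open>P\<close>, which are assumed not to belong to \<open>M\<close>, become parallel copies of \<open>e\<close>: an
  independent set contains at most one element of \<open>insert e P\<close>, and replacing that element by \<open>e\<close>
  gives an independent set of \<open>M\<close>.
\<close>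

definition add_parallel :: "'a indep_system \<Rightarrow> 'a \<Rightarrow> 'a set \<Rightarrow> 'a indep_system" where
  "add_parallel M e P =
     \<lparr>ground = ground M \<union> P,
      indeps = {I. I \<subseteq> ground M \<union> P \<and> card (I \<inter> insert e P) \<le> 1 \<and>
                   (\<lambda>x. if x \<in> P then e else x) ` I \<in> indeps M}\<rparr>"

definition complete_graph_edges :: "'v set \<Rightarrow> 'v set set" where
  "complete_graph_edges V = {uv. uv \<subseteq> V \<and> card uv = 2}"

text \<open>The edge set of the closed walk through the vertices \<open>vs\<close>; a cycle if \<open>vs\<close> is distinct of
  length at least three.\<close>

definition closed_walk_edges :: "'v list \<Rightarrow> 'v set set" where
  "closed_walk_edges vs = {{vs ! i, vs ! (Suc i mod length vs)} | i. i < length vs}"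

definition cycle_matroid :: "'v set set \<Rightarrow> 'v set indep_system" where
  "cycle_matroid E =
     \<lparr>ground = E,
      indeps = {X. X \<subseteq> E \<and>
        \<not> (\<exists>vs. distinct vs \<and> 3 \<le> length vs \<and> closed_walk_edges vs \<subseteq> X)}\<rparr>"

definition M_K4 :: "nat set indep_system" where
  "M_K4 = cycle_matroid (complete_graph_edges {..<4})"

definition Fano :: "(bit ^ 3) indep_system" where
  "Fano = \<lparr>ground = UNIV - {0}, indeps = {X. X \<subseteq> UNIV - {0} \<and> vec.independent X}\<rparr>"

definition affinely_independent :: "(bit ^ 3) set \<Rightarrow> bool" where
  "affinely_independent X \<longleftrightarrow>
     (\<forall>c. (\<Sum>x\<in>X. c x) = 0 \<and> (\<Sum>x\<in>X. c x *s x) = 0 \<longrightarrow> (\<forall>x\<in>X. c x = 0))"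

definition AG32 :: "(bit ^ 3) indep_system" where
  "AG32 = \<lparr>ground = UNIV, indeps = {X. affinely_independent X}\<rparr>"


definition in_list_a :: "'a indep_system \<Rightarrow> bool" where
  "in_list_a M \<longleftrightarrow>
     (\<exists>r e P. 2 \<le> r \<and> e < r \<and> finite P \<and> P \<inter> {..<r} = {} \<and>
        matroid_iso M (add_parallel (uniform_matroid (r - 1) r) e P))"

definition three_class_rank2 :: "'a indep_system \<Rightarrow> bool" where
  "three_class_rank2 N \<longleftrightarrow>
     matroid N \<and> loopless N \<and> rk N (ground N) = 2 \<and> card (parallel_classes N) = 3"

text \<open>A matroid isomorphic to \<open>M\<close> can always be taken to live on the element type of \<open>M\<close>.\<close>

definition in_list_b :: "'a indep_system \<Rightarrow> bool" where
  "in_list_b M \<longleftrightarrow>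
     (\<exists>N :: 'a indep_system. three_class_rank2 N \<and> (matroid_iso M N \<or> matroid_iso M (dual N)))"

definition in_list_c :: "'a indep_system \<Rightarrow> bool" where
  "in_list_c M \<longleftrightarrow>
     matroid_iso M M_K4 \<or> matroid_iso M Fano \<or> matroid_iso M (dual Fano) \<or> matroid_iso M AG32"

end

theory Submission
  imports Defs
begin

text \<open>
  A binary matroid is given by its cycle space, a family of sets closed under symmetric difference
  (locale \<open>cycle_space\<close>). Restriction, contraction, duality, connectivity and the rank all have simple
  descriptions in terms of cycles, and the classification becomes one of cycle spaces.

  Let a connected binary split matroid of rank \<open>r\<close> be given. The closure of every circuit with at most \<open>r\<close>
  elements is a split flacet (\<open>split_circuit_flacet\<close>), so the compatibility condition applies to any two such
  closures. Suppose that a circuit \<open>C\<close> has fewer than \<open>r\<close> elements, and let \<open>F\<close> be its closure. Compatibility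
  with the closures of lifted circuits shows that the contraction of \<open>F\<close> is uniform, hence, being binary of
  rank at least two, a single circuit. Compatibility with the closures of circuits inside \<open>F\<close> shows that
  the restriction to \<open>F\<close> is uniform as well, hence a parallel class or the circuit \<open>C\<close> itself
  (\<open>split_nonpaving\<close>). The first case gives family (a), in the second the corank is two. A connected binary
  matroid of rank or corank at most two belongs to (a) or (b) by inspection of its cycle space. The remaining
  matroids are paving with rank and corank at least three.

  For these, the split property plays no role. All nonempty cycles have at least \<open>r\<close> elements. Two fundamental
  cycles have a sum with at most four elements, whence \<open>r \<le> 4\<close>. If \<open>r = 3\<close>, the elements are distinct nonzero
  vectors of dimension three. If \<open>r = 4\<close>, all cycles are even and the elements are distinct vectors of odd
  weight in dimension four. As the corank is at least three, at most one vector is missing in either case, and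
  linear automorphisms show that rank and size determine the matroid
  (\<open>large_paving_unique\<close>). There are four possible pairs of rank and size, and the four matroids of (c) realise
  them. That these are sparse paving, connected and split follows from paving, rank and corank alone
  (\<open>paving_dual_paving\<close>, \<open>paving_connected\<close>, \<open>paving_split\<close>). For (a) and (b), connectivity and the split
  property are read off the cycle spaces.
\<close>

section \<open>Matroids given by a cycle space\<close>

text \<open>
  A binary matroid is determined by its cycle space, the family of all subsets \<open>X\<close> of the ground set
  such that the vectors representing the elements of \<open>X\<close> add up to zero. Conversely, every family of
  sets that contains \<open>{}\<close> and is closed under symmetric difference arises in this way. The
  independent sets are those that contain no nonempty cycle, where "cycle" means a member of the
  family, that is, a disjoint union of circuits.
\<close>

definition matroid_of_cycles :: "'a set \<Rightarrow> 'a set set \<Rightarrow> 'a indep_system" where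
  "matroid_of_cycles E Z =
     \<lparr>ground = E, indeps = {I. I \<subseteq> E \<and> (\<forall>X\<in>Z. X \<subseteq> I \<longrightarrow> X = {})}\<rparr>"

locale cycle_space =
  fixes E :: "'a set" and Z :: "'a set set"
  assumes finite_ground: "finite E"
    and cycle_subset: "X \<in> Z \<Longrightarrow> X \<subseteq> E"
    and empty_cycle: "{} \<in> Z"
    and sym_diff_cycle: "X \<in> Z \<Longrightarrow> Y \<in> Z \<Longrightarrow> sym_diff X Y \<in> Z"
begin

abbreviation M :: "'a indep_system" where
  "M \<equiv> matroid_of_cycles E Z"

text \<open>
  The closure of \<open>A\<close>: the elements that are congruent to a subset of \<open>A\<close> modulo the cycle space. The
  definition makes sense for all \<open>A\<close>, but it is the matroid closure only for \<open>A \<subseteq> E\<close>.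
\<close>

definition cl :: "'a set \<Rightarrow> 'a set" where
  "cl A = {e \<in> E. \<exists>W\<subseteq>A. sym_diff {e} W \<in> Z}"

lemma ground_M [simp]: "ground M = E"
  by (simp add: matroid_of_cycles_def)

lemma indep_iff: "I \<in> indeps M \<longleftrightarrow> I \<subseteq> E \<and> (\<forall>X\<in>Z. X \<subseteq> I \<longrightarrow> X = {})"
  by (simp add: matroid_of_cycles_def)

lemma indep_subset: "I \<in> indeps M \<Longrightarrow> J \<subseteq> I \<Longrightarrow> J \<in> indeps M"
  unfolding indep_iff by blast

lemma finite_subset_ground: "A \<subseteq> E \<Longrightarrow> finite A"
  using finite_ground finite_subset by blast

lemma cl_subset_ground: "cl A \<subseteq> E"
  by (auto simp: cl_def)

lemma subset_cl: "A \<subseteq> E \<Longrightarrow> A \<subseteq> cl A"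
  unfolding cl_def using empty_cycle by (auto intro!: exI[of _ "{_}"])

lemma cl_mono: "A \<subseteq> B \<Longrightarrow> cl A \<subseteq> cl B"
  unfolding cl_def by blast

text \<open>
  Reduction: modulo the cycle space, every set spanned by \<open>A\<close> is congruent to a subset of \<open>A\<close>. This
  replaces linear algebra over the two-element field.
\<close>

lemma spanned_reduces:
  assumes "Y \<subseteq> cl A"
  shows "\<exists>W\<subseteq>A. sym_diff Y W \<in> Z"
proof -
  have "finite Y"
    using assms cl_subset_ground finite_subset_ground by blast
  then show ?thesis
    using assms
  proof (induction Y rule: finite_induct)
    case empty
    then show ?case using empty_cycle by auto
  next
    case (insert e Y)
    then obtain W where W: "W \<subseteq> A" "sym_diff Y W \<in> Z" by auto
    obtain V where V: "V \<subseteq> A" "sym_diff {e} V \<in> Z"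
      using insert.prems unfolding cl_def by auto
    have "sym_diff (sym_diff Y W) (sym_diff {e} V) = sym_diff (insert e Y) (sym_diff W V)"
      using insert.hyps by auto
    then have "sym_diff (insert e Y) (sym_diff W V) \<in> Z"
      using sym_diff_cycle[OF W(2) V(2)] by simp
    then show ?case using W(1) V(1) by (intro exI[of _ "sym_diff W V"]) auto
  qed
qed

lemma in_cl_iff:
  assumes "A \<subseteq> E"
  shows "e \<in> cl A \<longleftrightarrow> e \<in> A \<or> (\<exists>W\<subseteq>A. e \<notin> W \<and> insert e W \<in> Z)"
proof
  assume "e \<in> cl A"
  then obtain W where W: "W \<subseteq> A" "sym_diff {e} W \<in> Z" by (auto simp: cl_def)
  show "e \<in> A \<or> (\<exists>W\<subseteq>A. e \<notin> W \<and> insert e W \<in> Z)"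
  proof (cases "e \<in> W")
    case False
    then have "sym_diff {e} W = insert e W" by auto
    then show ?thesis using W False by metis
  qed (use W in auto)
next
  assume *: "e \<in> A \<or> (\<exists>W\<subseteq>A. e \<notin> W \<and> insert e W \<in> Z)"
  show "e \<in> cl A"
  proof (cases "e \<in> A")
    case True
    then show ?thesis using subset_cl[OF assms] by auto
  next
    case False
    then obtain W where W: "W \<subseteq> A" "e \<notin> W" "insert e W \<in> Z" using * by auto
    moreover have "sym_diff {e} W = insert e W" using W by auto
    ultimately show ?thesis unfolding cl_def using cycle_subset[OF W(3)] by auto
  qed
qed

lemma cl_cl: "cl (cl A) = cl A" if "A \<subseteq> E"
proof
  show "cl (cl A) \<subseteq> cl A"
  proof
    fix e assume e: "e \<in> cl (cl A)"
    then obtain W where W: "W \<subseteq> cl A" "sym_diff {e} W \<in> Z" by (auto simp: cl_def)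
    obtain V where V: "V \<subseteq> A" "sym_diff W V \<in> Z" using spanned_reduces[OF W(1)] by auto
    have "sym_diff (sym_diff {e} W) (sym_diff W V) = sym_diff {e} V" by auto
    then have "sym_diff {e} V \<in> Z" using sym_diff_cycle[OF W(2) V(2)] by simp
    then show "e \<in> cl A" using V(1) e unfolding cl_def by blast
  qed
qed (use subset_cl cl_subset_ground in blast)

lemma cl_subset_cl: "A \<subseteq> cl B \<Longrightarrow> B \<subseteq> E \<Longrightarrow> cl A \<subseteq> cl B"
  using cl_mono cl_cl by metis

lemma indep_insert_iff:
  assumes "I \<in> indeps M" "e \<in> E" "e \<notin> I"
  shows "insert e I \<in> indeps M \<longleftrightarrow> e \<notin> cl I"
proof -
  have IE: "I \<subseteq> E" using assms by (simp add: indep_iff)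
  show ?thesis
  proof
    assume i: "insert e I \<in> indeps M"
    show "e \<notin> cl I"
    proof
      assume "e \<in> cl I"
      then obtain W where "W \<subseteq> I" "insert e W \<in> Z" using in_cl_iff[OF IE] assms by auto
      then show False using i unfolding indep_iff by (meson insert_mono insert_not_empty)
    qed
  next
    assume e: "e \<notin> cl I"
    show "insert e I \<in> indeps M"
      unfolding indep_iff
    proof (intro conjI ballI impI)
      show "insert e I \<subseteq> E" using IE assms by auto
      fix X assume X: "X \<in> Z" "X \<subseteq> insert e I"
      have "e \<notin> X"
      proof
        assume "e \<in> X"
        then have "insert e (X - {e}) \<in> Z" "X - {e} \<subseteq> I" using X by (auto simp: insert_absorb)
        then show False using e in_cl_iff[OF IE] by blast
      qed
      then show "X = {}" using X assms(1) unfolding indep_iff by blast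
    qed
  qed
qed

text \<open>
  This is the exchange property in the form of a count: reduction maps the subsets of \<open>I\<close> injectively
  to subsets of \<open>A\<close>, so that \<open>2 ^ card I \<le> 2 ^ card A\<close>.
\<close>

lemma card_indep_le:
  assumes "I \<in> indeps M" "I \<subseteq> cl A" "finite A"
  shows "card I \<le> card A"
proof -
  have "\<forall>Y\<in>Pow I. \<exists>W. W \<subseteq> A \<and> sym_diff Y W \<in> Z"
    using spanned_reduces assms(2) by (meson PowD subset_trans)
  then obtain w where w: "\<And>Y. Y \<in> Pow I \<Longrightarrow> w Y \<subseteq> A \<and> sym_diff Y (w Y) \<in> Z"
    by metis
  have inj: "inj_on w (Pow I)"
  proof (rule inj_onI)
    fix X Y assume XY: "X \<in> Pow I" "Y \<in> Pow I" "w X = w Y"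
    have "sym_diff (sym_diff X (w X)) (sym_diff Y (w Y)) = sym_diff X Y" using XY(3) by auto
    then have "sym_diff X Y \<in> Z" using sym_diff_cycle w XY by metis
    moreover have "sym_diff X Y \<subseteq> I" using XY by auto
    ultimately have "sym_diff X Y = {}" using assms(1) unfolding indep_iff by blast
    then show "X = Y" by auto
  qed
  have "card (Pow I) \<le> card (Pow A)"
    by (rule card_inj_on_le[OF inj]) (use w assms(3) in auto)
  moreover have "finite I" using assms(1) finite_subset_ground by (simp add: indep_iff)
  ultimately show ?thesis using assms(3) by (simp add: card_Pow)
qed

lemma empty_indep: "{} \<in> indeps M"
  by (simp add: indep_iff)

lemma matroid_M: "matroid M"
  unfolding matroid_def
proof (intro conjI ballI allI impI)
  fix I J assume IJ: "I \<in> indeps M" "J \<in> indeps M" "card I < card J"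
  have IE: "I \<subseteq> E" "J \<subseteq> E" using IJ by (auto simp: indep_iff)
  have "\<not> J \<subseteq> cl I"
    using card_indep_le[OF IJ(2) _ finite_subset_ground[OF IE(1)]] IJ(3) by linarith
  then obtain e where "e \<in> J" "e \<notin> cl I" by auto
  moreover have "e \<notin> I" using \<open>e \<notin> cl I\<close> subset_cl[OF IE(1)] by auto
  ultimately show "\<exists>e\<in>J - I. insert e I \<in> indeps M"
    using indep_insert_iff[OF IJ(1)] IE by auto
qed (use finite_ground indep_subset empty_indep in \<open>auto simp: indep_iff\<close>)

text \<open>
  \<open>I\<close> is a maximal independent subset of \<open>X\<close>.
\<close>

definition basis_in :: "'a set \<Rightarrow> 'a set \<Rightarrow> bool" where
  "basis_in X I \<longleftrightarrow> I \<in> indeps M \<and> I \<subseteq> X \<and> X \<subseteq> cl I"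

lemma basis_in_extends:
  assumes "J \<in> indeps M" "J \<subseteq> X" "X \<subseteq> E"
  obtains I where "basis_in X I" "J \<subseteq> I"
proof -
  let ?S = "{I \<in> indeps M. J \<subseteq> I \<and> I \<subseteq> X}"
  have "finite ?S" by (rule finite_subset[of _ "Pow E"]) (use finite_ground assms in auto)
  moreover have "J \<in> ?S" using assms by auto
  ultimately have "\<exists>I\<in>?S. J \<subseteq> I \<and> (\<forall>K\<in>?S. I \<subseteq> K \<longrightarrow> I = K)"
    by (rule finite_has_maximal2)
  then obtain I where I0: "I \<in> ?S" and max: "\<forall>K\<in>?S. I \<subseteq> K \<longrightarrow> I = K"
    by (elim bexE conjE) (rule that)
  have I: "I \<in> indeps M" "J \<subseteq> I" "I \<subseteq> X" using I0 by simp_all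
  have "X \<subseteq> cl I"
  proof
    fix e assume e: "e \<in> X"
    show "e \<in> cl I"
    proof (cases "e \<in> I")
      case True
      then show ?thesis using subset_cl[of I] I(3) assms(3) by auto
    next
      case False
      then have "insert e I \<notin> indeps M"
        using max[rule_format, of "insert e I"] I e by auto
      then show ?thesis using indep_insert_iff[of I e] False e I assms(3) by auto
    qed
  qed
  then show ?thesis using that I unfolding basis_in_def by blast
qed

lemma rk_basis_in:
  assumes "basis_in X I"
  shows "rk M X = card I"
  unfolding rk_def
proof (rule Max_eqI)
  show "finite (card ` {I \<in> indeps M. I \<subseteq> X})"
    by (rule finite_imageI, rule finite_subset[of _ "Pow E"]) (use finite_ground in \<open>auto simp: indep_iff\<close>)
  show "card I \<in> card ` {I \<in> indeps M. I \<subseteq> X}" using assms by (auto simp: basis_in_def)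
  fix k assume "k \<in> card ` {I \<in> indeps M. I \<subseteq> X}"
  then obtain J where J: "J \<in> indeps M" "J \<subseteq> X" "k = card J" by auto
  moreover have "finite I" using assms finite_subset_ground by (auto simp: basis_in_def indep_iff)
  ultimately show "k \<le> card I" using card_indep_le assms unfolding basis_in_def by blast
qed

lemma basis_in_exists:
  assumes "X \<subseteq> E"
  obtains I where "basis_in X I" "card I = rk M X"
  using basis_in_extends[OF empty_indep _ assms] rk_basis_in by (metis empty_subsetI)

lemma rk_indep: "I \<in> indeps M \<Longrightarrow> rk M I = card I"
  using rk_basis_in[of I I] subset_cl by (auto simp: basis_in_def indep_iff)

lemma indep_card_le_rk:
  assumes "I \<in> indeps M" "I \<subseteq> X" "X \<subseteq> E"
  shows "card I \<le> rk M X"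
proof -
  obtain J where J: "basis_in X J" "I \<subseteq> J" using basis_in_extends[OF assms] .
  then show ?thesis using rk_basis_in card_mono[of J I] finite_subset_ground
    by (auto simp: basis_in_def indep_iff)
qed

lemma rk_mono:
  assumes "X \<subseteq> Y" "Y \<subseteq> E"
  shows "rk M X \<le> rk M Y"
  using basis_in_exists[of X] indep_card_le_rk[of _ Y] assms unfolding basis_in_def
  by (metis subset_trans)

lemma rk_le_card: "X \<subseteq> E \<Longrightarrow> rk M X \<le> card X"
  by (metis basis_in_exists basis_in_def card_mono finite_subset_ground)

lemma basis_in_cl: "basis_in X I \<Longrightarrow> X \<subseteq> E \<Longrightarrow> cl X = cl I"
  unfolding basis_in_def using cl_subset_cl cl_mono by (metis subset_antisym subset_trans)

lemma rk_eq_if_cl: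
  assumes "X \<subseteq> Y" "Y \<subseteq> cl X" "X \<subseteq> E"
  shows "rk M Y = rk M X"
proof -
  obtain I where I: "basis_in X I" "card I = rk M X" using basis_in_exists assms(3) by metis
  have "basis_in Y I"
    using I(1) basis_in_cl[OF I(1) assms(3)] assms unfolding basis_in_def by auto
  then show ?thesis using rk_basis_in I by auto
qed

lemma rk_cl: "X \<subseteq> E \<Longrightarrow> rk M (cl X) = rk M X"
  using rk_eq_if_cl subset_cl by blast

lemma rk_insert_notin:
  assumes "X \<subseteq> E" "e \<in> E" "e \<notin> cl X"
  shows "rk M (insert e X) = Suc (rk M X)"
proof -
  obtain I where I: "basis_in X I" "card I = rk M X" using basis_in_exists assms(1) by metis
  have eI: "e \<notin> I" "e \<notin> cl I" using basis_in_cl[OF I(1) assms(1)] assms I subset_cl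
    unfolding basis_in_def by auto
  have "insert e I \<in> indeps M" using indep_insert_iff eI assms I unfolding basis_in_def by auto
  moreover have "insert e X \<subseteq> cl (insert e I)"
  proof -
    have "insert e I \<subseteq> E" using I assms unfolding basis_in_def by auto
    moreover have "X \<subseteq> cl (insert e I)"
      using cl_mono[of I "insert e I", OF subset_insertI] I unfolding basis_in_def by blast
    ultimately show ?thesis using subset_cl[of "insert e I"] by blast
  qed
  ultimately have "basis_in (insert e X) (insert e I)"
    using I unfolding basis_in_def by auto
  moreover have "finite I" using I finite_subset_ground by (auto simp: basis_in_def indep_iff)
  ultimately show ?thesis using rk_basis_in eI I by auto
qed

lemma flat_iff: "flat M F \<longleftrightarrow> F \<subseteq> E \<and> cl F = F"
proof (cases "F \<subseteq> E")
  case True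
  have "rk M F < rk M (insert e F) \<longleftrightarrow> e \<notin> cl F" if "e \<in> E - F" for e
  proof (cases "e \<in> cl F")
    case True2: True
    then have "rk M (insert e F) = rk M F"
      using rk_eq_if_cl[of F "insert e F", OF subset_insertI] subset_cl[OF True] True by blast
    then show ?thesis using True2 by simp
  next
    case False
    then show ?thesis using rk_insert_notin[OF True] that by simp
  qed
  then have "flat M F \<longleftrightarrow> (\<forall>e\<in>E - F. e \<notin> cl F)" using True by (simp add: flat_def)
  also have "\<dots> \<longleftrightarrow> cl F = F" using True subset_cl[of F] cl_subset_ground by blast
  finally show ?thesis using True by simp
qed (simp add: flat_def)

lemma rk_proper_cl:
  assumes "X \<subseteq> E" "cl X \<noteq> E"
  shows "rk M X < rk M E"
proof -
  obtain e where e: "e \<in> E" "e \<notin> cl X" using assms cl_subset_ground by blast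
  then have "Suc (rk M X) \<le> rk M E"
    using rk_insert_notin[OF assms(1) e] rk_mono[of "insert e X" E] assms(1) by simp
  then show ?thesis by simp
qed

lemma circuit_iff:
  "circuit M C \<longleftrightarrow> C \<in> Z \<and> C \<noteq> {} \<and> (\<forall>X\<in>Z. X \<subseteq> C \<longrightarrow> X = {} \<or> X = C)"
proof
  assume C: "circuit M C"
  then have "C \<subseteq> E" "C \<notin> indeps M" by (auto simp: circuit_def)
  then obtain X where X: "X \<in> Z" "X \<subseteq> C" "X \<noteq> {}" by (auto simp: indep_iff)
  have *: "Y = {} \<or> Y = C" if "Y \<in> Z" "Y \<subseteq> C" for Y
    using C that unfolding circuit_def indep_iff by blast
  then show "C \<in> Z \<and> C \<noteq> {} \<and> (\<forall>X\<in>Z. X \<subseteq> C \<longrightarrow> X = {} \<or> X = C)" using X by blast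
next
  assume C: "C \<in> Z \<and> C \<noteq> {} \<and> (\<forall>X\<in>Z. X \<subseteq> C \<longrightarrow> X = {} \<or> X = C)"
  then have CE: "C \<subseteq> E" "C \<notin> indeps M" using cycle_subset by (auto simp: indep_iff)
  have "D \<in> indeps M" if "D \<subset> C" for D
    unfolding indep_iff
  proof (intro conjI ballI impI)
    show "D \<subseteq> E" using that CE by blast
    fix X assume "X \<in> Z" "X \<subseteq> D"
    then show "X = {}" using C that by blast
  qed
  then show "circuit M C" unfolding circuit_def using CE by auto
qed

lemma circuit_through:
  assumes "X \<in> Z" "e \<in> X"
  obtains C where "circuit M C" "C \<subseteq> X" "e \<in> C"
proof -
  have "\<exists>C. circuit M C \<and> C \<subseteq> X \<and> e \<in> C"
    using assms
  proof (induction "card X" arbitrary: X rule: less_induct)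
    case less
    show ?case
    proof (cases "circuit M X")
      case False
      then obtain Y where Y: "Y \<in> Z" "Y \<subseteq> X" "Y \<noteq> {}" "Y \<noteq> X"
        using less.prems circuit_iff by blast
      have fin: "finite X" using less.prems cycle_subset finite_subset_ground by auto
      have eq: "sym_diff X Y = X - Y" using Y by auto
      then have XY: "X - Y \<in> Z" using sym_diff_cycle[OF less.prems(1) Y(1)] by simp
      have "card Y < card X" "card (X - Y) < card X"
        using Y fin by (auto intro!: psubset_card_mono)
      then show ?thesis using less.hyps[of Y] less.hyps[of "X - Y"] XY Y less.prems by blast
    qed (use less.prems in auto)
  qed
  then show ?thesis using that by auto
qed

lemma circuit_basis:
  assumes "circuit M C" "c \<in> C"
  shows "basis_in C (C - {c})" "rk M C = card C - 1"
proof -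
  have C: "C \<in> Z" "C \<subseteq> E" using assms(1) cycle_subset by (auto simp: circuit_iff)
  have "C - {c} \<in> indeps M" using assms unfolding circuit_def by auto
  moreover have "C \<subseteq> cl (C - {c})"
  proof
    fix x assume x: "x \<in> C"
    have "insert c (C - {c}) \<in> Z" using C assms(2) by (simp add: insert_absorb)
    have CE: "C - {c} \<subseteq> E" using C by auto
    show "x \<in> cl (C - {c})"
      unfolding in_cl_iff[OF CE]
    proof (cases "x = c")
      case True
      then show "x \<in> C - {c} \<or> (\<exists>W\<subseteq>C - {c}. x \<notin> W \<and> insert x W \<in> Z)"
        using \<open>insert c (C - {c}) \<in> Z\<close> by blast
    qed (use x in blast)
  qed
  ultimately show *: "basis_in C (C - {c})" unfolding basis_in_def by auto
  show "rk M C = card C - 1" using rk_basis_in[OF *] assms by simp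
qed

lemma circuit_card_le:
  assumes "circuit M C"
  shows "card C \<le> Suc (rk M E)" "0 < card C"
proof -
  have "C \<subseteq> E" "C \<noteq> {}" using assms cycle_subset by (auto simp: circuit_iff)
  then show "0 < card C" using finite_subset_ground by (simp add: card_gt_0_iff)
  show "card C \<le> Suc (rk M E)" using rk_mono[of C E] circuit_basis(2)[OF assms] \<open>C \<subseteq> E\<close> \<open>C \<noteq> {}\<close> by fastforce
qed

text \<open>
  \<open>A\<close> is a union of connected components: the cycle space is the direct sum of its parts on \<open>A\<close> and on
  \<open>E - A\<close>.
\<close>

definition separator :: "'a set \<Rightarrow> bool" where
  "separator A \<longleftrightarrow> A \<subseteq> E \<and> (\<forall>X\<in>Z. X \<inter> A \<in> Z)"

lemma separator_Diff:
  assumes "separator A"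
  shows "separator (E - A)"
  unfolding separator_def
proof (intro conjI ballI)
  fix X assume X: "X \<in> Z"
  have "sym_diff X (X \<inter> A) = X \<inter> (E - A)" using cycle_subset[OF X] by auto
  then show "X \<inter> (E - A) \<in> Z" using sym_diff_cycle X assms unfolding separator_def by metis
qed auto

lemma circuit_separator:
  assumes "separator A" "circuit M C" "e \<in> C" "e \<in> A"
  shows "C \<subseteq> A"
proof -
  have "C \<inter> A \<in> Z" using assms unfolding separator_def circuit_iff by auto
  then have "C \<inter> A = C" using assms unfolding circuit_iff by blast
  then show ?thesis by auto
qed

text \<open>
  Lying in a common circuit is a transitive relation. The induction decreases \<open>C1 \<union> C2\<close>: if \<open>C1\<close> contains
  \<open>e\<close>, \<open>C2\<close> contains \<open>g\<close>, and their symmetric difference contains disjoint circuits \<open>D1\<close> through \<open>e\<close> and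
  \<open>D2\<close> through \<open>g\<close>, then \<open>D1\<close> and \<open>C2\<close> still meet, and their union misses the elements of \<open>D2 \<inter> C1\<close>.
\<close>

lemma common_circuit_trans:
  assumes "circuit M C1" "circuit M C2" "e \<in> C1" "g \<in> C2" "C1 \<inter> C2 \<noteq> {}"
  shows "\<exists>C. circuit M C \<and> e \<in> C \<and> g \<in> C"
  using assms
proof (induction "card (C1 \<union> C2)" arbitrary: C1 C2 rule: less_induct)
  case less
  show ?case
  proof (cases "e \<in> C2 \<or> g \<in> C1")
    case False
    have C: "C1 \<in> Z" "C2 \<in> Z" using less.prems by (auto simp: circuit_iff)
    then have D: "sym_diff C1 C2 \<in> Z" by (rule sym_diff_cycle)
    have "e \<in> sym_diff C1 C2" using False less.prems by auto
    then obtain D1 where D1: "circuit M D1" "D1 \<subseteq> sym_diff C1 C2" "e \<in> D1"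
      using circuit_through[OF D] by metis
    show ?thesis
    proof (cases "g \<in> D1")
      case False2: False
      have D1Z: "D1 \<in> Z" using D1 by (auto simp: circuit_iff)
      have "sym_diff (sym_diff C1 C2) D1 = sym_diff C1 C2 - D1" using D1 by auto
      then have "sym_diff C1 C2 - D1 \<in> Z" using sym_diff_cycle[OF D D1Z] by simp
      moreover have "g \<in> sym_diff C1 C2 - D1" using False False2 less.prems by auto
      ultimately obtain D2 where D2: "circuit M D2" "D2 \<subseteq> sym_diff C1 C2 - D1" "g \<in> D2"
        using circuit_through by metis
      have D2Z: "D2 \<in> Z" using D2 by (auto simp: circuit_iff)
      have m1: "D1 \<inter> C2 \<noteq> {}"
      proof
        assume "D1 \<inter> C2 = {}"
        then have "D1 \<subseteq> C1" "D1 \<noteq> {}" using D1 by auto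
        then have "D1 = C1" using less.prems(1) D1Z unfolding circuit_iff by blast
        then show False using \<open>D1 \<inter> C2 = {}\<close> less.prems by auto
      qed
      have m2: "D2 \<inter> C1 \<noteq> {}"
      proof
        assume "D2 \<inter> C1 = {}"
        then have "D2 \<subseteq> C2" "D2 \<noteq> {}" using D2 by auto
        then have "D2 = C2" using less.prems(2) D2Z unfolding circuit_iff by blast
        then show False using \<open>D2 \<inter> C1 = {}\<close> less.prems by auto
      qed
      have "finite (C1 \<union> C2)" using C cycle_subset finite_subset_ground by auto
      moreover have "D1 \<union> C2 \<subset> C1 \<union> C2" using D1(2) D2(2) m2 by blast
      ultimately have "card (D1 \<union> C2) < card (C1 \<union> C2)" by (rule psubset_card_mono)
      then show ?thesis using less.hyps[of D1 C2] D1 less.prems m1 by blast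
    qed (use D1 in blast)
  qed (use less.prems in blast)
qed

lemma connected_iff:
  "matroid_connected M \<longleftrightarrow> (\<forall>A. separator A \<longrightarrow> A = {} \<or> A = E)"
proof
  assume conn: "matroid_connected M"
  show "\<forall>A. separator A \<longrightarrow> A = {} \<or> A = E"
  proof (intro allI impI)
    fix A assume A: "separator A"
    show "A = {} \<or> A = E"
    proof (rule ccontr)
      assume "\<not> (A = {} \<or> A = E)"
      moreover have "A \<subseteq> E" using A by (simp add: separator_def)
      ultimately obtain e f where ef: "e \<in> A" "f \<in> E - A" by auto
      then obtain C where "circuit M C" "e \<in> C" "f \<in> C"
        using conn \<open>A \<subseteq> E\<close> unfolding matroid_connected_def ground_M by (metis DiffD1 DiffD2 subsetD)
      then show False using circuit_separator A ef by blast
    qed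
  qed
next
  assume sep: "\<forall>A. separator A \<longrightarrow> A = {} \<or> A = E"
  show "matroid_connected M"
    unfolding matroid_connected_def ground_M
  proof (intro ballI impI)
    fix e f assume ef: "e \<in> E" "f \<in> E" "e \<noteq> f"
    \<comment> \<open>the connected component of \<open>e\<close>\<close>
    define A where "A = insert e {x. \<exists>C. circuit M C \<and> e \<in> C \<and> x \<in> C}"
    have AC: "C \<subseteq> A" if C: "circuit M C" "x \<in> C" "x \<in> A" for C x
    proof
      fix y assume y: "y \<in> C"
      show "y \<in> A"
      proof (cases "e \<in> C")
        case False
        then obtain D where "circuit M D" "e \<in> D" "x \<in> D" using C unfolding A_def by auto
        then show ?thesis using common_circuit_trans[of D C e y] C y unfolding A_def by blast
      qed (use C y in \<open>auto simp: A_def\<close>)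
    qed
    have XA: "X \<inter> A \<in> Z" if "X \<in> Z" for X
      using that
    proof (induction "card X" arbitrary: X rule: less_induct)
      case less
      show ?case
      proof (cases "X \<inter> A = {}")
        case False
        then obtain x where x: "x \<in> X" "x \<in> A" by auto
        then obtain C where C: "circuit M C" "C \<subseteq> X" "x \<in> C"
          using circuit_through[OF less.prems] by metis
        have CA: "C \<subseteq> A" using AC C x by auto
        have CZ: "C \<in> Z" using C by (auto simp: circuit_iff)
        have "sym_diff X C = X - C" using C by auto
        then have "X - C \<in> Z" using sym_diff_cycle[OF less.prems CZ] by simp
        moreover have "card (X - C) < card X"
          using C x cycle_subset[OF less.prems] finite_subset_ground by (intro psubset_card_mono) auto
        ultimately have "(X - C) \<inter> A \<in> Z" using less.hyps by blast
        then have "sym_diff ((X - C) \<inter> A) C \<in> Z" using CZ sym_diff_cycle by blast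
        moreover have "sym_diff ((X - C) \<inter> A) C = X \<inter> A" using C CA by auto
        ultimately show ?thesis by simp
      qed (simp add: empty_cycle)
    qed
    have "A \<subseteq> E" unfolding A_def using ef by (auto simp: circuit_def)
    then have "separator A" unfolding separator_def using XA by auto
    then have "A = E" using sep unfolding A_def by auto
    then show "\<exists>C. circuit M C \<and> e \<in> C \<and> f \<in> C" using ef unfolding A_def by auto
  qed
qed

end

section \<open>Restriction and contraction\<close>

lemma cycle_space_restrict:
  assumes "cycle_space E Z" "F \<subseteq> E"
  shows "cycle_space F (Z \<inter> Pow F)"
proof -
  interpret cycle_space E Z by fact
  show ?thesis
  proof
    show "finite F" using assms finite_subset_ground by auto
    show "sym_diff X Y \<in> Z \<inter> Pow F" if "X \<in> Z \<inter> Pow F" "Y \<in> Z \<inter> Pow F" for X Y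
      using that sym_diff_cycle by blast
  qed (use empty_cycle in auto)
qed

lemma restriction_cycles:
  assumes "F \<subseteq> E"
  shows "restriction (matroid_of_cycles E Z) F = matroid_of_cycles F (Z \<inter> Pow F)"
proof -
  have "(\<forall>X\<in>Z \<inter> Pow F. X \<subseteq> I \<longrightarrow> X = {}) \<longleftrightarrow> (\<forall>X\<in>Z. X \<subseteq> I \<longrightarrow> X = {})" if "I \<subseteq> F" for I
    using that by blast
  then have "{I \<in> {I. I \<subseteq> E \<and> (\<forall>X\<in>Z. X \<subseteq> I \<longrightarrow> X = {})}. I \<subseteq> F} =
      {I. I \<subseteq> F \<and> (\<forall>X\<in>Z \<inter> Pow F. X \<subseteq> I \<longrightarrow> X = {})}"
    using assms by (intro Collect_cong) (simp, metis subset_trans)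
  moreover have "E \<inter> F = F" using assms by blast
  ultimately show ?thesis
    unfolding restriction_def matroid_of_cycles_def by simp
qed

lemma cycle_space_contract:
  assumes "cycle_space E Z"
  shows "cycle_space (E - F) ((\<lambda>X. X - F) ` Z)"
proof -
  interpret cycle_space E Z by fact
  show ?thesis
  proof
    fix X Y assume "X \<in> (\<lambda>X. X - F) ` Z" "Y \<in> (\<lambda>X. X - F) ` Z"
    then obtain X' Y' where "X' \<in> Z" "Y' \<in> Z" "X = X' - F" "Y = Y' - F" by auto
    moreover have "sym_diff (X' - F) (Y' - F) = sym_diff X' Y' - F" by auto
    ultimately show "sym_diff X Y \<in> (\<lambda>X. X - F) ` Z" using sym_diff_cycle by auto
  qed (use finite_ground cycle_subset empty_cycle in \<open>auto simp: image_iff intro!: bexI[of _ "{}"]\<close>)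
qed

lemma (in cycle_space) contraction_cycles:
  assumes F: "F \<subseteq> E"
  shows "contraction M F = matroid_of_cycles (E - F) ((\<lambda>X. X - F) ` Z)"
proof -
  have "rk M (I \<union> F) = card I + rk M F \<longleftrightarrow> (\<forall>X\<in>Z. X - F \<subseteq> I \<longrightarrow> X - F = {})"
    if I: "I \<subseteq> E - F" for I
  proof -
    obtain B where B: "basis_in F B" "card B = rk M F" using basis_in_exists[OF F] by metis
    have BF: "B \<subseteq> F" "B \<in> indeps M" "F \<subseteq> cl B" using B by (auto simp: basis_in_def)
    have fin: "finite I" "finite B" using I F BF finite_subset_ground by (meson Diff_subset subset_trans)+
    have card: "card (I \<union> B) = card I + card B" using I BF fin by (intro card_Un_disjoint) auto
    have IBE: "I \<union> B \<subseteq> E" "I \<union> F \<subseteq> E" using I F BF by auto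
    have spn: "I \<union> F \<subseteq> cl (I \<union> B)"
      using subset_cl[OF IBE(1)] cl_mono[of B "I \<union> B"] BF by auto
    have rk: "rk M (I \<union> F) = rk M (I \<union> B)"
      using rk_eq_if_cl[of "I \<union> B" "I \<union> F"] BF spn IBE by auto
    have "rk M (I \<union> F) = card I + rk M F \<longleftrightarrow> I \<union> B \<in> indeps M"
    proof
      assume "I \<union> B \<in> indeps M"
      then show "rk M (I \<union> F) = card I + rk M F" using rk_indep rk card B by auto
    next
      assume *: "rk M (I \<union> F) = card I + rk M F"
      obtain J where J: "basis_in (I \<union> B) J" "card J = rk M (I \<union> B)"
        using basis_in_exists[OF IBE(1)] by metis
      then have "J \<subseteq> I \<union> B" "card J = card (I \<union> B)"
        using * rk card B(2) by (auto simp: basis_in_def)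
      then have "J = I \<union> B" using fin by (simp add: card_subset_eq)
      then show "I \<union> B \<in> indeps M" using J by (auto simp: basis_in_def)
    qed
    also have "\<dots> \<longleftrightarrow> (\<forall>X\<in>Z. X - F \<subseteq> I \<longrightarrow> X - F = {})"
    proof
      assume ind: "I \<union> B \<in> indeps M"
      show "\<forall>X\<in>Z. X - F \<subseteq> I \<longrightarrow> X - F = {}"
      proof (intro ballI impI)
        fix X assume X: "X \<in> Z" "X - F \<subseteq> I"
        obtain W where W: "W \<subseteq> B" "sym_diff (X \<inter> F) W \<in> Z"
          using spanned_reduces[of "X \<inter> F" B] BF by auto
        let ?Y = "sym_diff X (sym_diff (X \<inter> F) W)"
        have "?Y \<in> Z" using sym_diff_cycle X W by blast
        moreover have Y: "?Y = (X - F) \<union> W" using W BF by auto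
        moreover have "(X - F) \<union> W \<subseteq> I \<union> B" using X W by blast
        ultimately have "(X - F) \<union> W = {}" using ind unfolding indep_iff by metis
        then show "X - F = {}" by auto
      qed
    next
      assume *: "\<forall>X\<in>Z. X - F \<subseteq> I \<longrightarrow> X - F = {}"
      show "I \<union> B \<in> indeps M"
        unfolding indep_iff
      proof (intro conjI ballI impI IBE)
        fix X assume X: "X \<in> Z" "X \<subseteq> I \<union> B"
        then have "X - F \<subseteq> I" using BF(1) by blast
        then have "X - F = {}" using * X(1) by metis
        then have "X \<subseteq> B" using X I by auto
        then show "X = {}" using BF(2) X(1) unfolding indep_iff by blast
      qed
    qed
    finally show ?thesis .
  qed
  then show ?thesis
    unfolding contraction_def ground_M by (simp add: matroid_of_cycles_def cong: conj_cong)
qed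

section \<open>Coordinates, duality, representability and isomorphism\<close>

lemma even_card_sym_diff:
  assumes "finite A" "finite B"
  shows "even (card (sym_diff A B)) \<longleftrightarrow> (even (card A) \<longleftrightarrow> even (card B))"
proof -
  have "card (sym_diff A B) = card (A - B) + card (B - A)"
    using assms by (intro card_Un_disjoint) auto
  moreover have "card A = card (A - B) + card (A \<inter> B)"
    using assms by (simp add: card_Diff_subset_Int card_mono)
  moreover have "card B = card (B - A) + card (A \<inter> B)"
    using assms by (simp add: card_Diff_subset_Int card_mono Int_commute)
  ultimately show ?thesis by presburger
qed

text \<open>
  The orthogonal complement of the cycle space; it is the cycle space of the dual matroid.
\<close>

definition cocycles :: "'a set \<Rightarrow> 'a set set \<Rightarrow> 'a set set" where
  "cocycles E Z = {D. D \<subseteq> E \<and> (\<forall>X\<in>Z. even (card (X \<inter> D)))}"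

context cycle_space
begin

lemma cycle_space_cocycles: "cycle_space E (cocycles E Z)"
proof
  fix D D' assume D: "D \<in> cocycles E Z" "D' \<in> cocycles E Z"
  have "even (card (X \<inter> sym_diff D D'))" if "X \<in> Z" for X
  proof -
    have "X \<inter> sym_diff D D' = sym_diff (X \<inter> D) (X \<inter> D')" by auto
    moreover have "finite X" using that cycle_subset finite_subset_ground by auto
    ultimately show ?thesis using D that by (simp add: even_card_sym_diff cocycles_def)
  qed
  then show "sym_diff D D' \<in> cocycles E Z" using D by (auto simp: cocycles_def)
qed (use finite_ground in \<open>auto simp: cocycles_def\<close>)

lemma basis_iff: "basis M B \<longleftrightarrow> basis_in E B"
proof
  assume B: "basis M B"
  then have BI: "B \<in> indeps M" "B \<subseteq> E" by (auto simp: basis_def indep_iff)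
  have "E \<subseteq> cl B"
  proof
    fix e assume "e \<in> E"
    show "e \<in> cl B"
    proof (rule ccontr)
      assume e: "e \<notin> cl B"
      then have "e \<notin> B" using subset_cl BI by auto
      then have "insert e B \<in> indeps M" using indep_insert_iff BI e \<open>e \<in> E\<close> by auto
      then show False using B \<open>e \<notin> B\<close> unfolding basis_def by blast
    qed
  qed
  then show "basis_in E B" using BI by (simp add: basis_in_def)
next
  assume B: "basis_in E B"
  show "basis M B"
    unfolding basis_def
  proof (intro conjI ballI impI)
    show "B \<in> indeps M" using B by (simp add: basis_in_def)
    fix I assume I: "I \<in> indeps M" "B \<subseteq> I"
    then have "I \<subseteq> E" by (simp add: indep_iff)
    then have "card I \<le> card B" using indep_card_le_rk[of I E] I rk_basis_in[OF B] by simp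
    then show "I = B" using card_seteq[of I B] I \<open>I \<subseteq> E\<close> finite_subset_ground by blast
  qed
qed

text \<open>
  For a basis \<open>B\<close> and \<open>Y \<subseteq> E\<close>, the unique subset of \<open>B\<close> congruent to \<open>Y\<close> modulo the cycle space: the support
  of the coordinate vector of the sum of \<open>Y\<close> with respect to \<open>B\<close>.
\<close>

definition coord :: "'a set \<Rightarrow> 'a set \<Rightarrow> 'a set" where
  "coord B Y = (THE W. W \<subseteq> B \<and> sym_diff Y W \<in> Z)"

lemma coord_unique:
  assumes "basis_in E B" "W \<subseteq> B" "sym_diff Y W \<in> Z"
  shows "coord B Y = W"
  unfolding coord_def
proof (rule the_equality)
  fix V assume V: "V \<subseteq> B \<and> sym_diff Y V \<in> Z"
  have "sym_diff (sym_diff Y V) (sym_diff Y W) = sym_diff V W" by auto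
  then have "sym_diff V W \<in> Z" using sym_diff_cycle V assms by metis
  moreover have "sym_diff V W \<subseteq> B" using V assms by auto
  moreover have "\<forall>X\<in>Z. X \<subseteq> B \<longrightarrow> X = {}" using assms(1) by (simp add: basis_in_def indep_iff)
  ultimately have "sym_diff V W = {}" by metis
  then show "V = W" by auto
qed (use assms in auto)

lemma coord:
  assumes "basis_in E B" "Y \<subseteq> E"
  shows "coord B Y \<subseteq> B" "sym_diff Y (coord B Y) \<in> Z"
proof -
  have "Y \<subseteq> cl B" using assms by (auto simp: basis_in_def)
  then obtain W where "W \<subseteq> B" "sym_diff Y W \<in> Z" using spanned_reduces by metis
  then show "coord B Y \<subseteq> B" "sym_diff Y (coord B Y) \<in> Z" using coord_unique assms by auto
qed

lemma coord_sym_diff: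
  assumes "basis_in E B" "X \<subseteq> E" "Y \<subseteq> E"
  shows "coord B (sym_diff X Y) = sym_diff (coord B X) (coord B Y)"
proof (rule coord_unique[OF assms(1)])
  show "sym_diff (coord B X) (coord B Y) \<subseteq> B" using coord assms by blast
  have "sym_diff (sym_diff X (coord B X)) (sym_diff Y (coord B Y)) \<in> Z"
    using sym_diff_cycle coord assms by blast
  moreover have "sym_diff (sym_diff X (coord B X)) (sym_diff Y (coord B Y))
     = sym_diff (sym_diff X Y) (sym_diff (coord B X) (coord B Y))" by auto
  ultimately show "sym_diff (sym_diff X Y) (sym_diff (coord B X) (coord B Y)) \<in> Z" by simp
qed

lemma coord_subset: "basis_in E B \<Longrightarrow> W \<subseteq> B \<Longrightarrow> coord B W = W"
  by (rule coord_unique) (auto simp: empty_cycle)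

lemma cycle_iff_coord:
  assumes "basis_in E B" "X \<subseteq> E"
  shows "X \<in> Z \<longleftrightarrow> coord B X = {}"
  using coord_unique[OF assms(1), of "{}" X] coord(2)[OF assms] by auto

lemma in_coord_iff:
  assumes "basis_in E B" "Y \<subseteq> E"
  shows "b \<in> coord B Y \<longleftrightarrow> odd (card {e \<in> Y. b \<in> coord B {e}})"
proof -
  have "finite Y" using assms finite_subset_ground by auto
  then show ?thesis
    using assms(2)
  proof (induction Y rule: finite_induct)
    case empty
    then show ?case using coord_subset[OF assms(1), of "{}"] by simp
  next
    case (insert e Y)
    have eY: "{e} \<subseteq> E" "Y \<subseteq> E" using insert.prems by auto
    have "sym_diff {e} Y = insert e Y" using insert.hyps by auto
    then have "coord B (insert e Y) = sym_diff (coord B {e}) (coord B Y)"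
      using coord_sym_diff[OF assms(1) eY] by simp
    then have *: "b \<in> coord B (insert e Y) \<longleftrightarrow> (b \<in> coord B {e} \<longleftrightarrow> b \<notin> coord B Y)"
      by blast
    have "card {x \<in> insert e Y. b \<in> coord B {x}} =
        (if b \<in> coord B {e} then Suc (card {x \<in> Y. b \<in> coord B {x}})
         else card {x \<in> Y. b \<in> coord B {x}})"
    proof (cases "b \<in> coord B {e}")
      case True
      then have "{x \<in> insert e Y. b \<in> coord B {x}} = insert e {x \<in> Y. b \<in> coord B {x}}" by blast
      then show ?thesis using insert.hyps True by simp
    next
      case False
      then have "{x \<in> insert e Y. b \<in> coord B {x}} = {x \<in> Y. b \<in> coord B {x}}" by blast
      then show ?thesis using False by simp
    qed
    then show ?case using insert.IH[OF eY(2)] * by simp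
  qed
qed

lemma fundamental_cocircuit:
  assumes "basis_in E B"
  shows "{e \<in> E. b \<in> coord B {e}} \<in> cocycles E Z"
  unfolding cocycles_def
proof (intro CollectI conjI ballI)
  fix X assume X: "X \<in> Z"
  then have XE: "X \<subseteq> E" by (rule cycle_subset)
  have "X \<inter> {e \<in> E. b \<in> coord B {e}} = {e \<in> X. b \<in> coord B {e}}" using XE by auto
  moreover have "b \<notin> coord B X" using cycle_iff_coord[OF assms XE] X by simp
  ultimately show "even (card (X \<inter> {e \<in> E. b \<in> coord B {e}}))"
    using in_coord_iff[OF assms XE] by simp
qed auto

text \<open>
  If a cocycle \<open>D\<close> is disjoint from a basis, then the fundamental cycle of an element \<open>e\<close> of \<open>D\<close> meets
  \<open>D\<close> in \<open>e\<close> alone, which has the wrong parity. Conversely, if \<open>I\<close> meets every basis, choose a basis \<open>B\<close> that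
  extends one of \<open>E - I\<close>; for \<open>b\<close> in \<open>I \<inter> B\<close>, the fundamental cocircuit of \<open>b\<close> lies inside \<open>I\<close>.
\<close>

lemma disjoint_basis_iff:
  assumes I: "I \<subseteq> E"
  shows "(\<exists>B. basis M B \<and> I \<inter> B = {}) \<longleftrightarrow> (\<forall>D\<in>cocycles E Z. D \<subseteq> I \<longrightarrow> D = {})"
proof
  assume "\<exists>B. basis M B \<and> I \<inter> B = {}"
  then obtain B where B: "basis_in E B" "I \<inter> B = {}" using basis_iff by auto
  show "\<forall>D\<in>cocycles E Z. D \<subseteq> I \<longrightarrow> D = {}"
  proof (intro ballI impI, rule ccontr)
    fix D assume D: "D \<in> cocycles E Z" "D \<subseteq> I" "D \<noteq> {}"
    then obtain e where e: "e \<in> D" by auto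
    then have eE: "{e} \<subseteq> E" using D I by auto
    have "sym_diff {e} (coord B {e}) \<inter> D = {e}"
      using coord(1)[OF B(1) eE] B(2) D e by blast
    moreover have "sym_diff {e} (coord B {e}) \<in> Z" using coord(2)[OF B(1) eE] .
    ultimately have "even (card {e})" using D(1) unfolding cocycles_def by fastforce
    then show False by simp
  qed
next
  assume *: "\<forall>D\<in>cocycles E Z. D \<subseteq> I \<longrightarrow> D = {}"
  obtain B' where B': "basis_in (E - I) B'" using basis_in_exists[of "E - I"] by auto
  then have B'I: "B' \<in> indeps M" "B' \<subseteq> E" "E - I \<subseteq> cl B'" "B' \<subseteq> E - I"
    by (auto simp: basis_in_def indep_iff)
  obtain B where B: "basis_in E B" "B' \<subseteq> B" using basis_in_extends[OF B'I(1,2)] by auto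
  have "I \<inter> B = {}"
  proof (rule ccontr)
    assume "I \<inter> B \<noteq> {}"
    then obtain b where b: "b \<in> I" "b \<in> B" by auto
    let ?D = "{e \<in> E. b \<in> coord B {e}}"
    have "?D \<subseteq> I"
    proof (rule subsetI, rule ccontr)
      fix e assume e: "e \<in> ?D" "e \<notin> I"
      then have "{e} \<subseteq> cl B'" using B'I by auto
      then obtain W where W: "W \<subseteq> B'" "sym_diff {e} W \<in> Z" using spanned_reduces by metis
      then have "coord B {e} = W" using coord_unique[OF B(1)] B(2) by (metis subset_trans)
      then show False using e W B'I b by auto
    qed
    moreover have "b \<in> ?D" using coord_subset[OF B(1), of "{b}"] b I by auto
    ultimately show False using * fundamental_cocircuit[OF B(1), of b] by blast
  qed
  then show "\<exists>B. basis M B \<and> I \<inter> B = {}" using B basis_iff by auto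
qed

lemma dual_cycles: "dual M = matroid_of_cycles E (cocycles E Z)"
  unfolding dual_def ground_M matroid_of_cycles_def[of E "cocycles E Z"]
  by (simp add: disjoint_basis_iff cong: conj_cong)

lemma corank_eq: "corank M = card E - rk M E"
proof -
  obtain B where B: "basis_in E B" "card B = rk M E" using basis_in_exists[of E] by auto
  have BE: "B \<subseteq> E" using B by (auto simp: basis_in_def)
  have mem: "I \<in> indeps (dual M) \<longleftrightarrow> I \<subseteq> E \<and> (\<exists>B. basis_in E B \<and> I \<inter> B = {})" for I
    by (simp add: dual_def basis_iff)
  show ?thesis
    unfolding corank_def rk_def[of "dual M"] ground_M
  proof (rule Max_eqI)
    show "finite (card ` {I \<in> indeps (dual M). I \<subseteq> E})"
      by (rule finite_imageI, rule finite_subset[of _ "Pow E"]) (use finite_ground in auto)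
    have "E - B \<in> {I \<in> indeps (dual M). I \<subseteq> E}" using B BE by (auto simp: mem)
    moreover have "card (E - B) = card E - rk M E"
      using B BE finite_subset_ground by (simp add: card_Diff_subset)
    ultimately show "card E - rk M E \<in> card ` {I \<in> indeps (dual M). I \<subseteq> E}" by force
    fix k assume "k \<in> card ` {I \<in> indeps (dual M). I \<subseteq> E}"
    then obtain I C where I: "k = card I" "I \<subseteq> E" "basis_in E C" "I \<inter> C = {}" by (auto simp: mem)
    have CE: "C \<subseteq> E" using I by (auto simp: basis_in_def)
    have "card I + card C = card (I \<union> C)"
      using I CE finite_subset_ground by (intro card_Un_disjoint[symmetric]) auto
    also have "\<dots> \<le> card E" using I CE finite_ground by (intro card_mono) auto
    finally show "k \<le> card E - rk M E" using I rk_basis_in[OF I(3)] by simp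
  qed
qed

end

lemma sum_of_bool_bit:
  assumes "finite X"
  shows "(\<Sum>e\<in>X. of_bool (P e)) = (of_bool (odd (card {e \<in> X. P e})) :: bit)"
  using assms
proof (induction X rule: finite_induct)
  case (insert x X)
  have "{e \<in> insert x X. P e} = (if P x then insert x {e \<in> X. P e} else {e \<in> X. P e})" by auto
  then have "card {e \<in> insert x X. P e} = (if P x then Suc (card {e \<in> X. P e}) else card {e \<in> X. P e})"
    using insert.hyps by simp
  then show ?case using insert by (simp add: of_bool_def)
qed simp

lemma sum_sym_diff:
  fixes g :: "'a \<Rightarrow> 'b::ab_group_add"
  assumes "\<And>x :: 'b. x + x = 0" "finite X" "finite Y"
  shows "sum g (sym_diff X Y) = sum g X + sum g Y"
proof -
  have "sum g X = sum g (X \<inter> Y) + sum g (X - Y)" using assms(2) by (rule sum.Int_Diff)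
  moreover have "sum g Y = sum g (Y \<inter> X) + sum g (Y - X)" using assms(3) by (rule sum.Int_Diff)
  moreover have "sum g (sym_diff X Y) = sum g (X - Y) + sum g (Y - X)"
    using assms by (intro sum.union_disjoint) auto
  moreover have "sum g (X \<inter> Y) + sum g (Y \<inter> X) = 0" using assms(1) by (simp add: Int_commute)
  ultimately show ?thesis by (metis (no_types, lifting) add.assoc add.left_commute add_0)
qed

lemma lin_indep_family_bit:
  fixes v :: "'a \<Rightarrow> nat \<Rightarrow> bit"
  assumes "finite X"
  shows "lin_indep_family d v X \<longleftrightarrow> (\<forall>Y\<subseteq>X. (\<forall>i<d. (\<Sum>e\<in>Y. v e i) = 0) \<longrightarrow> Y = {})"
proof
  assume L: "lin_indep_family d v X"
  show "\<forall>Y\<subseteq>X. (\<forall>i<d. (\<Sum>e\<in>Y. v e i) = 0) \<longrightarrow> Y = {}"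
  proof (intro allI impI)
    fix Y assume Y: "Y \<subseteq> X" "\<forall>i<d. (\<Sum>e\<in>Y. v e i) = 0"
    have "(\<Sum>e\<in>X. of_bool (e \<in> Y) * v e i) = (\<Sum>e\<in>Y. v e i)" for i
      using assms Y by (intro sum.mono_neutral_cong_right) auto
    then have "\<forall>i<d. (\<Sum>e\<in>X. of_bool (e \<in> Y) * v e i) = 0" using Y(2) by simp
    then have "\<forall>e\<in>X. of_bool (e \<in> Y) = (0::bit)" using L unfolding lin_indep_family_def
      by (elim allE[of _ "\<lambda>e. of_bool (e \<in> Y)"]) simp
    then show "Y = {}" using Y by auto
  qed
next
  assume R: "\<forall>Y\<subseteq>X. (\<forall>i<d. (\<Sum>e\<in>Y. v e i) = 0) \<longrightarrow> Y = {}"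
  show "lin_indep_family d v X"
    unfolding lin_indep_family_def
  proof (intro allI impI)
    fix c :: "'a \<Rightarrow> bit" assume c: "\<forall>i<d. (\<Sum>e\<in>X. c e * v e i) = 0"
    let ?Y = "{e \<in> X. c e \<noteq> 0}"
    have one: "c e = 1" if "c e \<noteq> 0" for e using that by (cases "c e") auto
    have "(\<Sum>e\<in>X. c e * v e i) = (\<Sum>e\<in>?Y. v e i)" for i
      using assms one by (intro sum.mono_neutral_cong_right) auto
    then have "\<forall>i<d. (\<Sum>e\<in>?Y. v e i) = 0" using c by simp
    then have "?Y = {}" using R[rule_format, of ?Y] by simp
    then show "\<forall>e\<in>X. c e = 0" by simp
  qed
qed

lemma indep_system_eqI:
  fixes M N :: "'a indep_system"
  assumes "indeps M \<subseteq> Pow (ground M)" "indeps N \<subseteq> Pow (ground M)" "ground M = ground N"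
    and "\<And>X. X \<subseteq> ground M \<Longrightarrow> X \<in> indeps M \<longleftrightarrow> X \<in> indeps N"
  shows "M = N"
proof -
  have "indeps M = indeps N" using assms by (intro set_eqI) (meson PowD subsetD)
  then show ?thesis using assms(3) by simp
qed

lemma representation_bit_iff:
  fixes v :: "'a \<Rightarrow> nat \<Rightarrow> bit"
  assumes "matroid M"
  shows "representation M d v \<longleftrightarrow>
    M = matroid_of_cycles (ground M) {X. X \<subseteq> ground M \<and> (\<forall>i<d. (\<Sum>e\<in>X. v e i) = 0)}"
proof -
  let ?E = "ground M"
  let ?N = "matroid_of_cycles ?E {X. X \<subseteq> ?E \<and> (\<forall>i<d. (\<Sum>e\<in>X. v e i) = 0)}"
  have fin: "finite ?E" and sub: "indeps M \<subseteq> Pow ?E" using assms by (auto simp: matroid_def)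
  have N: "X \<in> indeps ?N \<longleftrightarrow> lin_indep_family d v X" if X: "X \<subseteq> ?E" for X
  proof -
    have "finite X" using X fin finite_subset by blast
    then show ?thesis using X
      unfolding lin_indep_family_bit[OF \<open>finite X\<close>] matroid_of_cycles_def
      by simp (metis subset_trans)
  qed
  have Nsub: "indeps ?N \<subseteq> Pow ?E" by (auto simp: matroid_of_cycles_def)
  show ?thesis
  proof
    assume rep: "representation M d v"
    have g: "ground M = ground ?N" by (simp add: matroid_of_cycles_def)
    show "M = ?N"
    proof (rule indep_system_eqI[OF sub Nsub g])
      fix X assume X: "X \<subseteq> ground M"
      then have "X \<in> indeps M \<longleftrightarrow> lin_indep_family d v X"
        using rep by (simp add: representation_def)
      then show "X \<in> indeps M \<longleftrightarrow> X \<in> indeps ?N" by (rule trans[OF _ N[OF X, symmetric]])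
    qed
  next
    assume "M = ?N"
    then have "indeps M = indeps ?N" by (rule arg_cong)
    then show "representation M d v" unfolding representation_def using N by simp
  qed
qed

lemma cycles_of_binary:
  assumes "matroid M" "binary M"
  obtains Z where "cycle_space (ground M) Z" "M = matroid_of_cycles (ground M) Z"
proof -
  obtain d and v :: "'a \<Rightarrow> nat \<Rightarrow> bit" where "representation M d v"
    using assms(2) by (auto simp: binary_def)
  then have M: "M = matroid_of_cycles (ground M) {X. X \<subseteq> ground M \<and> (\<forall>i<d. (\<Sum>e\<in>X. v e i) = 0)}"
    using representation_bit_iff[OF assms(1)] by blast
  have fin: "finite (ground M)" using assms by (simp add: matroid_def)
  have "cycle_space (ground M) {X. X \<subseteq> ground M \<and> (\<forall>i<d. (\<Sum>e\<in>X. v e i) = 0)}"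
  proof
    fix X Y
    assume XY: "X \<in> {X. X \<subseteq> ground M \<and> (\<forall>i<d. (\<Sum>e\<in>X. v e i) = 0)}"
      "Y \<in> {X. X \<subseteq> ground M \<and> (\<forall>i<d. (\<Sum>e\<in>X. v e i) = 0)}"
    then have f: "finite X" "finite Y" using fin finite_subset by auto
    have two: "x + x = 0" for x :: bit by (cases x) auto
    have "(\<Sum>e\<in>sym_diff X Y. v e i) = (\<Sum>e\<in>X. v e i) + (\<Sum>e\<in>Y. v e i)" for i
      using f by (intro sum_sym_diff two)
    then show "sym_diff X Y \<in> {X. X \<subseteq> ground M \<and> (\<forall>i<d. (\<Sum>e\<in>X. v e i) = 0)}"
      using XY by auto
  qed (use fin in auto)
  then show ?thesis using that M by blast
qed

text \<open>
  Conversely, the coordinate vectors with respect to a basis represent the matroid.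
\<close>

lemma (in cycle_space) binary_M: "binary M"
proof -
  obtain B where B: "basis_in E B" using basis_in_exists[of E] by auto
  have finB: "finite B" using B finite_subset_ground by (auto simp: basis_in_def)
  obtain h where h: "bij_betw h {0..<card B} B" using ex_bij_betw_nat_finite[OF finB] by auto
  define v :: "'a \<Rightarrow> nat \<Rightarrow> bit" where "v e i = of_bool (h i \<in> coord B {e})" for e i
  have "X \<in> Z \<longleftrightarrow> (\<forall>i<card B. (\<Sum>e\<in>X. v e i) = 0)" if X: "X \<subseteq> E" for X
  proof -
    have "(\<Sum>e\<in>X. v e i) = of_bool (h i \<in> coord B X)" for i
      unfolding v_def in_coord_iff[OF B X] by (rule sum_of_bool_bit[OF finite_subset_ground[OF X]])
    then have "(\<forall>i<card B. (\<Sum>e\<in>X. v e i) = 0) \<longleftrightarrow> (\<forall>i<card B. h i \<notin> coord B X)"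
      by simp
    also have "\<dots> \<longleftrightarrow> (\<forall>b\<in>B. b \<notin> coord B X)"
      using h unfolding bij_betw_def by (metis atLeastLessThan_iff image_iff le0)
    also have "\<dots> \<longleftrightarrow> coord B X = {}" using coord(1)[OF B X] by blast
    finally show ?thesis using cycle_iff_coord[OF B X] by simp
  qed
  then have "Z = {X. X \<subseteq> E \<and> (\<forall>i<card B. (\<Sum>e\<in>X. v e i) = 0)}" using cycle_subset by blast
  then have "representation M (card B) v"
    unfolding representation_bit_iff[OF matroid_M] ground_M by (rule arg_cong)
  then show ?thesis unfolding binary_def by blast
qed

lemma rk_ground_iso:
  assumes "matroid_iso M N"
  shows "rk M (ground M) = rk N (ground N)"
proof -
  obtain f where f: "bij_betw f (ground M) (ground N)"
    and i: "\<And>X. X \<subseteq> ground M \<Longrightarrow> X \<in> indeps M \<longleftrightarrow> f ` X \<in> indeps N"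
    using assms by (auto simp: matroid_iso_def)
  have card: "card (f ` X) = card X" if "X \<subseteq> ground M" for X
    using f that by (meson bij_betw_def card_image inj_on_subset)
  have "{J \<in> indeps N. J \<subseteq> ground N} = (`) f ` {I \<in> indeps M. I \<subseteq> ground M}"
  proof (intro equalityI subsetI)
    fix J assume J: "J \<in> {J \<in> indeps N. J \<subseteq> ground N}"
    then have "J \<subseteq> f ` ground M" using f by (simp add: bij_betw_def)
    then obtain I where "I \<subseteq> ground M" "J = f ` I" by (auto simp: subset_image_iff)
    then show "J \<in> (`) f ` {I \<in> indeps M. I \<subseteq> ground M}" using i J by auto
  qed (use f i in \<open>auto simp: bij_betw_def\<close>)
  then have "card ` {J \<in> indeps N. J \<subseteq> ground N} = (\<lambda>I. card (f ` I)) ` {I \<in> indeps M. I \<subseteq> ground M}"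
    by (simp add: image_image)
  also have "\<dots> = card ` {I \<in> indeps M. I \<subseteq> ground M}"
    by (rule image_cong) (use card in auto)
  finally show ?thesis by (simp add: rk_def)
qed

lemma image_sym_diff:
  assumes "inj_on f A" "X \<subseteq> A" "Y \<subseteq> A"
  shows "f ` sym_diff X Y = sym_diff (f ` X) (f ` Y)"
proof -
  have "f ` (X - Y) = f ` X - f ` Y" "f ` (Y - X) = f ` Y - f ` X"
    using assms by (auto intro!: inj_on_image_set_diff[OF assms(1)])
  then show ?thesis by (simp add: image_Un)
qed

lemma iso_cycles:
  assumes "matroid M" "matroid_iso M (matroid_of_cycles E Z)" "cycle_space E Z"
  obtains f where "bij_betw f (ground M) E"
    and "cycle_space (ground M) {X. X \<subseteq> ground M \<and> f ` X \<in> Z}"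
    and "M = matroid_of_cycles (ground M) {X. X \<subseteq> ground M \<and> f ` X \<in> Z}"
proof -
  interpret cycle_space E Z by fact
  obtain f where f: "bij_betw f (ground M) E"
    and i: "\<And>X. X \<subseteq> ground M \<Longrightarrow> X \<in> indeps M \<longleftrightarrow> f ` X \<in> indeps (matroid_of_cycles E Z)"
    using assms(2) by (auto simp: matroid_iso_def)
  have fin: "finite (ground M)" and sub: "indeps M \<subseteq> Pow (ground M)"
    using assms by (auto simp: matroid_def)
  have inj: "inj_on f (ground M)" and im: "f ` ground M = E" using f by (auto simp: bij_betw_def)
  let ?Z = "{X. X \<subseteq> ground M \<and> f ` X \<in> Z}"
  have "cycle_space (ground M) ?Z"
  proof
    fix X Y assume XY: "X \<in> ?Z" "Y \<in> ?Z"
    have "f ` sym_diff X Y = sym_diff (f ` X) (f ` Y)"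
      using XY image_sym_diff[OF inj] by simp
    then show "sym_diff X Y \<in> ?Z" using XY sym_diff_cycle by auto
  qed (use fin empty_cycle in auto)
  moreover have "M = matroid_of_cycles (ground M) ?Z"
  proof -
    have "X \<in> indeps M \<longleftrightarrow> X \<in> indeps (matroid_of_cycles (ground M) ?Z)" if X: "X \<subseteq> ground M" for X
    proof -
      have "X \<in> indeps M \<longleftrightarrow> (\<forall>Y\<in>Z. Y \<subseteq> f ` X \<longrightarrow> Y = {})"
        using i[OF X] im X unfolding indep_iff by auto
      also have "\<dots> \<longleftrightarrow> (\<forall>Y\<in>?Z. Y \<subseteq> X \<longrightarrow> Y = {})"
      proof (intro iffI)
        assume l: "\<forall>Y\<in>Z. Y \<subseteq> f ` X \<longrightarrow> Y = {}"
        show "\<forall>Y\<in>?Z. Y \<subseteq> X \<longrightarrow> Y = {}"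
          using l by (metis (mono_tags, lifting) CollectD image_is_empty image_mono)
      next
        assume r: "\<forall>Y\<in>?Z. Y \<subseteq> X \<longrightarrow> Y = {}"
        show "\<forall>Y\<in>Z. Y \<subseteq> f ` X \<longrightarrow> Y = {}"
        proof (intro ballI impI)
          fix Y assume Y: "Y \<in> Z" "Y \<subseteq> f ` X"
          then obtain Y' where "Y' \<subseteq> X" "Y = f ` Y'" by (auto simp: subset_image_iff)
          then show "Y = {}" using r Y X by (metis (mono_tags, lifting) CollectI image_empty subset_trans)
        qed
      qed
      finally show ?thesis using X by (simp add: matroid_of_cycles_def)
    qed
    moreover have "indeps (matroid_of_cycles (ground M) ?Z) \<subseteq> Pow (ground M)"
      by (auto simp: matroid_of_cycles_def)
    moreover have "ground M = ground (matroid_of_cycles (ground M) ?Z)" by (simp add: matroid_of_cycles_def)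
    ultimately show ?thesis using sub by (intro indep_system_eqI) simp_all
  qed
  ultimately show ?thesis using that f by blast
qed

lemma matroid_iso_refl: "matroid_iso M M"
  unfolding matroid_iso_def by (intro exI[of _ id]) auto

lemma matroid_of_cycles_iso:
  assumes "cycle_space E Z" "cycle_space E' Z'" "bij_betw f E E'"
    and "\<And>X. X \<subseteq> E \<Longrightarrow> X \<in> Z \<longleftrightarrow> f ` X \<in> Z'"
  shows "matroid_iso (matroid_of_cycles E Z) (matroid_of_cycles E' Z')"
proof -
  interpret A: cycle_space E Z by fact
  interpret B: cycle_space E' Z' by fact
  have inj: "inj_on f E" and im: "f ` E = E'" using assms(3) by (auto simp: bij_betw_def)
  have "X \<in> indeps A.M \<longleftrightarrow> f ` X \<in> indeps B.M" if X: "X \<subseteq> E" for X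
  proof
    assume *: "X \<in> indeps A.M"
    show "f ` X \<in> indeps B.M"
      unfolding B.indep_iff
    proof (intro conjI ballI impI)
      show "f ` X \<subseteq> E'" using X im by auto
      fix Y assume Y: "Y \<in> Z'" "Y \<subseteq> f ` X"
      then obtain Y' where "Y' \<subseteq> X" "Y = f ` Y'" by (auto simp: subset_image_iff)
      moreover then have "Y' \<in> Z" using assms(4)[of Y'] X Y by auto
      ultimately show "Y = {}" using * unfolding A.indep_iff by auto
    qed
  next
    assume *: "f ` X \<in> indeps B.M"
    show "X \<in> indeps A.M"
      unfolding A.indep_iff
    proof (intro conjI ballI impI X)
      fix Y assume Y: "Y \<in> Z" "Y \<subseteq> X"
      then have "f ` Y \<in> Z'" using assms(4)[of Y] X by auto
      moreover have "f ` Y \<subseteq> f ` X" using Y by auto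
      ultimately have "f ` Y = {}" using * unfolding B.indep_iff by blast
      then show "Y = {}" by simp
    qed
  qed
  then show ?thesis unfolding matroid_iso_def using assms(3) by auto
qed

section \<open>Closures of nonspanning circuits are split flacets\<close>

context cycle_space
begin

lemma paving_iff: "paving M \<longleftrightarrow> (\<forall>X\<in>Z. X \<noteq> {} \<longrightarrow> rk M E \<le> card X)"
proof
  assume pav: "paving M"
  show "\<forall>X\<in>Z. X \<noteq> {} \<longrightarrow> rk M E \<le> card X"
  proof (intro ballI impI)
    fix X assume X: "X \<in> Z" "X \<noteq> {}"
    then obtain e where "e \<in> X" by blast
    then obtain C where C: "circuit M C" "C \<subseteq> X" using circuit_through X by metis
    have "card C \<le> card X" using C X cycle_subset finite_subset_ground by (intro card_mono) auto
    then show "rk M E \<le> card X" using pav C(1) unfolding paving_def ground_M by fastforce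
  qed
qed (auto simp: paving_def circuit_iff)

lemma basis_in_maximal:
  assumes "basis_in X I" "J \<in> indeps M" "I \<subseteq> J" "J \<subseteq> X"
  shows "J = I"
proof -
  have fin: "finite J" "finite I"
    using assms finite_subset_ground unfolding basis_in_def indep_iff by auto
  have "card J \<le> card I"
    using card_indep_le[OF assms(2) _ fin(2)] assms unfolding basis_in_def by auto
  then show ?thesis using card_seteq[OF fin(1) assms(3)] by simp
qed

lemma indep_if_rk_card:
  assumes "X \<subseteq> E" "card X \<le> rk M X"
  shows "X \<in> indeps M"
proof -
  obtain I where I: "basis_in X I" "card I = rk M X" using basis_in_exists[OF assms(1)] by metis
  then have "I = X" using card_seteq[of X I] finite_subset_ground assms unfolding basis_in_def by auto
  then show ?thesis using I by (simp add: basis_in_def)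
qed

lemma connected_no_loop:
  assumes "matroid_connected M" "2 \<le> card E"
  shows "{e} \<notin> Z"
proof
  assume e: "{e} \<in> Z"
  then have eE: "e \<in> E" using cycle_subset by blast
  obtain f where f: "f \<in> E" "f \<noteq> e" using assms(2) eE
    by (metis card_le_Suc0_iff_eq finite_ground not_less_eq_eq numeral_2_eq_2)
  then obtain C where "circuit M C" "e \<in> C" "f \<in> C"
    using assms(1) eE unfolding matroid_connected_def ground_M by metis
  then show False using e f unfolding circuit_iff by blast
qed

lemma connected_in_cycle:
  assumes "matroid_connected M" "2 \<le> card E" "e \<in> E"
  obtains X where "X \<in> Z" "e \<in> X"
proof -
  obtain f where f: "f \<in> E" "f \<noteq> e" using assms(2,3)
    by (metis card_le_Suc0_iff_eq finite_ground not_less_eq_eq numeral_2_eq_2)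
  then obtain C where "circuit M C" "e \<in> C" "f \<in> C"
    using assms unfolding matroid_connected_def ground_M by metis
  then show ?thesis using that by (auto simp: circuit_iff)
qed

lemma cl_not_single:
  assumes "F \<subseteq> E" "cl F = F" "X \<in> Z"
  shows "X - F \<noteq> {e}"
proof
  assume e: "X - F = {e}"
  then have "insert e (X \<inter> F) = X" by blast
  then have "insert e (X \<inter> F) \<in> Z" using assms(3) by simp
  moreover have "e \<notin> X \<inter> F" "X \<inter> F \<subseteq> F" using e by auto
  ultimately have "e \<in> cl F" unfolding in_cl_iff[OF assms(1)] by blast
  then show False using e assms(2) by auto
qed

lemma minimal_separator:
  assumes "separator A" "A \<noteq> {}"
  obtains K where "separator K" "K \<noteq> {}" "K \<subseteq> A"
    "\<And>A'. separator A' \<Longrightarrow> A' \<subseteq> K \<Longrightarrow> A' = {} \<or> A' = K"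
proof -
  have "\<exists>K. separator K \<and> K \<noteq> {} \<and> K \<subseteq> A \<and> (\<forall>A'. separator A' \<longrightarrow> A' \<subseteq> K \<longrightarrow> A' = {} \<or> A' = K)"
    using assms
  proof (induction "card A" arbitrary: A rule: less_induct)
    case less
    show ?case
    proof (cases "\<forall>A'. separator A' \<longrightarrow> A' \<subseteq> A \<longrightarrow> A' = {} \<or> A' = A")
      case False
      then obtain A' where A': "separator A'" "A' \<subseteq> A" "A' \<noteq> {}" "A' \<noteq> A" by metis
      have "finite A" using less.prems finite_subset_ground by (simp add: separator_def)
      then have "card A' < card A" using A' by (intro psubset_card_mono) auto
      then obtain K where "separator K" "K \<noteq> {}" "K \<subseteq> A'"
        "\<forall>B. separator B \<longrightarrow> B \<subseteq> K \<longrightarrow> B = {} \<or> B = K"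
        using less.hyps A' by metis
      then show ?thesis using A'(2) by (metis subset_trans)
    qed (use less.prems in blast)
  qed
  then show ?thesis using that by metis
qed

lemma circuit_cl_connected:
  assumes C: "circuit M C" and noloop: "\<And>e. {e} \<notin> Z"
  shows "matroid_connected (restriction M (cl C))"
proof -
  let ?F = "cl C"
  have CZ: "C \<in> Z" "C \<subseteq> E" using C cycle_subset by (auto simp: circuit_iff)
  interpret R: cycle_space ?F "Z \<inter> Pow ?F"
    using cycle_space_restrict[OF cycle_space_axioms cl_subset_ground] .
  have CF: "C \<subseteq> ?F" using subset_cl CZ by auto
  then have RC: "circuit R.M C" using C unfolding R.circuit_iff circuit_iff by auto
  have *: "A = ?F" if A: "R.separator A" "c \<in> C" "c \<in> A" for A c
  proof
    show AF: "A \<subseteq> ?F" using A(1) by (simp add: R.separator_def)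
    have CA: "C \<subseteq> A" using R.circuit_separator[OF A(1) RC A(2,3)] .
    show "?F \<subseteq> A"
    proof
      fix f assume f: "f \<in> ?F"
      show "f \<in> A"
      proof (rule ccontr)
        assume fA: "f \<notin> A"
        then obtain W where W: "W \<subseteq> C" "f \<notin> W" "insert f W \<in> Z"
          using f CA in_cl_iff[OF CZ(2)] by auto
        have "insert f W \<in> Z \<inter> Pow ?F" using W f CF by auto
        then have "insert f W \<inter> A \<in> Z" using A(1) unfolding R.separator_def by blast
        moreover have "insert f W \<inter> A = W" using W CA fA by auto
        ultimately have "sym_diff (insert f W) W \<in> Z" using sym_diff_cycle[OF W(3)] by simp
        moreover have "sym_diff (insert f W) W = {f}" using W by auto
        ultimately show False using noloop by simp
      qed
    qed
  qed
  obtain c where c: "c \<in> C" using C by (auto simp: circuit_iff)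
  have "matroid_connected R.M"
    unfolding R.connected_iff
  proof (intro allI impI)
    fix A assume A: "R.separator A"
    show "A = {} \<or> A = ?F"
    proof (cases "c \<in> A")
      case True
      then show ?thesis using *[OF A c] by simp
    next
      case False
      then have "c \<in> ?F - A" using c CF by auto
      then have "?F - A = ?F" using *[OF R.separator_Diff[OF A] c] by simp
      then show ?thesis using A unfolding R.separator_def by blast
    qed
  qed
  then show ?thesis by (simp add: restriction_cycles[OF cl_subset_ground])
qed

text \<open>
  Let \<open>F\<close> be a flat with connected restriction in a connected matroid, and let \<open>K\<close> be a connected component of
  the contraction of \<open>F\<close>. Then \<open>E - K\<close> is a split flacet. Its restriction is connected because a part of it
  that is disjoint from \<open>F\<close> and splits off would split off from the whole matroid as well.
\<close>

lemma component_complement_split_flacet: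
  assumes conn: "matroid_connected M"
    and F: "F \<subseteq> E" "cl F = F" "rk M F \<noteq> 0" "2 \<le> card F"
    and Fconn: "matroid_connected (restriction M F)"
    and K: "cycle_space.separator (E - F) ((\<lambda>X. X - F) ` Z) K" "K \<noteq> {}"
    and Kmin: "\<And>A. cycle_space.separator (E - F) ((\<lambda>X. X - F) ` Z) A \<Longrightarrow> A \<subseteq> K \<Longrightarrow> A = {} \<or> A = K"
  shows "split_flacet M (E - K)"
proof -
  interpret Q: cycle_space "E - F" "(\<lambda>X. X - F) ` Z" using cycle_space_contract[OF cycle_space_axioms] .
  have KE: "K \<subseteq> E - F" using K by (simp add: Q.separator_def)
  have Ksep: "\<exists>Y\<in>Z. Y - F = (X - F) \<inter> K" if "X \<in> Z" for X
  proof -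
    have "(X - F) \<inter> K \<in> (\<lambda>X. X - F) ` Z" using K that unfolding Q.separator_def by blast
    then show ?thesis by (metis imageE)
  qed
  let ?G = "E - K"
  have FG: "F \<subseteq> ?G" using F KE by auto
  have "flat M ?G"
    unfolding flat_iff
  proof (intro conjI equalityI)
    show "cl ?G \<subseteq> ?G"
    proof
      fix e assume e: "e \<in> cl ?G"
      show "e \<in> ?G"
      proof (rule ccontr)
        assume nG: "e \<notin> ?G"
        then have eK: "e \<in> K" using e cl_subset_ground by blast
        obtain W where W: "W \<subseteq> ?G" "insert e W \<in> Z"
          using e nG in_cl_iff[of ?G e] by auto
        obtain Y where Y: "Y \<in> Z" "Y - F = (insert e W - F) \<inter> K" using Ksep[OF W(2)] by metis
        have "(insert e W - F) \<inter> K = {e}" using W(1) eK KE by auto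
        have "Y - F = {e}" using Y(2) \<open>(insert e W - F) \<inter> K = {e}\<close> by (rule trans)
        then show False using cl_not_single[OF F(1,2) Y(1)] by metis
      qed
    qed
  qed (use subset_cl in auto)
  moreover have "rk M ?G \<noteq> 0" using rk_mono[OF FG] F(3) by auto
  moreover have "?G \<noteq> E" using K KE by auto
  moreover have "2 \<le> card ?G" using F(4) card_mono[OF _ FG] finite_ground by auto
  moreover have "matroid_connected (restriction M ?G)"
  proof -
    interpret R: cycle_space ?G "Z \<inter> Pow ?G"
      by (rule cycle_space_restrict[OF cycle_space_axioms]) auto
    interpret RF: cycle_space F "Z \<inter> Pow F"
      by (rule cycle_space_restrict[OF cycle_space_axioms F(1)])
    have empty: "A = {}" if A: "R.separator A" "A \<inter> F = {}" for A
    proof -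
      have AG: "A \<subseteq> ?G" using A(1) by (simp add: R.separator_def)
      have "separator A"
        unfolding separator_def
      proof (intro conjI ballI)
        show "A \<subseteq> E" using AG by auto
        fix X assume X: "X \<in> Z"
        have "Q.separator ((E - F) - K)" using Q.separator_Diff K by blast
        then have "(X - F) \<inter> ((E - F) - K) \<in> (\<lambda>X. X - F) ` Z"
          using X unfolding Q.separator_def by blast
        then obtain Y where Y: "Y \<in> Z" "Y - F = (X - F) \<inter> ((E - F) - K)" by (metis (no_types, lifting) imageE)
        have "Y \<subseteq> ?G" using Y(2) cycle_subset[OF Y(1)] FG by blast
        then have "Y \<inter> A \<in> Z" using Y(1) A(1) unfolding R.separator_def by blast
        moreover have "Y \<inter> A = X \<inter> A" using Y(2) A(2) AG by blast
        ultimately show "X \<inter> A \<in> Z" by simp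
      qed
      moreover have "F \<noteq> {}" using F(4) by auto
      then have "A \<noteq> E" using A(2) F(1) by auto
      ultimately show ?thesis using conn connected_iff by blast
    qed
    have "matroid_connected R.M"
      unfolding R.connected_iff
    proof (intro allI impI)
      fix A assume A: "R.separator A"
      have "RF.separator (A \<inter> F)"
        unfolding RF.separator_def
      proof (intro conjI ballI)
        fix X assume X: "X \<in> Z \<inter> Pow F"
        then have "X \<inter> A \<in> Z \<inter> Pow ?G" using A FG unfolding R.separator_def by blast
        moreover have "X \<inter> A = X \<inter> (A \<inter> F)" using X by auto
        ultimately show "X \<inter> (A \<inter> F) \<in> Z \<inter> Pow F" by auto
      qed auto
      then consider "A \<inter> F = {}" | "A \<inter> F = F"
        using Fconn RF.connected_iff by (metis restriction_cycles F(1))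
      then show "A = {} \<or> A = ?G"
      proof cases
        case 1
        then show ?thesis using empty[OF A] by simp
      next
        case 2
        then have "(?G - A) \<inter> F = {}" by auto
        then have "?G - A = {}" using empty[OF R.separator_Diff[OF A]] by simp
        then show ?thesis using A unfolding R.separator_def by blast
      qed
    qed
    then show ?thesis using restriction_cycles[of ?G E Z] by auto
  qed
  moreover have "matroid_connected (contraction M ?G)"
  proof -
    interpret QG: cycle_space "E - ?G" "(\<lambda>X. X - ?G) ` Z"
      using cycle_space_contract[OF cycle_space_axioms] .
    have EG: "E - ?G = K" using KE by auto
    have "matroid_connected QG.M"
      unfolding QG.connected_iff
    proof (intro allI impI)
      fix A assume A: "QG.separator A"
      then have AK: "A \<subseteq> K" unfolding QG.separator_def using EG by auto
      have "Q.separator A"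
        unfolding Q.separator_def
      proof (intro conjI ballI)
        show "A \<subseteq> E - F" using AK KE by auto
        fix X' assume "X' \<in> (\<lambda>X. X - F) ` Z"
        then obtain X where X: "X \<in> Z" "X' = X - F" by auto
        have "(X - ?G) \<inter> A \<in> (\<lambda>X. X - ?G) ` Z" using X A unfolding QG.separator_def by blast
        then obtain W where W: "(X - ?G) \<inter> A = W - ?G" "W \<in> Z" by (rule imageE)
        obtain Y where Y: "Y \<in> Z" "Y - F = (W - F) \<inter> K" using Ksep[OF W(2)] by metis
        have "(W - F) \<inter> K = W - ?G" using cycle_subset[OF W(2)] KE by auto
        also have "\<dots> = (X - ?G) \<inter> A" by (rule W(1)[symmetric])
        also have "\<dots> = X' \<inter> A" using X(2) cycle_subset[OF X(1)] AK KE by auto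
        finally have "X' \<inter> A = Y - F" using Y(2) by simp
        then show "X' \<inter> A \<in> (\<lambda>X. X - F) ` Z" using Y(1) by simp
      qed
      then show "A = {} \<or> A = E - ?G" using Kmin[of A] AK EG by simp
    qed
    moreover have "contraction M ?G = QG.M" by (rule contraction_cycles) auto
    ultimately show ?thesis by simp
  qed
  ultimately show ?thesis unfolding split_flacet_def by simp
qed

text \<open>
  An independent set that contains a spanning set \<open>I\<close> of \<open>F\<close> remains independent outside \<open>F\<close> when \<open>F\<close> is
  contracted. Hence a cycle whose trace on \<open>K\<close>, a union of components of the contraction, lies in such a
  set has empty trace on \<open>K\<close>.
\<close>

lemma separator_trace_empty:
  assumes F: "F \<subseteq> E"
    and K: "cycle_space.separator (E - F) ((\<lambda>X. X - F) ` Z) K"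
    and I: "F \<subseteq> cl I" "I \<subseteq> B" "B \<in> indeps M" "I \<inter> K = {}"
    and X: "X \<in> Z" "X \<inter> K \<subseteq> B"
  shows "X \<inter> K = {}"
proof -
  interpret Q: cycle_space "E - F" "(\<lambda>X. X - F) ` Z" using cycle_space_contract[OF cycle_space_axioms] .
  have KE: "K \<subseteq> E - F" using K by (simp add: Q.separator_def)
  have "(X - F) \<inter> K \<in> (\<lambda>X. X - F) ` Z" using K X unfolding Q.separator_def by blast
  then obtain Y where Y: "Y \<in> Z" "Y - F = (X - F) \<inter> K" by (metis imageE)
  have YF: "Y - F = X \<inter> K" using Y(2) KE by blast
  obtain W where W: "W \<subseteq> I" "sym_diff (Y \<inter> F) W \<in> Z"
    using spanned_reduces[of "Y \<inter> F" I] I by blast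
  have "sym_diff Y (sym_diff (Y \<inter> F) W) \<in> Z" using sym_diff_cycle[OF Y(1) W(2)] .
  moreover have "sym_diff Y (sym_diff (Y \<inter> F) W) = (X \<inter> K) \<union> W"
    using YF W(1) I(4) by blast
  ultimately have "(X \<inter> K) \<union> W \<in> Z" by simp
  moreover have "(X \<inter> K) \<union> W \<subseteq> B" using X W I by blast
  ultimately have "(X \<inter> K) \<union> W = {}" using I(3) unfolding indep_iff by meson
  then show ?thesis by simp
qed

text \<open>
  If \<open>K\<close> and \<open>L\<close> are disjoint unions of components of the contraction of \<open>F\<close>, then \<open>E - K\<close> and \<open>E - L\<close> form a
  modular pair. Only this inequality is needed; submodularity gives the other one.
\<close>

lemma separator_complements_modular:
  assumes F: "F \<subseteq> E"
    and K: "cycle_space.separator (E - F) ((\<lambda>X. X - F) ` Z) K"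
    and L: "cycle_space.separator (E - F) ((\<lambda>X. X - F) ` Z) L"
    and KL: "K \<inter> L = {}"
  shows "rk M (E - K) + rk M (E - L) \<le> rk M E + rk M ((E - K) \<inter> (E - L))"
proof -
  interpret Q: cycle_space "E - F" "(\<lambda>X. X - F) ` Z" using cycle_space_contract[OF cycle_space_axioms] .
  have KE: "K \<subseteq> E - F" "L \<subseteq> E - F" using K L by (simp_all add: Q.separator_def)
  let ?H = "(E - K) \<inter> (E - L)"
  obtain I where I: "basis_in ?H I" using basis_in_exists[of ?H] by auto
  then have II: "I \<in> indeps M" "I \<subseteq> ?H" "?H \<subseteq> cl I" by (auto simp: basis_in_def)
  obtain B1 where B1: "basis_in (E - K) B1" "I \<subseteq> B1" using basis_in_extends[of I "E - K"] II by auto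
  obtain B2 where B2: "basis_in (E - L) B2" "I \<subseteq> B2" using basis_in_extends[of I "E - L"] II by auto
  have B1': "B1 \<in> indeps M" "B1 \<subseteq> E - K" and B2': "B2 \<in> indeps M" "B2 \<subseteq> E - L"
    using B1 B2 by (auto simp: basis_in_def)
  have FI: "F \<subseteq> cl I" using II(3) F KE by blast
  have B2I: "B2 \<inter> ?H = I"
    using basis_in_maximal[OF I indep_subset[OF B2'(1)], of "B2 \<inter> ?H"] B2(2) II(2) by auto
  have "B1 \<union> B2 \<in> indeps M"
    unfolding indep_iff
  proof (intro conjI ballI impI)
    show "B1 \<union> B2 \<subseteq> E" using B1' B2' by auto
    fix X assume X: "X \<in> Z" "X \<subseteq> B1 \<union> B2"
    have "X \<inter> K \<subseteq> B2" "X \<inter> L \<subseteq> B1" using X(2) B1'(2) B2'(2) by auto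
    moreover have "I \<inter> K = {}" "I \<inter> L = {}" using II(2) by auto
    ultimately have "X \<inter> K = {}" "X \<inter> L = {}"
      using separator_trace_empty[OF F K FI B2(2) B2'(1) _ X(1)]
        separator_trace_empty[OF F L FI B1(2) B1'(1) _ X(1)] by simp_all
    then have "X \<subseteq> B1" using X B2I B1(2) cycle_subset[OF X(1)] by blast
    then show "X = {}" using B1'(1) X(1) unfolding indep_iff by meson
  qed
  then have "card (B1 \<union> B2) \<le> rk M E" using indep_card_le_rk[of _ E] by (simp add: indep_iff)
  moreover have "card (B1 \<inter> B2) \<le> rk M ?H"
    using indep_card_le_rk[OF indep_subset[OF B1'(1)], of "B1 \<inter> B2" ?H] B1' B2' by auto
  moreover have "card B1 + card B2 = card (B1 \<union> B2) + card (B1 \<inter> B2)"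
    using B1' B2' finite_subset_ground by (intro card_Un_Int) (auto simp: indep_iff)
  ultimately show ?thesis using rk_basis_in[OF B1(1)] rk_basis_in[OF B2(1)] by simp
qed

text \<open>
  The main consequence of the split property: the closure \<open>F\<close> of every nonspanning circuit \<open>C\<close> is a split
  flacet. Otherwise the contraction of \<open>F\<close> has two components \<open>K\<close> and \<open>L\<close>. Compatibility of the split
  flacets \<open>E - K\<close> and \<open>E - L\<close>, together with modularity, makes their intersection independent, but it
  contains \<open>C\<close>.
\<close>

lemma split_circuit_flacet:
  assumes conn: "matroid_connected M" and split: "split_matroid M" and E2: "2 \<le> card E"
    and C: "circuit M C" "card C \<le> rk M E"
  shows "split_flacet M (cl C)"
proof -
  let ?F = "cl C"
  note noloop = connected_no_loop[OF conn E2]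
  have CZ: "C \<in> Z" "C \<subseteq> E" using C(1) cycle_subset by (auto simp: circuit_iff)
  have CF: "C \<subseteq> ?F" using subset_cl CZ by auto
  have FE: "?F \<subseteq> E" by (rule cl_subset_ground)
  have clF: "cl ?F = ?F" using cl_cl CZ by simp
  obtain c where c: "c \<in> C" using C(1) by (auto simp: circuit_iff)
  have finC: "finite C" using CZ finite_subset_ground by auto
  have "card C \<noteq> 1" using noloop CZ by (metis card_1_singletonE)
  moreover have "card C \<noteq> 0" using c finC by auto
  ultimately have C2: "2 \<le> card C" by linarith
  have rkF: "rk M ?F = card C - 1" using rk_cl[OF CZ(2)] circuit_basis(2)[OF C(1) c] by simp
  have FnE: "?F \<noteq> E" using rkF C2 C(2) by auto
  have F2: "2 \<le> card ?F" using C2 card_mono[OF finite_subset_ground[OF FE] CF] by simp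
  have rk0: "rk M ?F \<noteq> 0" using rkF C2 by simp
  note Fconn = circuit_cl_connected[OF C(1) noloop]
  interpret Q: cycle_space "E - ?F" "(\<lambda>X. X - ?F) ` Z"
    using cycle_space_contract[OF cycle_space_axioms] .
  have "matroid_connected Q.M"
  proof (rule ccontr)
    assume "\<not> matroid_connected Q.M"
    then obtain A where A: "Q.separator A" "A \<noteq> {}" "A \<noteq> E - ?F" using Q.connected_iff by auto
    have AE: "A \<subseteq> E - ?F" using A(1) by (simp add: Q.separator_def)
    obtain K where K: "Q.separator K" "K \<noteq> {}" "K \<subseteq> A"
      "\<And>A'. Q.separator A' \<Longrightarrow> A' \<subseteq> K \<Longrightarrow> A' = {} \<or> A' = K"
      using Q.minimal_separator[OF A(1,2)] by metis
    have A': "Q.separator ((E - ?F) - A)" "(E - ?F) - A \<noteq> {}"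
      using Q.separator_Diff[OF A(1)] A(3) AE by auto
    obtain L where L: "Q.separator L" "L \<noteq> {}" "L \<subseteq> (E - ?F) - A"
      "\<And>A'. Q.separator A' \<Longrightarrow> A' \<subseteq> L \<Longrightarrow> A' = {} \<or> A' = L"
      using Q.minimal_separator[OF A'] by metis
    note fl = component_complement_split_flacet[OF conn FE clF rk0 F2 Fconn]
    have fK: "split_flacet M (E - K)" using fl[OF K(1,2,4)] .
    have fL: "split_flacet M (E - L)" using fl[OF L(1,2,4)] .
    have KL: "K \<inter> L = {}" using K L by auto
    have "E - K \<noteq> E - L" using K L AE by blast
    then have "card ((E - K) \<inter> (E - L)) + rk M E \<le> rk M (E - K) + rk M (E - L)"
      using split fK fL unfolding split_matroid_def ground_M by blast
    moreover have "rk M (E - K) + rk M (E - L) \<le> rk M E + rk M ((E - K) \<inter> (E - L))"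
      using separator_complements_modular[OF FE K(1) L(1) KL] .
    ultimately have "(E - K) \<inter> (E - L) \<in> indeps M" by (intro indep_if_rk_card) auto
    moreover have "C \<subseteq> (E - K) \<inter> (E - L)" using CF CZ(2) K L AE by blast
    ultimately show False using CZ c unfolding indep_iff by blast
  qed
  then have "matroid_connected (contraction M ?F)" using contraction_cycles[OF FE] by simp
  then show ?thesis
    unfolding split_flacet_def flat_iff ground_M using FE clF rk0 FnE F2 Fconn by simp
qed

end

section \<open>Connected matroids of small rank or corank\<close>

text \<open>
  The cycle space of a circuit \<open>S \<union> {p}\<close> whose element \<open>p\<close> is replaced by a parallel class \<open>P\<close>.
\<close>

definition parallel_series_cycles :: "'a set \<Rightarrow> 'a set \<Rightarrow> 'a set set" where
  "parallel_series_cycles P S =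
     {X. X \<subseteq> P \<union> S \<and> ((X \<inter> S = {} \<and> even (card (X \<inter> P))) \<or> (S \<subseteq> X \<and> odd (card (X \<inter> P))))}"

text \<open>
  The cycle space of a loopless matroid of rank two with parallel classes \<open>A\<close>, \<open>B\<close>, \<open>C\<close>; a cycle has the
  same parity on the three classes, because the vectors of the classes are \<open>a\<close>, \<open>b\<close>, \<open>a + b\<close>.
\<close>

definition three_parallel_cycles :: "'a set \<Rightarrow> 'a set \<Rightarrow> 'a set \<Rightarrow> 'a set set" where
  "three_parallel_cycles A B C =
     {X. X \<subseteq> A \<union> B \<union> C \<and> (even (card (X \<inter> A)) \<longleftrightarrow> even (card (X \<inter> C))) \<and>
         (even (card (X \<inter> B)) \<longleftrightarrow> even (card (X \<inter> C)))}"

text \<open>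
  The cycle space of the dual of such a matroid.
\<close>

definition three_series_cycles :: "'a set \<Rightarrow> 'a set \<Rightarrow> 'a set \<Rightarrow> 'a set set" where
  "three_series_cycles A B C = {{}, A \<union> B, A \<union> C, B \<union> C}"

text \<open>
  The matroids obtained from a circuit with at least two elements by adding parallel copies of one element.
\<close>

definition parallel_series :: "'a set \<Rightarrow> 'a set set \<Rightarrow> bool" where
  "parallel_series E Z \<longleftrightarrow> (\<exists>P S. P \<inter> S = {} \<and> P \<noteq> {} \<and> S \<noteq> {} \<and> E = P \<union> S \<and>
      Z = parallel_series_cycles P S)"

text \<open>
  \<open>E\<close> is partitioned into the nonempty sets \<open>A\<close>, \<open>B\<close>, \<open>C\<close>.
\<close>

definition tripartition :: "'a set \<Rightarrow> 'a set \<Rightarrow> 'a set \<Rightarrow> 'a set \<Rightarrow> bool" where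
  "tripartition E A B C \<longleftrightarrow> A \<noteq> {} \<and> B \<noteq> {} \<and> C \<noteq> {} \<and> A \<inter> B = {} \<and> A \<inter> C = {} \<and> B \<inter> C = {} \<and>
     E = A \<union> B \<union> C"

lemma subset_pairD: "X \<subseteq> {a, b} \<Longrightarrow> X = {} \<or> X = {a} \<or> X = {b} \<or> X = {a, b}"
  by (cases "a \<in> X"; cases "b \<in> X") auto

context cycle_space
begin

lemma even_parallel_cycle:
  assumes pairs: "\<And>p q. p \<in> P \<Longrightarrow> q \<in> P \<Longrightarrow> p \<noteq> q \<Longrightarrow> {p, q} \<in> Z"
    and "Y \<subseteq> P" "finite Y" "even (card Y)"
  shows "Y \<in> Z"
  using assms(2-)
proof (induction "card Y" arbitrary: Y rule: less_induct)
  case less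
  show ?case
  proof (cases "Y = {}")
    case False
    then obtain p where p: "p \<in> Y" by blast
    then have "Y - {p} \<noteq> {}" using less.prems(2,3) by (metis card_Suc_Diff1 card.empty odd_one One_nat_def)
    then obtain q where q: "q \<in> Y" "q \<noteq> p" by blast
    have card: "card (Y - {p, q}) = card Y - 2" using p q less.prems(2) by (subst card_Diff_subset) auto
    have "card Y \<noteq> 0" using p less.prems(2) by auto
    then have lt: "card (Y - {p, q}) < card Y" using card by simp
    have ev: "even (card (Y - {p, q}))" using less.prems(3) card by simp
    have sub: "Y - {p, q} \<subseteq> P" using less.prems(1) by blast
    have "Y - {p, q} \<in> Z" using less.hyps[OF lt sub _ ev] less.prems(2) by simp
    then have "sym_diff (Y - {p, q}) {p, q} \<in> Z" using pairs p q less.prems(1) by (intro sym_diff_cycle) auto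
    moreover have "sym_diff (Y - {p, q}) {p, q} = Y" using p q by blast
    ultimately show ?thesis by simp
  qed (simp add: empty_cycle)
qed

text \<open>
  The cycles listed here already generate the space \<open>parallel_series_cycles P S\<close>, and no further cycle exists
  since an odd subset of \<open>P\<close> that is a cycle would lead to a loop.
\<close>

lemma parallel_seriesI:
  assumes noloop: "\<And>e. {e} \<notin> Z"
    and PS: "P \<inter> S = {}" "E = P \<union> S" "S \<noteq> {}"
    and pairs: "\<And>p q. p \<in> P \<Longrightarrow> q \<in> P \<Longrightarrow> p \<noteq> q \<Longrightarrow> {p, q} \<in> Z"
    and p: "p \<in> P" "insert p S \<in> Z"
    and S: "\<And>X. X \<in> Z \<Longrightarrow> X \<inter> S = {} \<or> S \<subseteq> X"
  shows "parallel_series E Z"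
proof -
  have finP: "finite Y" if "Y \<subseteq> P" for Y using that PS finite_subset_ground by blast
  have Zeven: "even (card Y)" if Y: "Y \<in> Z" "Y \<subseteq> P" for Y
  proof (rule ccontr)
    assume odd: "odd (card Y)"
    then obtain e where e: "e \<in> Y" by fastforce
    then have "even (card (Y - {e}))" using odd finP[OF Y(2)] by simp
    then have "Y - {e} \<in> Z" using even_parallel_cycle[OF pairs, of P "Y - {e}"] Y finP by blast
    then have "sym_diff Y (Y - {e}) \<in> Z" using sym_diff_cycle Y by blast
    moreover have "sym_diff Y (Y - {e}) = {e}" using e by blast
    ultimately show False using noloop by simp
  qed
  have toggle: "even (card (sym_diff Y {p})) \<longleftrightarrow> odd (card Y)" if "Y \<subseteq> P" for Y
    using finP[OF that] by (simp add: even_card_sym_diff)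
  have "X \<in> Z \<longleftrightarrow> X \<in> parallel_series_cycles P S" if X: "X \<subseteq> E" for X
  proof
    assume XZ: "X \<in> Z"
    show "X \<in> parallel_series_cycles P S"
    proof (cases "X \<inter> S = {}")
      case True
      then have "X \<subseteq> P" "X \<inter> P = X" using X PS by auto
      then show ?thesis using Zeven XZ True unfolding parallel_series_cycles_def by auto
    next
      case False
      then have SX: "S \<subseteq> X" using S XZ by auto
      have "sym_diff X (insert p S) \<in> Z" using sym_diff_cycle XZ p by blast
      moreover have eq: "sym_diff X (insert p S) = sym_diff (X \<inter> P) {p}" using SX X PS p(1) by blast
      ultimately have "even (card (sym_diff (X \<inter> P) {p}))" using Zeven p(1) by auto
      then have "odd (card (X \<inter> P))" using toggle by auto
      then show ?thesis using SX X PS unfolding parallel_series_cycles_def by auto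
    qed
  next
    assume XP: "X \<in> parallel_series_cycles P S"
    show "X \<in> Z"
    proof (cases "X \<inter> S = {}")
      case True
      then have "X \<subseteq> P" "X \<inter> P = X" using X PS by auto
      moreover have "even (card (X \<inter> P))" using XP True PS(3) unfolding parallel_series_cycles_def by auto
      ultimately show ?thesis using even_parallel_cycle[OF pairs, of P X] finP by simp
    next
      case False
      then have SX: "S \<subseteq> X" "odd (card (X \<inter> P))" using XP unfolding parallel_series_cycles_def by auto
      then have "even (card (sym_diff (X \<inter> P) {p}))" using toggle by auto
      moreover have sub: "sym_diff (X \<inter> P) {p} \<subseteq> P" using p(1) by auto
      ultimately have "sym_diff (X \<inter> P) {p} \<in> Z"
        using even_parallel_cycle[OF pairs _ finP[OF sub]] by blast
      then have "sym_diff (sym_diff (X \<inter> P) {p}) (insert p S) \<in> Z" using sym_diff_cycle p(2) by blast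
      moreover have "sym_diff (sym_diff (X \<inter> P) {p}) (insert p S) = X" using SX X PS p(1) by blast
      ultimately show ?thesis by simp
    qed
  qed
  moreover have "X \<in> parallel_series_cycles P S \<Longrightarrow> X \<subseteq> E" for X
    using PS unfolding parallel_series_cycles_def by auto
  ultimately have "Z = parallel_series_cycles P S" using cycle_subset by blast
  then show ?thesis unfolding parallel_series_def using PS p by blast
qed

lemma rank1_parallel_series:
  assumes conn: "matroid_connected M" and E2: "2 \<le> card E" and r: "rk M E = 1"
  shows "parallel_series E Z"
proof -
  note noloop = connected_no_loop[OF conn E2]
  have pair: "{p, q} \<in> Z" if "p \<in> E" "q \<in> E" "p \<noteq> q" for p q
  proof -
    have "{p, q} \<notin> indeps M" using indep_card_le_rk[of "{p, q}" E] that r by auto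
    moreover have "{p, q} \<subseteq> E" using that by simp
    ultimately obtain X where X: "X \<in> Z" "X \<subseteq> {p, q}" "X \<noteq> {}" unfolding indep_iff by metis
    then have "X = {p} \<or> X = {q} \<or> X = {p, q}" using subset_pairD by metis
    then show ?thesis using X noloop by auto
  qed
  obtain s where s: "s \<in> E" using E2 by fastforce
  have "card (E - {s}) \<noteq> 0" using E2 s finite_ground by simp
  then obtain p where p: "p \<in> E - {s}" by (metis card.empty ex_in_conv)
  show ?thesis
    by (rule parallel_seriesI[OF noloop, of "E - {s}" "{s}" p]) (use s p pair in auto)
qed

lemma corank1_parallel_series:
  assumes conn: "matroid_connected M" and E2: "2 \<le> card E" and r: "card E = rk M E + 1"
  shows "parallel_series E Z"
proof -
  obtain B where B: "basis_in E B" "card B = rk M E" using basis_in_exists[of E] by auto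
  then have BE: "B \<subseteq> E" "B \<in> indeps M" by (auto simp: basis_in_def)
  have "card (E - B) = 1" using B BE r finite_subset_ground by (simp add: card_Diff_subset)
  then obtain e where e: "E - B = {e}" by (auto simp: card_1_singleton_iff)
  have inB: "X = {}" if "X \<in> Z" "e \<notin> X" for X
  proof -
    have "E \<subseteq> insert e B" using e by auto
    then have "X \<subseteq> B" using that(2) cycle_subset[OF that(1)] by auto
    then show ?thesis using BE(2) that(1) unfolding indep_iff by blast
  qed
  have full: "X = E" if X: "X \<in> Z" "X \<noteq> {}" for X
  proof
    show "X \<subseteq> E" using cycle_subset X by blast
    show "E \<subseteq> X"
    proof
      fix x assume "x \<in> E"
      then obtain Y where Y: "Y \<in> Z" "x \<in> Y" using connected_in_cycle[OF conn E2] by metis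
      have "e \<in> X" "e \<in> Y" using inB X Y by blast+
      then have "sym_diff X Y = {}" using inB[OF sym_diff_cycle[OF X(1) Y(1)]] by blast
      then show "x \<in> X" using Y by blast
    qed
  qed
  have eE: "e \<in> E" using e by auto
  then obtain Y where "Y \<in> Z" "e \<in> Y" using connected_in_cycle[OF conn E2] by metis
  then have EZ: "E \<in> Z" using full by blast
  have "card (E - {e}) \<noteq> 0" using E2 eE finite_ground by simp
  then have ne: "E - {e} \<noteq> {}" by (metis card.empty)
  show ?thesis
  proof (rule parallel_seriesI[OF connected_no_loop[OF conn E2], of "{e}" "E - {e}" e])
    show "insert e (E - {e}) \<in> Z" using EZ eE by (simp add: insert_absorb)
    show "X \<inter> (E - {e}) = {} \<or> E - {e} \<subseteq> X" if "X \<in> Z" for X using full[OF that] by blast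
  qed (use eE ne in auto)
qed

text \<open>
  Two elements \<open>e\<close>, \<open>f\<close> lie outside a basis, and the cycle space consists of \<open>{}\<close>, the two fundamental
  cycles \<open>X\<close>, \<open>Y\<close> and their sum. The series classes are \<open>X - Y\<close>, \<open>Y - X\<close> and \<open>X \<inter> Y\<close>; connectivity makes
  the last one nonempty.
\<close>

lemma corank2_three_series:
  assumes conn: "matroid_connected M" and E2: "2 \<le> card E" and r: "card E = rk M E + 2"
  shows "\<exists>A B C. tripartition E A B C \<and> Z = three_series_cycles A B C"
proof -
  obtain B where B: "basis_in E B" "card B = rk M E" using basis_in_exists[of E] by auto
  then have BE: "B \<subseteq> E" "B \<in> indeps M" "E \<subseteq> cl B" by (auto simp: basis_in_def)
  have "card (E - B) = 2" using B BE r finite_subset_ground by (simp add: card_Diff_subset)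
  then obtain e f where ef: "E - B = {e, f}" "e \<noteq> f" by (auto simp: card_2_iff)
  have eq: "X = Y" if "X \<in> Z" "Y \<in> Z" "e \<in> X \<longleftrightarrow> e \<in> Y" "f \<in> X \<longleftrightarrow> f \<in> Y" for X Y
  proof -
    have "E \<subseteq> insert e (insert f B)" using ef(1) by auto
    then have "sym_diff X Y \<subseteq> B"
      using that(3,4) cycle_subset[OF that(1)] cycle_subset[OF that(2)] by auto
    then have "sym_diff X Y = {}" using BE(2) sym_diff_cycle[OF that(1,2)] unfolding indep_iff by metis
    then show ?thesis by blast
  qed
  have ecl: "e \<in> cl B" "e \<notin> B" "f \<in> cl B" "f \<notin> B" using ef BE by auto
  then obtain We where We: "We \<subseteq> B" "insert e We \<in> Z" using in_cl_iff[OF BE(1)] by metis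
  obtain Wf where Wf: "Wf \<subseteq> B" "insert f Wf \<in> Z" using ecl in_cl_iff[OF BE(1)] by metis
  define X where "X = insert e We"
  define Y where "Y = insert f Wf"
  have XY: "X \<in> Z" "Y \<in> Z" "e \<in> X" "f \<notin> X" "f \<in> Y" "e \<notin> Y"
    using We Wf ecl ef unfolding X_def Y_def by auto
  have D: "sym_diff X Y \<in> Z" using sym_diff_cycle XY by blast
  have Zcases: "T = {} \<or> T = X \<or> T = Y \<or> T = sym_diff X Y" if T: "T \<in> Z" for T
    using eq[OF T empty_cycle] eq[OF T XY(1)] eq[OF T XY(2)] eq[OF T D] XY by auto
  have cover: "E = X \<union> Y"
  proof
    show "X \<union> Y \<subseteq> E" using cycle_subset XY by blast
    show "E \<subseteq> X \<union> Y"
    proof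
      fix x assume "x \<in> E"
      then obtain T where "T \<in> Z" "x \<in> T" using connected_in_cycle[OF conn E2] by metis
      then show "x \<in> X \<union> Y" using Zcases by blast
    qed
  qed
  have "X \<inter> Y \<noteq> {}"
  proof
    assume disj: "X \<inter> Y = {}"
    have "T \<inter> X \<in> Z" if T: "T \<in> Z" for T
    proof -
      have "T \<inter> X = {} \<or> T \<inter> X = X" using Zcases[OF T] disj by auto
      then show ?thesis using XY(1) empty_cycle by auto
    qed
    then have "separator X" unfolding separator_def using cover by auto
    then have "X = E" using conn XY unfolding connected_iff by blast
    then show False using XY cover by blast
  qed
  then have tri: "tripartition E (X - Y) (Y - X) (X \<inter> Y)"
    unfolding tripartition_def using cover XY by blast
  have "(X - Y) \<union> (X \<inter> Y) = X" "(Y - X) \<union> (X \<inter> Y) = Y" by auto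
  then have "three_series_cycles (X - Y) (Y - X) (X \<inter> Y) = {{}, sym_diff X Y, X, Y}"
    unfolding three_series_cycles_def by simp
  moreover have "Z = {{}, sym_diff X Y, X, Y}" using Zcases D XY(1,2) empty_cycle by blast
  ultimately show ?thesis using tri by metis
qed

lemma rank2_three_parallel:
  assumes conn: "matroid_connected M" and E2: "2 \<le> card E" and r: "rk M E = 2"
  shows "\<exists>A B C. tripartition E A B C \<and> Z = three_parallel_cycles A B C"
proof -
  obtain K where K: "basis_in E K" "card K = 2" using basis_in_exists[of E] r by auto
  then obtain a b where ab: "K = {a, b}" "a \<noteq> b" by (auto simp: card_2_iff)
  have KE: "a \<in> E" "b \<in> E" using K ab by (auto simp: basis_in_def)
  let ?c = "\<lambda>e. coord K {e}"
  have sub: "?c e \<subseteq> {a, b}" if "e \<in> E" for e using coord(1)[OF K(1), of "{e}"] that ab by auto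
  have ne: "?c e \<noteq> {}" if "e \<in> E" for e
    using cycle_iff_coord[OF K(1), of "{e}"] connected_no_loop[OF conn E2] that by auto
  define A where "A = {e \<in> E. ?c e = {a}}"
  define B where "B = {e \<in> E. ?c e = {b}}"
  define C where "C = {e \<in> E. ?c e = {a, b}}"
  have disj: "A \<inter> B = {}" "A \<inter> C = {}" "B \<inter> C = {}" using ab unfolding A_def B_def C_def by auto
  have cover: "E = A \<union> B \<union> C"
  proof
    show "E \<subseteq> A \<union> B \<union> C"
    proof
      fix e assume e: "e \<in> E"
      have "?c e = {a} \<or> ?c e = {b} \<or> ?c e = {a, b}"
        using subset_pairD[OF sub[OF e]] ne[OF e] by metis
      then show "e \<in> A \<union> B \<union> C" using e unfolding A_def B_def C_def by blast
    qed
  qed (auto simp: A_def B_def C_def)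
  have aA: "a \<in> A" "b \<in> B"
    using coord_subset[OF K(1), of "{a}"] coord_subset[OF K(1), of "{b}"] ab KE
    unfolding A_def B_def by auto
  have mem: "X \<in> Z \<longleftrightarrow> (even (card (X \<inter> A)) \<longleftrightarrow> even (card (X \<inter> C))) \<and>
     (even (card (X \<inter> B)) \<longleftrightarrow> even (card (X \<inter> C)))" if X: "X \<subseteq> E" for X
  proof -
    have fin: "finite X" using X finite_subset_ground by auto
    have "{e \<in> X. a \<in> ?c e} = (X \<inter> A) \<union> (X \<inter> C)"
      using X cover ab unfolding A_def B_def C_def by auto
    then have ca: "card {e \<in> X. a \<in> ?c e} = card (X \<inter> A) + card (X \<inter> C)"
      using fin disj by (subst card_Un_disjoint[symmetric]) auto
    have "{e \<in> X. b \<in> ?c e} = (X \<inter> B) \<union> (X \<inter> C)"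
      using X cover ab unfolding A_def B_def C_def by auto
    then have cb: "card {e \<in> X. b \<in> ?c e} = card (X \<inter> B) + card (X \<inter> C)"
      using fin disj by (subst card_Un_disjoint[symmetric]) auto
    have "X \<in> Z \<longleftrightarrow> a \<notin> coord K X \<and> b \<notin> coord K X"
      using cycle_iff_coord[OF K(1) X] coord(1)[OF K(1) X] ab by auto
    then show ?thesis unfolding in_coord_iff[OF K(1) X] ca cb by auto
  qed
  have "C \<noteq> {}"
  proof
    assume C0: "C = {}"
    have "separator A"
      unfolding separator_def
    proof (intro conjI ballI)
      fix X assume X: "X \<in> Z"
      then have XE: "X \<subseteq> E" "X \<inter> A \<subseteq> E" using cycle_subset by auto
      have "X \<inter> A \<inter> A = X \<inter> A" "X \<inter> A \<inter> B = {}" using disj by auto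
      then show "X \<inter> A \<in> Z" using mem[OF XE(1)] mem[OF XE(2)] X C0 by simp
    qed (auto simp: A_def)
    then have "A = E" using conn aA unfolding connected_iff by blast
    then show False using aA disj KE by blast
  qed
  then have "tripartition E A B C" unfolding tripartition_def using disj cover aA by blast
  moreover have "Z = three_parallel_cycles A B C"
  proof (rule set_eqI)
    fix X
    show "X \<in> Z \<longleftrightarrow> X \<in> three_parallel_cycles A B C"
      using mem[of X] cycle_subset[of X] cover unfolding three_parallel_cycles_def by auto
  qed
  ultimately show ?thesis by blast
qed

end

section \<open>Split matroids that are not paving\<close>

context cycle_space
begin

text \<open>
  Every nonempty cycle of the contraction of \<open>cl C\<close>, for a nonspanning circuit \<open>C\<close>, is larger than the rank of this
  contraction, which is \<open>rk M E + 1 - card C\<close>. Indeed, a circuit \<open>D\<close> of the contraction lifts to a circuit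
  \<open>D \<union> W\<close> with \<open>W\<close> a proper subset of \<open>C\<close>. If this circuit is nonspanning, its closure is a split flacet, and
  compatibility with \<open>cl C\<close> gives the bound; otherwise the bound is immediate.
\<close>

lemma contraction_cycle_card:
  assumes conn: "matroid_connected M" and split: "split_matroid M" and E2: "2 \<le> card E"
    and C: "circuit M C" "card C \<le> rk M E"
    and X: "X \<in> Z" "X - cl C \<noteq> {}"
  shows "rk M E + 2 \<le> card C + card (X - cl C)"
proof -
  let ?F = "cl C"
  have CZ: "C \<in> Z" "C \<subseteq> E" "C \<noteq> {}" using C(1) cycle_subset by (auto simp: circuit_iff)
  have Cmin: "T = {} \<or> T = C" if "T \<in> Z" "T \<subseteq> C" for T using C(1) that unfolding circuit_iff by blast
  have CF: "C \<subseteq> ?F" using subset_cl CZ by auto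
  have finC: "finite C" using CZ finite_subset_ground by auto
  obtain c where c: "c \<in> C" using CZ by auto
  have rkF: "rk M ?F = card C - 1" using rk_cl[OF CZ(2)] circuit_basis(2)[OF C(1) c] by simp
  interpret Q: cycle_space "E - ?F" "(\<lambda>X. X - ?F) ` Z"
    using cycle_space_contract[OF cycle_space_axioms] .
  obtain e where e: "e \<in> X - ?F" using X by auto
  have "X - ?F \<in> (\<lambda>X. X - ?F) ` Z" using X by simp
  then obtain D where D: "circuit Q.M D" "D \<subseteq> X - ?F" "e \<in> D" using Q.circuit_through e by metis
  have DF: "D \<inter> ?F = {}" using D(2) by auto
  have DE: "D \<subseteq> E" using D(2) cycle_subset[OF X(1)] by auto
  have finD: "finite D" using DE finite_subset_ground by auto
  have Dmin: "T - ?F = {} \<or> T - ?F = D" if "T \<in> Z" "T - ?F \<subseteq> D" for T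
    using D(1) that unfolding Q.circuit_iff by blast
  have "D \<in> (\<lambda>X. X - ?F) ` Z" using D(1) unfolding Q.circuit_iff by simp
  then obtain Y where Y: "D = Y - ?F" "Y \<in> Z" by (rule imageE)
  obtain V where V: "V \<subseteq> C" "sym_diff (Y \<inter> ?F) V \<in> Z" using spanned_reduces[of "Y \<inter> ?F" C] by auto
  have "sym_diff Y (sym_diff (Y \<inter> ?F) V) \<in> Z" using sym_diff_cycle[OF Y(2) V(2)] .
  moreover have "sym_diff Y (sym_diff (Y \<inter> ?F) V) = D \<union> V" using V(1) CF Y(1) by auto
  ultimately have DV: "D \<union> V \<in> Z" by simp
  \<comment> \<open>if \<open>V = C\<close>, then adding the cycle \<open>C\<close> replaces \<open>V\<close> by the empty set\<close>
  have "\<exists>W. W \<subset> C \<and> D \<union> W \<in> Z"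
  proof (cases "V = C")
    case True
    have "sym_diff (D \<union> V) C \<in> Z" using sym_diff_cycle[OF DV CZ(1)] .
    moreover have "sym_diff (D \<union> V) C = D \<union> {}" using True DF CF by auto
    ultimately show ?thesis using CZ(3) by (metis psubsetI empty_subsetI)
  next
    case False
    then show ?thesis using V(1) DV by auto
  qed
  then obtain W where W: "W \<subset> C" "D \<union> W \<in> Z" by auto
  have DC: "D \<inter> C = {}" using DF CF by auto
  have circ: "circuit M (D \<union> W)"
    unfolding circuit_iff
  proof (intro conjI ballI impI)
    show "D \<union> W \<in> Z" "D \<union> W \<noteq> {}" using W D(3) by auto
    fix T assume T: "T \<in> Z" "T \<subseteq> D \<union> W"
    have "T - ?F \<subseteq> D" using T(2) W(1) CF by auto
    then consider "T - ?F = {}" | "T - ?F = D" using Dmin T(1) by metis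
    then show "T = {} \<or> T = D \<union> W"
    proof cases
      case 1
      then have "T \<subseteq> W" using T(2) DF by auto
      then show ?thesis using Cmin[OF T(1)] W(1) by auto
    next
      case 2
      then have TD: "D \<subseteq> T" by auto
      have "sym_diff (D \<union> W) T \<in> Z" using sym_diff_cycle[OF W(2) T(1)] .
      moreover have "sym_diff (D \<union> W) T = W - T" using T(2) TD by auto
      ultimately have "W - T \<in> Z" by simp
      then have "W - T = {}" using Cmin[of "W - T"] W(1) by auto
      then show ?thesis using T(2) TD by auto
    qed
  qed
  have cardDW: "card (D \<union> W) = card D + card W"
    using finD finC W(1) DC by (intro card_Un_disjoint) (auto intro: finite_subset)
  have WC: "card W < card C" using psubset_card_mono[OF finC W(1)] .
  have "card D > 0" using D(3) finD by (auto simp: card_gt_0_iff)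
  have "rk M E + 2 \<le> card C + card D"
  proof (cases "card (D \<union> W) \<le> rk M E")
    case False
    then show ?thesis using cardDW WC by simp
  next
    case True
    let ?G = "cl (D \<union> W)"
    have DWE: "D \<union> W \<subseteq> E" using cycle_subset[OF W(2)] .
    have rkG: "rk M ?G = card D + card W - 1"
      using rk_cl[OF DWE] circuit_basis(2)[OF circ, of e] D(3) cardDW by simp
    have GE: "?G \<subseteq> E" by (rule cl_subset_ground)
    have DWG: "D \<union> W \<subseteq> ?G" using subset_cl[OF DWE] .
    have "?F \<noteq> ?G" using DWG D(3) DF by auto
    then have "card (?F \<inter> ?G) + rk M E \<le> rk M ?F + rk M ?G"
      using split split_circuit_flacet[OF conn split E2 C] split_circuit_flacet[OF conn split E2 circ True]
      unfolding split_matroid_def ground_M by blast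
    moreover have "card W \<le> card (?F \<inter> ?G)"
      using DWG W(1) CF finite_subset_ground[OF GE] by (intro card_mono) auto
    ultimately show ?thesis using rkF rkG \<open>card D > 0\<close> WC by linarith
  qed
  moreover have "card D \<le> card (X - ?F)"
    using D(2) cycle_subset[OF X(1)] finite_subset_ground[of X] by (intro card_mono) auto
  ultimately show ?thesis by simp
qed

text \<open>
  A shorter circuit inside \<open>cl C\<close> would have a different closure, and the compatibility of the two flacets
  would force \<open>rk M E < card C\<close>.
\<close>

lemma small_circuit_cl_cycle_card:
  assumes conn: "matroid_connected M" and split: "split_matroid M" and E2: "2 \<le> card E"
    and C: "circuit M C" "card C \<le> rk M E"
    and X: "X \<in> Z" "X \<noteq> {}" "X \<subseteq> cl C"
  shows "card C \<le> card X"
proof (rule ccontr)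
  assume "\<not> card C \<le> card X"
  obtain x where x: "x \<in> X" using X by auto
  obtain C' where C': "circuit M C'" "C' \<subseteq> X" "x \<in> C'" using circuit_through[OF X(1) x] by metis
  have XE: "X \<subseteq> E" using cycle_subset[OF X(1)] .
  have "card C' \<le> card X" using C'(2) finite_subset_ground[OF XE] by (intro card_mono)
  then have lt: "card C' < card C" using \<open>\<not> card C \<le> card X\<close> by simp
  then have le: "card C' \<le> rk M E" using C(2) by simp
  have CE: "C \<subseteq> E" "C' \<subseteq> E" using C(1) C'(1) cycle_subset by (auto simp: circuit_iff)
  obtain c where c: "c \<in> C" using C(1) by (auto simp: circuit_iff)
  have rkF: "rk M (cl C) = card C - 1" using rk_cl[OF CE(1)] circuit_basis(2)[OF C(1) c] by simp
  have rkG: "rk M (cl C') = card C' - 1" using rk_cl[OF CE(2)] circuit_basis(2)[OF C'(1,3)] by simp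
  have pos: "0 < card C'" using circuit_card_le[OF C'(1)] by simp
  have "cl C \<noteq> cl C'" using rkF rkG lt pos by fastforce
  then have "card (cl C \<inter> cl C') + rk M E \<le> rk M (cl C) + rk M (cl C')"
    using split split_circuit_flacet[OF conn split E2 C] split_circuit_flacet[OF conn split E2 C'(1) le]
    unfolding split_matroid_def ground_M by blast
  moreover have "C' \<subseteq> cl C \<inter> cl C'" using C'(2) X(3) subset_cl[OF CE(2)] by auto
  then have "card C' \<le> card (cl C \<inter> cl C')"
    using finite_subset_ground[OF cl_subset_ground[of C]] by (intro card_mono) auto
  ultimately show False using rkF rkG C(2) pos lt by linarith
qed

text \<open>
  Let \<open>C\<close> be a circuit with fewer than \<open>rk M E\<close> elements and let \<open>F = cl C\<close>. The contraction of \<open>F\<close> has rank at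
  least two and all its nonempty cycles exceed its rank, so \<open>S = E - F\<close> is a single circuit of it: the sum of two
  fundamental cycles would have two elements only. All nonempty cycles inside \<open>F\<close> have at least \<open>card C\<close> elements.
  If \<open>card C = 2\<close>, then \<open>F\<close> is a parallel class. If \<open>card C \<ge> 3\<close>, then a further element of \<open>F\<close> would close a
  short cycle with a part of \<open>C\<close> or with the complementary part, so \<open>F = C\<close> and the corank is two.
\<close>

lemma split_nonpaving:
  assumes conn: "matroid_connected M" and split: "split_matroid M" and E2: "2 \<le> card E"
    and C: "circuit M C" "card C < rk M E"
  shows "parallel_series E Z \<or> card E = rk M E + 2"
proof -
  let ?F = "cl C"
  have C': "card C \<le> rk M E" using C(2) by simp
  note noloop = connected_no_loop[OF conn E2]
  note long = contraction_cycle_card[OF conn split E2 C(1) C']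
  note short = small_circuit_cl_cycle_card[OF conn split E2 C(1) C']
  have CZ: "C \<in> Z" "C \<subseteq> E" "C \<noteq> {}" using C(1) cycle_subset by (auto simp: circuit_iff)
  have CF: "C \<subseteq> ?F" using subset_cl CZ by auto
  have FE: "?F \<subseteq> E" by (rule cl_subset_ground)
  have finC: "finite C" using CZ finite_subset_ground by auto
  obtain c where c: "c \<in> C" using CZ by auto
  note bC = circuit_basis[OF C(1) c]
  have ind: "C - {c} \<in> indeps M" "C - {c} \<subseteq> E" using bC(1) CZ by (auto simp: basis_in_def)
  obtain B where B: "basis_in E B" "C - {c} \<subseteq> B" using basis_in_extends[OF ind] by auto
  have BE: "B \<in> indeps M" "B \<subseteq> E" "E \<subseteq> cl B" using B by (auto simp: basis_in_def)
  have "basis_in ?F (C - {c})"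
    using bC(1) CF basis_in_cl[OF bC(1) CZ(2)] unfolding basis_in_def by auto
  then have BF: "B \<inter> ?F = C - {c}"
    using basis_in_maximal[OF _ indep_subset[OF BE(1)], of ?F "C - {c}" "B \<inter> ?F"] B(2) CF by auto
  let ?J = "B - ?F"
  have finB: "finite B" using BE finite_subset_ground by auto
  have "card B = card (B \<inter> ?F) + card ?J"
    using finB by (metis card_Int_Diff)
  then have "rk M E = card C - 1 + card ?J" using BF c finC rk_basis_in[OF B(1)] by simp
  moreover have C0: "card C > 0" using c finC by (auto simp: card_gt_0_iff)
  ultimately have J: "card ?J + card C = rk M E + 1" by simp
  \<comment> \<open>\<open>?J\<close> is a basis of the contraction, and its fundamental cycles there use all of \<open>?J\<close>\<close>
  have ext: "\<exists>X\<in>Z. X - ?F = insert e ?J" if e: "e \<in> E - ?F" "e \<notin> ?J" for e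
  proof -
    have "e \<notin> B" "e \<in> cl B" using e BE by auto
    then obtain W where W: "W \<subseteq> B" "insert e W \<in> Z" using in_cl_iff[OF BE(2)] by metis
    have sub: "insert e W - ?F \<subseteq> insert e ?J" using W(1) by auto
    have "rk M E + 2 \<le> card C + card (insert e W - ?F)" using long[OF W(2)] e(1) by blast
    moreover have "card (insert e ?J) = card ?J + 1" using e(2) finB by simp
    ultimately have "card (insert e ?J) \<le> card (insert e W - ?F)" using J by simp
    then have "insert e W - ?F = insert e ?J" using card_seteq[OF _ sub] finB by simp
    then show ?thesis using W(2) by blast
  qed
  have "\<exists>e. e \<in> E - ?F \<and> e \<notin> ?J"
  proof (rule ccontr)
    assume no: "\<not> (\<exists>e. e \<in> E - ?F \<and> e \<notin> ?J)"
    have "card ?J \<noteq> 0" using J C(2) by linarith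
    then obtain j where j: "j \<in> ?J" by (metis card.empty ex_in_conv)
    then have "j \<in> E" using BE by auto
    then obtain X where X: "X \<in> Z" "j \<in> X" using connected_in_cycle[OF conn E2] by metis
    have "X - ?F \<subseteq> ?J" using no cycle_subset[OF X(1)] by auto
    then have "card (X - ?F) \<le> card ?J" using finB by (intro card_mono) auto
    moreover have "X - ?F \<noteq> {}" using j X(2) by auto
    ultimately show False using long[OF X(1)] J by simp
  qed
  then obtain e where e: "e \<in> E - ?F" "e \<notin> ?J" by auto
  have S: "E - ?F = insert e ?J"
  proof
    show "insert e ?J \<subseteq> E - ?F" using e BE by auto
    show "E - ?F \<subseteq> insert e ?J"
    proof
      fix f assume f: "f \<in> E - ?F"
      show "f \<in> insert e ?J"
      proof (rule ccontr)
        assume nf: "f \<notin> insert e ?J"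
        obtain X where X: "X \<in> Z" "X - ?F = insert e ?J" using ext[OF e] by auto
        obtain Y where Y: "Y \<in> Z" "Y - ?F = insert f ?J" using ext[of f] f nf by auto
        have "sym_diff X Y - ?F = sym_diff (X - ?F) (Y - ?F)" by auto
        also have "\<dots> = {e, f}" unfolding X(2) Y(2) using nf e(2) by auto
        finally have eq: "sym_diff X Y - ?F = {e, f}" .
        have "rk M E + 2 \<le> card C + card (sym_diff X Y - ?F)"
          by (rule long[OF sym_diff_cycle[OF X(1) Y(1)]]) (use eq in auto)
        also have "\<dots> \<le> card C + 2" unfolding eq by (simp add: card_insert_if)
        finally show False using C(2) by simp
      qed
    qed
  qed
  let ?S = "insert e ?J"
  have cardS: "card ?S + card C = rk M E + 2" using J e(2) finB by simp
  have XS: "X \<inter> ?S = {} \<or> ?S \<subseteq> X" if X: "X \<in> Z" for X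
  proof (cases "X - ?F = {}")
    case True
    then show ?thesis using S by auto
  next
    case False
    have sub: "X - ?F \<subseteq> ?S" using S cycle_subset[OF X] by auto
    have "card ?S \<le> card (X - ?F)" using long[OF X False] cardS by simp
    then have "X - ?F = ?S" using card_seteq[OF _ sub] finB by simp
    then show ?thesis by auto
  qed
  have "card C \<noteq> 1" using noloop CZ by (metis card_1_singletonE)
  then consider "card C = 2" | "3 \<le> card C" using C0 by linarith
  then show ?thesis
  proof cases
    case 1
    then obtain c' where c': "C = {c, c'}" "c \<noteq> c'" using c by (auto simp: card_2_iff)
    have cZ: "{p, c} \<in> Z" if p: "p \<in> ?F" "p \<noteq> c" for p
    proof (cases "p \<in> C")
      case True
      then show ?thesis using c' p CZ(1) by (auto simp: insert_commute)
    next
      case False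
      then obtain W where W: "W \<subseteq> C" "insert p W \<in> Z" using p in_cl_iff[OF CZ(2)] by metis
      have "sym_diff (insert p W) C \<in> Z" using sym_diff_cycle W CZ by blast
      moreover have "W = {} \<or> W = {c} \<or> W = {c'} \<or> W = C" using W(1) c' subset_pairD by metis
      moreover have "sym_diff (insert p C) C = {p}" "sym_diff (insert p {c'}) C = {p, c}"
        using False c' by auto
      ultimately show ?thesis using W(2) noloop by metis
    qed
    have pairs: "{p, q} \<in> Z" if pq: "p \<in> ?F" "q \<in> ?F" "p \<noteq> q" for p q
    proof -
      consider "p = c" | "q = c" | "p \<noteq> c" "q \<noteq> c" by auto
      then show ?thesis
      proof cases
        case 3
        have "sym_diff {p, c} {q, c} \<in> Z" by (rule sym_diff_cycle[OF cZ[OF pq(1) 3(1)] cZ[OF pq(2) 3(2)]])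
        moreover have "sym_diff {p, c} {q, c} = {p, q}" using 3 pq by auto
        ultimately show ?thesis by simp
      next
        case 1
        then show ?thesis using cZ[of q] pq insert_commute[of c q "{}"] by simp
      next
        case 2
        then show ?thesis using cZ[of p] pq by simp
      qed
    qed
    have SnZ: "?S \<notin> Z"
    proof
      assume "?S \<in> Z"
      then have "X \<inter> ?S \<in> Z" if "X \<in> Z" for X
        using XS[OF that] empty_cycle by (auto simp: Int_absorb1)
      moreover have "?S \<subseteq> E" using S by auto
      ultimately have "separator ?S" unfolding separator_def by simp
      then have "?S = E" using conn unfolding connected_iff by blast
      then show False using S c CF FE by auto
    qed
    have "e \<in> E" using e by auto
    then obtain X where X: "X \<in> Z" "e \<in> X" using connected_in_cycle[OF conn E2] by metis
    then have SX: "?S \<subseteq> X" using XS by auto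
    obtain W where W: "W \<subseteq> C" "sym_diff (X \<inter> ?F) W \<in> Z" using spanned_reduces[of "X \<inter> ?F" C] by auto
    have "sym_diff X (sym_diff (X \<inter> ?F) W) \<in> Z" using sym_diff_cycle[OF X(1) W(2)] .
    moreover have XF: "X - ?F = ?S" using SX S cycle_subset[OF X(1)] by blast
    have "sym_diff X (sym_diff (X \<inter> ?F) W) = (X - ?F) \<union> W" using W(1) CF by auto
    ultimately have SW: "?S \<union> W \<in> Z" using XF by simp
    have SC: "?S \<inter> C = {}" using S CF by blast
    have "W = {} \<or> W = {c} \<or> W = {c'} \<or> W = C" using W(1) c' subset_pairD by metis
    moreover have "W \<noteq> {}" using SW SnZ by auto
    moreover have "W \<noteq> C"
    proof
      assume "W = C"
      then have "sym_diff (?S \<union> W) C \<in> Z" using sym_diff_cycle[OF SW CZ(1)] by simp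
      moreover have "sym_diff (?S \<union> W) C = ?S" using \<open>W = C\<close> SC by blast
      ultimately show False using SnZ by simp
    qed
    ultimately obtain p where p: "p \<in> C" "W = {p}" using c' by auto
    have "parallel_series E Z"
    proof (rule parallel_seriesI[OF noloop _ _ _ pairs, of ?F ?S p])
      show "?F \<inter> ?S = {}" "E = ?F \<union> ?S" using S FE by blast+
      show "p \<in> ?F" using p CF by auto
      show "insert p ?S \<in> Z" using SW p by simp
    qed (use XS in auto)
    then show ?thesis ..
  next
    case 2
    have "?F \<subseteq> C"
    proof
      fix f assume f: "f \<in> ?F"
      show "f \<in> C"
      proof (rule ccontr)
        assume fC: "f \<notin> C"
        then obtain W where W: "W \<subseteq> C" "f \<notin> W" "insert f W \<in> Z" using f in_cl_iff[OF CZ(2)] by metis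
        have finW: "finite W" using W finC finite_subset by auto
        have "card C \<le> card (insert f W)" using short[OF W(3)] W(1) f CF by blast
        then have a: "card C \<le> Suc (card W)" using W(2) finW by simp
        have "sym_diff (insert f W) C \<in> Z" using sym_diff_cycle[OF W(3) CZ(1)] .
        moreover have "sym_diff (insert f W) C = insert f (C - W)" using W fC by auto
        ultimately have "insert f (C - W) \<in> Z" by simp
        then have "card C \<le> card (insert f (C - W))" using short f CF by blast
        also have "\<dots> = Suc (card C - card W)" using fC W(1) finC finW by (simp add: card_Diff_subset)
        finally show False using a 2 by linarith
      qed
    qed
    then have "?F = C" using CF by auto
    then have "card E = card C + card (E - ?F)"
      using card_Un_disjoint[of C "E - C"] finC CZ finite_ground by (simp add: Un_absorb1)
    then show ?thesis using S cardS by simp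
  qed
qed

end

section \<open>Binary paving matroids\<close>

lemma card_symmetric_difference:
  assumes "finite A" "finite B"
  shows "card (sym_diff A B) + 2 * card (A \<inter> B) = card A + card B"
proof -
  have "card (sym_diff A B) = card (A - B) + card (B - A)"
    using assms by (intro card_Un_disjoint) auto
  moreover have "card A = card (A \<inter> B) + card (A - B)" using assms by (metis card_Int_Diff)
  moreover have "card B = card (A \<inter> B) + card (B - A)" using assms by (metis card_Int_Diff Int_commute)
  ultimately show ?thesis by simp
qed

context cycle_space
begin

lemma pavingD: "paving M \<Longrightarrow> X \<in> Z \<Longrightarrow> X \<noteq> {} \<Longrightarrow> rk M E \<le> card X"
  unfolding paving_iff by blast

lemma paving_circuitD: "paving M \<Longrightarrow> circuit M C \<Longrightarrow> rk M E \<le> card C"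
  unfolding paving_def by simp

lemma basis_in_full_rank:
  assumes "basis_in X I" "X \<subseteq> E" "rk M X = rk M E"
  shows "basis_in E I"
proof -
  have I: "I \<in> indeps M" "I \<subseteq> E" using assms by (auto simp: basis_in_def)
  obtain B where B: "basis_in E B" "I \<subseteq> B" using basis_in_extends[OF I] by auto
  have "card B = card I" using rk_basis_in[OF B(1)] rk_basis_in[OF assms(1)] assms(3) by simp
  moreover have "finite B" using B finite_subset_ground by (auto simp: basis_in_def)
  ultimately have "I = B" using card_subset_eq B(2) by metis
  then show ?thesis using B by simp
qed

text \<open>
  If a set of more than \<open>rk M E\<close> elements with maximal independent subset \<open>I\<close> does not span, then it contains
  circuits \<open>insert e I\<close> and \<open>insert f I\<close>, whose sum \<open>{e, f}\<close> is too short. This makes every binary paving matroid of rank at least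
  three sparse paving, and the split property follows as well.
\<close>

lemma paving_large_spanning:
  assumes pav: "paving M" and r: "3 \<le> rk M E" and X: "X \<subseteq> E" "rk M E < card X"
  shows "rk M X = rk M E"
proof (rule ccontr)
  assume "rk M X \<noteq> rk M E"
  then have lt: "rk M X < rk M E" using rk_mono[OF X(1)] by simp
  obtain I where I: "basis_in X I" "card I = rk M X" using basis_in_exists[OF X(1)] by metis
  have IX: "I \<subseteq> X" "X \<subseteq> cl I" "I \<subseteq> E" using I X by (auto simp: basis_in_def)
  have finI: "finite I" "finite X" using IX X finite_subset_ground by auto
  have whole: "insert e I \<in> Z" if e: "e \<in> X - I" for e
  proof -
    obtain W where W: "W \<subseteq> I" "e \<notin> W" "insert e W \<in> Z" using e IX in_cl_iff[OF IX(3), of e] by auto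
    have "rk M E \<le> card (insert e W)" using pavingD[OF pav W(3)] by simp
    also have "\<dots> = Suc (card W)" using W finI finite_subset by (metis card_insert_disjoint)
    finally have "card I \<le> card W" using I(2) lt by simp
    then have "W = I" using card_seteq[OF finI(1) W(1)] by simp
    then show ?thesis using W by simp
  qed
  have "card (X - I) = card X - card I" using IX finI by (simp add: card_Diff_subset)
  then have "2 \<le> card (X - I)" using X(2) I(2) lt by simp
  then obtain e f where ef: "e \<in> X - I" "f \<in> X - I" "e \<noteq> f"
    by (metis card_le_Suc0_iff_eq finI(2) finite_Diff not_less_eq_eq numeral_2_eq_2)
  have "sym_diff (insert e I) (insert f I) \<in> Z" using sym_diff_cycle[OF whole[OF ef(1)] whole[OF ef(2)]] .
  moreover have "sym_diff (insert e I) (insert f I) = {e, f}" using ef by auto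
  ultimately have "rk M E \<le> card {e, f}" using pavingD[OF pav, of "{e, f}"] by simp
  then show False using r ef(3) by simp
qed

lemma paving_dual_paving:
  assumes pav: "paving M" and r: "3 \<le> rk M E"
  shows "paving (dual M)"
proof -
  interpret D: cycle_space E "cocycles E Z" by (rule cycle_space_cocycles)
  have rkD: "rk D.M E = card E - rk M E"
    using corank_eq by (simp add: corank_def dual_cycles)
  have "rk D.M E \<le> card D" if D: "D \<in> cocycles E Z" "D \<noteq> {}" for D
  proof (rule ccontr)
    assume "\<not> rk D.M E \<le> card D"
    then have lt: "card D < card E - rk M E" using rkD by simp
    have DE: "D \<subseteq> E" using D.cycle_subset[OF D(1)] .
    have "card (E - D) = card E - card D" using DE finite_subset_ground by (simp add: card_Diff_subset)
    then have "rk M (E - D) = rk M E" using paving_large_spanning[OF pav r, of "E - D"] lt by simp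
    moreover obtain I where I: "basis_in (E - D) I" using basis_in_exists[of "E - D"] by auto
    ultimately have "basis_in E I" using basis_in_full_rank by simp
    moreover have "D \<inter> I = {}" using I by (auto simp: basis_in_def)
    ultimately have "\<forall>D'\<in>cocycles E Z. D' \<subseteq> D \<longrightarrow> D' = {}"
      using disjoint_basis_iff[OF DE] basis_iff by blast
    then show False using D by blast
  qed
  then have "paving D.M" unfolding D.paving_iff by blast
  then show ?thesis by (simp add: dual_cycles)
qed

lemma paving_in_cycle:
  assumes pav: "paving M" and r: "3 \<le> rk M E" and c: "rk M E + 3 \<le> card E" and e: "e \<in> E"
  obtains X where "X \<in> Z" "e \<in> X"
proof -
  have "rk M (E - {e}) = rk M E"
    by (rule paving_large_spanning[OF pav r]) (use c e finite_ground in auto)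
  moreover obtain I where I: "basis_in (E - {e}) I" using basis_in_exists[of "E - {e}"] by auto
  ultimately have B: "basis_in E I" using basis_in_full_rank[of "E - {e}"] by auto
  have "e \<in> cl I" "e \<notin> I" "I \<subseteq> E" using B I e by (auto simp: basis_in_def)
  then obtain W where "insert e W \<in> Z" using in_cl_iff by metis
  then show ?thesis using that by blast
qed

text \<open>
  Two components would contain disjoint circuits with at least \<open>rk M E\<close> elements each. Removing one element
  from either leaves an independent set with at least \<open>2 * rk M E - 2\<close> elements, more than the rank.
\<close>

lemma paving_connected:
  assumes pav: "paving M" and r: "3 \<le> rk M E" and c: "rk M E + 3 \<le> card E"
  shows "matroid_connected M"
proof (rule ccontr)
  assume "\<not> matroid_connected M"
  then obtain A where A: "separator A" "A \<noteq> {}" "A \<noteq> E" using connected_iff by auto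
  have AE: "A \<subseteq> E" using A by (simp add: separator_def)
  have circ: "\<exists>C x. circuit M C \<and> C \<subseteq> A \<and> x \<in> C" if A: "separator A" "A \<noteq> {}" for A
  proof -
    obtain a where a: "a \<in> A" "a \<in> E" using A by (auto simp: separator_def)
    then obtain X where X: "X \<in> Z" "a \<in> X" using paving_in_cycle[OF pav r c] by metis
    obtain C where C: "circuit M C" "a \<in> C" using circuit_through[OF X] by metis
    then show ?thesis using circuit_separator[OF A(1) C a(1)] by blast
  qed
  obtain C x where C: "circuit M C" "C \<subseteq> A" "x \<in> C" using circ[OF A(1,2)] by auto
  have "E - A \<noteq> {}" using A AE by auto
  then obtain D y where D: "circuit M D" "D \<subseteq> E - A" "y \<in> D" using circ[OF separator_Diff[OF A(1)]] by auto
  have CE: "C \<subseteq> E" "D \<subseteq> E" using C D AE by auto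
  have fin: "finite C" "finite D" using CE finite_subset_ground by auto
  have ind: "C - {x} \<in> indeps M" "D - {y} \<in> indeps M" 
    using circuit_basis(1)[OF C(1,3)] circuit_basis(1)[OF D(1,3)] by (simp_all add: basis_in_def)
  have big: "rk M E \<le> card C" "rk M E \<le> card D" using paving_circuitD[OF pav] C(1) D(1) by blast+
  have "(C - {x}) \<union> (D - {y}) \<in> indeps M"
    unfolding indep_iff
  proof (intro conjI ballI impI)
    show "(C - {x}) \<union> (D - {y}) \<subseteq> E" using CE by auto
    fix X assume X: "X \<in> Z" "X \<subseteq> (C - {x}) \<union> (D - {y})"
    have "X \<inter> A \<in> Z" "X \<inter> (E - A) \<in> Z"
      using A(1) separator_Diff[OF A(1)] X(1) unfolding separator_def by blast+
    moreover have "X \<inter> A \<subseteq> C - {x}" "X \<inter> (E - A) \<subseteq> D - {y}" using X(2) C(2) D(2) by auto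
    ultimately have "X \<inter> A = {}" "X \<inter> (E - A) = {}" using ind unfolding indep_iff by metis+
    then show "X = {}" using cycle_subset[OF X(1)] by auto
  qed
  then have "card ((C - {x}) \<union> (D - {y})) \<le> rk M E"
    using indep_card_le_rk[of _ E] by (simp add: indep_iff)
  moreover have "card ((C - {x}) \<union> (D - {y})) = card (C - {x}) + card (D - {y})"
    using fin C D by (intro card_Un_disjoint) auto
  ultimately show False using fin C(3) D(3) big r by simp
qed

text \<open>
  The split flacets are hyperplanes that are circuits.
\<close>

lemma paving_split_flacet:
  assumes pav: "paving M" and r: "3 \<le> rk M E" and F: "split_flacet M F"
  shows "F \<in> Z" "card F = rk M E" "rk M E \<le> Suc (rk M F)"
proof -
  have F': "F \<subseteq> E" "cl F = F" "F \<noteq> E" "2 \<le> card F" "matroid_connected (restriction M F)"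
    using F unfolding split_flacet_def flat_iff by auto
  interpret R: cycle_space F "Z \<inter> Pow F" by (rule cycle_space_restrict[OF cycle_space_axioms F'(1)])
  have conn: "matroid_connected R.M" using F'(5) by (simp add: restriction_cycles[OF F'(1)])
  have "F \<noteq> {}" using F'(4) by auto
  then obtain x where x: "x \<in> F" by auto
  then obtain X where X: "X \<in> Z \<inter> Pow F" "x \<in> X" using R.connected_in_cycle[OF conn F'(4)] by metis
  have finF: "finite F" using F' finite_subset_ground by auto
  have rX: "rk M E \<le> card X" using pavingD[OF pav, of X] X by auto
  have "rk M F < rk M E" using rk_proper_cl[OF F'(1)] F' by simp
  then have "card F \<le> rk M E" using paving_large_spanning[OF pav r F'(1)] by (metis leI less_irrefl)
  then have "X = F" using card_seteq[OF finF, of X] X rX by auto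
  then show "F \<in> Z" using X by auto
  have "rk M E \<le> card F" using rX \<open>X = F\<close> by simp
  then show cF: "card F = rk M E" using \<open>card F \<le> rk M E\<close> by simp
  have "F - {x} \<in> indeps M"
    unfolding indep_iff
  proof (intro conjI ballI impI)
    show "F - {x} \<subseteq> E" using F' by auto
    fix Y assume Y: "Y \<in> Z" "Y \<subseteq> F - {x}"
    show "Y = {}"
    proof (rule ccontr)
      assume "Y \<noteq> {}"
      then have "rk M E \<le> card Y" using pavingD[OF pav Y(1)] by blast
      moreover have "card Y \<le> card (F - {x})" using Y finF by (intro card_mono) auto
      moreover have "card (F - {x}) < card F" using x finF by (metis card_Diff1_less)
      ultimately show False using cF by simp
    qed
  qed
  then have "card (F - {x}) \<le> rk M F" using indep_card_le_rk[of "F - {x}" F] F' by auto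
  then show "rk M E \<le> Suc (rk M F)" using x finF cF by simp
qed

lemma paving_split:
  assumes pav: "paving M" and r: "3 \<le> rk M E"
  shows "split_matroid M"
  unfolding split_matroid_def ground_M
proof (intro allI impI)
  fix F G assume "split_flacet M F \<and> split_flacet M G \<and> F \<noteq> G"
  then have FG: "split_flacet M F" "split_flacet M G" "F \<noteq> G" by auto
  note F = paving_split_flacet[OF pav r FG(1)] and G = paving_split_flacet[OF pav r FG(2)]
  have fin: "finite F" "finite G" using F(1) G(1) cycle_subset finite_subset_ground by auto
  have "sym_diff F G \<in> Z" "sym_diff F G \<noteq> {}" using sym_diff_cycle[OF F(1) G(1)] FG(3) by auto
  then have "rk M E \<le> card (sym_diff F G)" using pavingD[OF pav] by metis
  moreover have "card (sym_diff F G) + 2 * card (F \<inter> G) = 2 * rk M E"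
    using card_symmetric_difference[OF fin] F(2) G(2) by simp
  ultimately have "card (F \<inter> G) + 2 \<le> rk M E" using r by arith
  then show "card (F \<inter> G) + rk M E \<le> rk M F + rk M G" using F(3) G(3) by linarith
qed

lemma fundamental_cycle:
  assumes "basis_in E B" "e \<in> E - B"
  obtains W where "W \<subseteq> B" "insert e W \<in> Z"
proof -
  have "e \<in> cl B" "B \<subseteq> E" using assms by (auto simp: basis_in_def)
  then show ?thesis using that in_cl_iff[of B e] assms(2) by auto
qed

text \<open>
  Each of two fundamental cycles misses at most one element of the basis, so that their sum has at most
  four elements.
\<close>

lemma paving_rank_le_4:
  assumes pav: "paving M" and c: "rk M E + 2 \<le> card E"
  shows "rk M E \<le> 4"
proof (rule ccontr)
  assume r: "\<not> rk M E \<le> 4"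
  obtain B where B: "basis_in E B" "card B = rk M E" using basis_in_exists[of E] by auto
  have BE: "B \<subseteq> E" "finite B" using B finite_subset_ground by (auto simp: basis_in_def)
  have "card (E - B) = card E - card B" using BE by (simp add: card_Diff_subset)
  then have "2 \<le> card (E - B)" using c B by simp
  then obtain e f where ef: "e \<in> E - B" "f \<in> E - B" "e \<noteq> f"
    by (metis card_le_Suc0_iff_eq finite_ground finite_Diff not_less_eq_eq numeral_2_eq_2)
  have miss: "card (B - W) \<le> 1" if W: "W \<subseteq> B" "insert x W \<in> Z" for W x
  proof -
    have "rk M E \<le> card (insert x W)" using pavingD[OF pav W(2)] by simp
    also have "\<dots> \<le> Suc (card W)" by (rule card_insert_le_m1) simp_all
    finally show ?thesis using W(1) BE B(2) by (simp add: card_Diff_subset finite_subset)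
  qed
  obtain V where V: "V \<subseteq> B" "insert e V \<in> Z" using fundamental_cycle[OF B(1) ef(1)] .
  obtain W where W: "W \<subseteq> B" "insert f W \<in> Z" using fundamental_cycle[OF B(1) ef(2)] .
  let ?X = "sym_diff (insert e V) (insert f W)"
  have "?X \<in> Z" using sym_diff_cycle V W by blast
  moreover have "?X \<noteq> {}" using ef W by auto
  ultimately have "rk M E \<le> card ?X" by (rule pavingD[OF pav])
  also have "\<dots> \<le> card ({e, f} \<union> ((B - V) \<union> (B - W)))"
    using BE V W by (intro card_mono) auto
  also have "\<dots> \<le> card {e, f} + card ((B - V) \<union> (B - W))" by (rule card_Un_le)
  also have "\<dots> \<le> card {e, f} + (card (B - V) + card (B - W))" using card_Un_le by (intro add_left_mono)
  also have "\<dots> \<le> 4" using miss[OF V] miss[OF W] ef by simp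
  finally show False using r by simp
qed

text \<open>
  A circuit with five elements spans. Any further element \<open>e\<close> would form a cycle with a part \<open>W\<close> of this
  circuit and another one with the complement of \<open>W\<close>, and one of these parts has at most two elements.
\<close>

lemma paving_rank4_even:
  assumes pav: "paving M" and r: "rk M E = 4" and c: "rk M E + 2 \<le> card E" and X: "X \<in> Z"
  shows "even (card X)"
proof -
  have circ: "even (card C)" if C: "circuit M C" for C
  proof (rule ccontr)
    assume odd: "odd (card C)"
    have "4 \<le> card C" "card C \<le> 5"
      using paving_circuitD[OF pav C] circuit_card_le(1)[OF C] r by simp_all
    then have "card C = 4 \<or> card C = 5" by linarith
    then have C5: "card C = 5" using odd by auto
    have CZ: "C \<in> Z" "C \<subseteq> E" "finite C"
      using C cycle_subset finite_subset_ground by (auto simp: circuit_iff)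
    obtain x where x: "x \<in> C" using C by (auto simp: circuit_iff)
    have "basis_in E (C - {x})"
      using basis_in_full_rank[OF circuit_basis(1)[OF C x] CZ(2)] circuit_basis(2)[OF C x] C5 r by simp
    then have span: "E \<subseteq> cl C" using cl_mono[of "C - {x}" C] by (auto simp: basis_in_def)
    have "card (E - C) \<noteq> 0" using c r C5 CZ by (simp add: card_Diff_subset)
    then obtain e where e: "e \<in> E - C" by (metis card.empty ex_in_conv)
    then obtain W where W: "W \<subseteq> C" "insert e W \<in> Z" using span in_cl_iff[OF CZ(2), of e] by auto
    have finW: "finite W" using W CZ finite_subset by auto
    have "4 \<le> card (insert e W)" using pavingD[OF pav W(2)] r by simp
    then have a: "3 \<le> card W" using e W finW by (simp add: card_insert_if split: if_splits)
    have "sym_diff (insert e W) C \<in> Z" using sym_diff_cycle[OF W(2) CZ(1)] .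
    moreover have "sym_diff (insert e W) C = insert e (C - W)" using W e by auto
    ultimately have "insert e (C - W) \<in> Z" by simp
    then have "4 \<le> card (insert e (C - W))" using pavingD[OF pav] r by fastforce
    then have "3 \<le> card (C - W)" using e CZ by (simp add: card_insert_if split: if_splits)
    then show False using a C5 W(1) finW by (simp add: card_Diff_subset)
  qed
  show ?thesis
    using X
  proof (induction "card X" arbitrary: X rule: less_induct)
    case less
    show ?case
    proof (cases "X = {}")
      case False
      then obtain e where e: "e \<in> X" by auto
      obtain C where C: "circuit M C" "C \<subseteq> X" "e \<in> C" using circuit_through[OF less.prems e] by metis
      have CZ: "C \<in> Z" using C by (simp add: circuit_iff)
      have finX: "finite X" using less.prems cycle_subset finite_subset_ground by auto
      have "sym_diff X C = X - C" using C by auto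
      then have XC: "X - C \<in> Z" using sym_diff_cycle[OF less.prems CZ] by simp
      have lt: "card (X - C) < card X" using C e finX by (intro psubset_card_mono) auto
      have "card X = card (X - C) + card C"
        using card_Int_Diff[OF finX, of C] C(2) by (simp add: Int_absorb1)
      then show ?thesis using less.hyps[OF lt XC] circ[OF C(1)] by simp
    qed simp
  qed
qed

end

lemma bit_add_self: "x + x = (0::bit)"
  by (cases x) auto

lemma bit_vec_add_self: "x + x = (0 :: bit ^ 'n)"
  by (simp add: vec_eq_iff bit_add_self del: add_bit_eq_xor)

lemma CARD_bit: "CARD(bit) = 2"
proof -
  have "(UNIV :: bit set) = {0, 1}" using bit.exhaust by auto
  then show ?thesis by (metis card_2_iff zero_neq_one)
qed

text \<open>
  The coordinates with respect to a basis, as vectors. If all cycles are even, then the fundamental cycles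
  are even and all vectors have odd weight.
\<close>

lemma (in cycle_space) coordinate_embedding:
  assumes r: "rk M E = CARD('n::finite)"
  obtains \<phi> :: "'a \<Rightarrow> bit ^ 'n" where "\<And>X. X \<subseteq> E \<Longrightarrow> X \<in> Z \<longleftrightarrow> sum \<phi> X = 0"
    and "(\<And>X. X \<in> Z \<Longrightarrow> even (card X)) \<Longrightarrow> (\<And>e. e \<in> E \<Longrightarrow> (\<Sum>i\<in>UNIV. \<phi> e $ i) = 1)"
proof -
  obtain B where B: "basis_in E B" "card B = rk M E" using basis_in_exists[of E] by auto
  have BE: "B \<subseteq> E" "finite B" using B finite_subset_ground by (auto simp: basis_in_def)
  obtain h where h: "bij_betw h (UNIV :: 'n set) B"
    using finite_same_card_bij[of "UNIV :: 'n set" B] BE B r by auto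
  have hB: "h ` UNIV = B" "inj h" using h by (auto simp: bij_betw_def)
  define \<phi> :: "'a \<Rightarrow> bit ^ 'n" where "\<phi> e = (\<chi> i. of_bool (h i \<in> coord B {e}))" for e
  have 1: "X \<in> Z \<longleftrightarrow> sum \<phi> X = 0" if X: "X \<subseteq> E" for X
  proof -
    have "sum \<phi> X $ i = of_bool (h i \<in> coord B X)" for i
      unfolding sum_component \<phi>_def vec_lambda_beta in_coord_iff[OF B(1) X]
      by (rule sum_of_bool_bit[OF finite_subset_ground[OF X]])
    then have "sum \<phi> X = 0 \<longleftrightarrow> (\<forall>i. h i \<notin> coord B X)" by (simp add: vec_eq_iff)
    also have "\<dots> \<longleftrightarrow> (\<forall>b\<in>B. b \<notin> coord B X)" using hB(1) by auto
    also have "\<dots> \<longleftrightarrow> coord B X = {}" using coord(1)[OF B(1) X] by blast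
    finally show ?thesis using cycle_iff_coord[OF B(1) X] by simp
  qed
  have 2: "(\<Sum>i\<in>UNIV. \<phi> e $ i) = 1" if ev: "\<And>X. X \<in> Z \<Longrightarrow> even (card X)" and e: "e \<in> E" for e
  proof -
    have eE: "{e} \<subseteq> E" using e by simp
    note c = coord[OF B(1) eE]
    have finc: "finite (coord B {e})" using c(1) BE finite_subset by auto
    have "odd (card (coord B {e}))" using ev[OF c(2)] finc by (simp add: even_card_sym_diff)
    moreover have "coord B {e} = h ` {i. h i \<in> coord B {e}}" using c(1) hB(1) by auto
    then have "card (coord B {e}) = card {i. h i \<in> coord B {e}}"
      using card_image[of h "{i. h i \<in> coord B {e}}"] inj_on_subset[OF hB(2)] by auto
    ultimately have "odd (card {i \<in> UNIV. h i \<in> coord B {e}})" by simp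
    then show ?thesis unfolding \<phi>_def vec_lambda_beta
      by (subst sum_of_bool_bit) simp_all
  qed
  show ?thesis using that[of \<phi>] 1 2 by blast
qed

text \<open>
  The additive bijection \<open>x \<mapsto> x + a x (p + q)\<close> exchanges \<open>p\<close> and \<open>q\<close> and preserves the functional \<open>a\<close>.
\<close>

lemma transvection:
  fixes p q :: "bit ^ 'n" and a :: "bit ^ 'n \<Rightarrow> bit"
  assumes add: "\<And>x y. a (x + y) = a x + a y" and "a p = 1" "a q = 1"
  shows "\<exists>T. bij T \<and> (\<forall>x y. T (x + y) = T x + T y) \<and> T p = q \<and> (\<forall>x. a (T x) = a x)"
proof -
  define d where "d = p + q"
  have ad: "a d = 0" unfolding d_def add assms(2,3) by (rule bit_add_self)
  have dd: "d + d = 0" by (rule bit_vec_add_self)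
  define T where "T x = (if a x = 1 then x + d else x)" for x
  have T1: "T x = x + d" if "a x = 1" for x using that by (simp add: T_def)
  have T0: "T x = x" if "a x = 0" for x using that by (simp add: T_def)
  have aT: "a (T x) = a x" for x by (simp only: T_def add ad add_0_right split: if_split) simp
  have cases: "a x = 0 \<or> a x = 1" for x by (cases "a x") auto
  have TT: "T (T x) = x" for x
  proof (cases "a x = 1")
    case True
    then have "T (T x) = (x + d) + d" using T1[OF True] T1[of "T x"] aT[of x] by simp
    also have "\<dots> = x" by (simp only: add.assoc dd add_0_right)
    finally show ?thesis .
  next
    case False
    then show ?thesis using T0 cases by metis
  qed
  have "T (x + y) = T x + T y" for x y
  proof -
    consider "a x = 0" "a y = 0" | "a x = 1" "a y = 0" | "a x = 0" "a y = 1" | "a x = 1" "a y = 1"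
      using cases by metis
    then show ?thesis
    proof cases
      case 1
      then have "a (x + y) = 0" by (simp only: add add_0_right)
      then show ?thesis using T0 1 by simp
    next
      case 2
      then have "a (x + y) = 1" by (simp only: add add_0_right)
      then show ?thesis using T0 T1 2 by (simp only: add_ac)
    next
      case 3
      then have "a (x + y) = 1" by (simp only: add add_0_left)
      then show ?thesis using T0 T1 3 by (simp only: add_ac)
    next
      case 4
      then have "a (x + y) = 0" by (simp only: add bit_add_self)
      then have "T (x + y) = x + y" by (rule T0)
      moreover have "(x + d) + (y + d) = (x + y) + (d + d)" by (simp only: add_ac)
      ultimately show ?thesis using T1 4 by (simp only: dd add_0_right)
    qed
  qed
  moreover have "bij T" by (rule o_bij[of T T]) (auto simp: TT)
  moreover have "T p = q"
  proof -
    have "T p = q + (p + p)" unfolding T1[OF assms(2)] d_def by (simp only: add_ac)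
    then show ?thesis by (simp only: bit_vec_add_self add_0_right)
  qed
  ultimately show ?thesis using aT by (intro exI[of _ T]) simp
qed

lemma separating_functional:
  fixes p q :: "bit ^ 'n"
  assumes "p \<noteq> 0" "q \<noteq> 0"
  shows "\<exists>a :: bit ^ 'n \<Rightarrow> bit. (\<forall>x y. a (x + y) = a x + a y) \<and> a p = 1 \<and> a q = 1"
proof -
  obtain i j where i: "p $ i = 1" and j: "q $ j = 1" using assms by (auto simp: vec_eq_iff)
  consider "q $ i = 1" | "p $ j = 1" | "q $ i = 0" "p $ j = 0" by (metis bit_not_one_iff)
  then show ?thesis
  proof cases
    case 1
    show ?thesis by (rule exI[of _ "\<lambda>x. x $ i"]) (use 1 i in auto)
  next
    case 2
    show ?thesis by (rule exI[of _ "\<lambda>x. x $ j"]) (use 2 j in auto)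
  next
    case 3
    show ?thesis
    proof (intro exI[of _ "\<lambda>x. x $ i + x $ j"] conjI allI)
      show "(x + y) $ i + (x + y) $ j = x $ i + x $ j + (y $ i + y $ j)" for x y :: "bit ^ 'n"
        by (simp only: vector_add_component add_ac)
    qed (use 3 i j in auto)
  qed
qed

lemma embedding_iso:
  fixes \<phi>1 :: "'a \<Rightarrow> bit ^ 'n" and \<phi>2 :: "'b \<Rightarrow> bit ^ 'n"
  assumes "cycle_space E1 Z1" "cycle_space E2 Z2"
    and z1: "\<And>X. X \<subseteq> E1 \<Longrightarrow> X \<in> Z1 \<longleftrightarrow> sum \<phi>1 X = 0"
    and z2: "\<And>X. X \<subseteq> E2 \<Longrightarrow> X \<in> Z2 \<longleftrightarrow> sum \<phi>2 X = 0"
    and inj: "inj_on \<phi>1 E1" "inj_on \<phi>2 E2"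
    and T: "inj T" "\<And>x y. T (x + y) = T x + T y" "T ` \<phi>1 ` E1 = \<phi>2 ` E2"
  shows "matroid_iso (matroid_of_cycles E1 Z1) (matroid_of_cycles E2 Z2)"
proof -
  interpret A: cycle_space E1 Z1 by fact
  define f where "f = inv_into E2 \<phi>2 \<circ> (T \<circ> \<phi>1)"
  have "bij_betw (T \<circ> \<phi>1) E1 (\<phi>2 ` E2)"
    unfolding bij_betw_def using T(3) comp_inj_on[OF inj(1) inj_on_subset[OF T(1)]] by (auto simp: image_comp)
  moreover have "bij_betw (inv_into E2 \<phi>2) (\<phi>2 ` E2) E2" using inj(2) by (simp add: inj_on_imp_bij_betw bij_betw_inv_into)
  ultimately have f: "bij_betw f E1 E2" unfolding f_def by (rule bij_betw_trans)
  have \<phi>f: "\<phi>2 (f e) = T (\<phi>1 e)" if "e \<in> E1" for e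
  proof -
    have "T (\<phi>1 e) \<in> \<phi>2 ` E2" using T(3) that by auto
    then show ?thesis unfolding f_def by (simp add: f_inv_into_f)
  qed
  have T0: "T 0 = 0" using T(2)[of 0 0] by simp
  have Tsum: "T (sum g X) = (\<Sum>x\<in>X. T (g x))" if "finite X" for g :: "'a \<Rightarrow> bit ^ 'n" and X
    using that by (induction X rule: finite_induct) (auto simp: T0 T(2))
  show ?thesis
  proof (rule matroid_of_cycles_iso[OF assms(1,2) f])
    fix X assume X: "X \<subseteq> E1"
    have fX: "f ` X \<subseteq> E2" "inj_on f X" using f X by (auto simp: bij_betw_def inj_on_subset)
    have "sum \<phi>2 (f ` X) = (\<Sum>e\<in>X. T (\<phi>1 e))"
      using fX(2) \<phi>f X by (simp add: sum.reindex subset_eq)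
    also have "\<dots> = T (sum \<phi>1 X)" using Tsum[OF A.finite_subset_ground[OF X]] by simp
    finally have "sum \<phi>2 (f ` X) = 0 \<longleftrightarrow> sum \<phi>1 X = 0" using T(1) T0 by (metis injD)
    then show "X \<in> Z1 \<longleftrightarrow> f ` X \<in> Z2" using z1[OF X] z2[OF fX(1)] by simp
  qed
qed

text \<open>
  The binary paving matroids whose rank and corank are at least three.
\<close>

definition large_paving :: "'a set \<Rightarrow> 'a set set \<Rightarrow> bool" where
  "large_paving E Z \<longleftrightarrow> cycle_space E Z \<and> paving (matroid_of_cycles E Z) \<and>
     3 \<le> rk (matroid_of_cycles E Z) E \<and> rk (matroid_of_cycles E Z) E + 3 \<le> card E"

lemma (in cycle_space) embedding_inj:
  fixes \<phi> :: "'a \<Rightarrow> bit ^ 'n"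
  assumes "\<And>X. X \<subseteq> E \<Longrightarrow> X \<in> Z \<longleftrightarrow> sum \<phi> X = 0"
    and pav: "paving M" "3 \<le> rk M E"
  shows "inj_on \<phi> E" "0 \<notin> \<phi> ` E"
proof -
  have small: "X = {}" if "X \<in> Z" "card X \<le> 2" for X
  proof (rule ccontr)
    assume "X \<noteq> {}"
    then have "rk M E \<le> card X" using pavingD[OF pav(1) that(1)] by blast
    then show False using pav(2) that(2) by simp
  qed
  show "inj_on \<phi> E"
  proof (rule inj_onI)
    fix e f assume ef: "e \<in> E" "f \<in> E" "\<phi> e = \<phi> f"
    show "e = f"
    proof (rule ccontr)
      assume "e \<noteq> f"
      then have "sum \<phi> {e, f} = 0" using ef by (simp add: bit_vec_add_self)
      then have "{e, f} \<in> Z" using assms(1)[of "{e, f}"] ef by simp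
      then show False using small[of "{e, f}"] \<open>e \<noteq> f\<close> by simp
    qed
  qed
  show "0 \<notin> \<phi> ` E"
  proof
    assume "0 \<in> \<phi> ` E"
    then obtain e where "e \<in> E" "\<phi> e = 0" by (metis imageE)
    then have "{e} \<in> Z" using assms(1)[of "{e}"] by simp
    then show False using small[of "{e}"] by simp
  qed
qed

lemma card_odd_vectors:
  "2 * card {x :: bit ^ 'n. (\<Sum>i\<in>UNIV. x $ i) = 1} = 2 ^ CARD('n::finite)"
proof -
  define a :: "bit ^ 'n \<Rightarrow> bit" where "a x = (\<Sum>i\<in>UNIV. x $ i)" for x
  let ?O = "{x. a x = 1}" and ?N = "{x. a x = 0}"
  obtain k :: 'n where True by simp
  let ?s = "\<lambda>x :: bit ^ 'n. x + axis k 1"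
  have "a (axis k 1) = 1" unfolding a_def axis_def by simp
  then have as: "a (?s x) = a x + 1" for x unfolding a_def vector_add_component sum.distrib by simp
  have ss: "?s (?s x) = x" for x by (simp only: add.assoc bit_vec_add_self add_0_right)
  have fin: "finite (UNIV :: (bit ^ 'n) set)"
    by (rule card_ge_0_finite) (simp add: CARD_bit)
  have "bij_betw ?s ?O ?N"
    by (rule bij_betwI[of _ _ _ ?s]) (simp_all only: Pi_iff mem_Collect_eq as ss, simp_all)
  then have "card ?O = card ?N" by (rule bij_betw_same_card)
  moreover have "card (?O \<union> ?N) = card ?O + card ?N"
    using fin by (intro card_Un_disjoint) (auto intro: finite_subset[OF subset_UNIV])
  moreover have "a x = 1 \<or> a x = 0" for x by (cases "a x") auto
  then have "?O \<union> ?N = UNIV" by blast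
  ultimately show ?thesis unfolding a_def by (simp add: CARD_bit)
qed

section \<open>Uniqueness for given rank and size\<close>

lemma equal_or_misses_one:
  assumes "finite N" "A \<subseteq> N" "B \<subseteq> N" "card A = card B" "card N \<le> card A + 1"
  shows "A = B \<or> (\<exists>p q. A = N - {p} \<and> B = N - {q} \<and> p \<in> N \<and> q \<in> N)"
proof (cases "card N = card A")
  case True
  have "A = N" by (rule card_subset_eq[OF assms(1,2)]) (use True in simp)
  moreover have "B = N" by (rule card_subset_eq[OF assms(1,3)]) (use True assms(4) in simp)
  ultimately show ?thesis by blast
next
  case False
  have le: "card A \<le> card N" using assms card_mono by blast
  have *: "\<exists>p. X = N - {p} \<and> p \<in> N" if "X \<subseteq> N" "card X = card A" for X
  proof -
    have "card (N - X) = 1" using that assms False le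
      by (simp add: card_Diff_subset finite_subset)
    then obtain p where "N - X = {p}" by (auto simp: card_1_singleton_iff)
    then have "X = N - {p}" "p \<in> N" using that by auto
    then show ?thesis by auto
  qed
  show ?thesis using *[OF assms(2) refl] *[OF assms(3) assms(4)[symmetric]] by blast
qed

text \<open>
  Such a matroid embeds into the seven nonzero vectors of dimension three or, all its cycles being even, into
  the eight odd vectors of dimension four. As it has rank plus at least three elements, it omits at most one of
  these vectors, and a transvection moves the omitted vector to any other one. Hence rank and size determine
  the matroid up to isomorphism.
\<close>

lemma large_paving_unique:
  assumes 1: "large_paving E1 Z1" and 2: "large_paving E2 Z2"
    and rk: "rk (matroid_of_cycles E1 Z1) E1 = rk (matroid_of_cycles E2 Z2) E2"
    and card: "card E1 = card E2"
  shows "matroid_iso (matroid_of_cycles E1 Z1) (matroid_of_cycles E2 Z2)"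
proof -
  interpret A: cycle_space E1 Z1 using 1 by (simp add: large_paving_def)
  interpret B: cycle_space E2 Z2 using 2 by (simp add: large_paving_def)
  have A: "paving A.M" "3 \<le> rk A.M E1" "rk A.M E1 + 3 \<le> card E1"
    and B: "paving B.M" "3 \<le> rk B.M E2" "rk B.M E2 + 3 \<le> card E2"
    using 1 2 by (auto simp: large_paving_def)
  have "rk A.M E1 \<le> 4" using A.paving_rank_le_4 A by simp
  then consider "rk A.M E1 = 3" | "rk A.M E1 = 4" using A by linarith
  then show ?thesis
  proof cases
    case 1
    have r: "rk A.M E1 = CARD(3)" "rk B.M E2 = CARD(3)" using 1 rk by simp_all
    obtain \<phi>1 :: "'a \<Rightarrow> bit ^ 3" where \<phi>1: "\<And>X. X \<subseteq> E1 \<Longrightarrow> X \<in> Z1 \<longleftrightarrow> sum \<phi>1 X = 0"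
      using A.coordinate_embedding[OF r(1)] by metis
    obtain \<phi>2 :: "'b \<Rightarrow> bit ^ 3" where \<phi>2: "\<And>X. X \<subseteq> E2 \<Longrightarrow> X \<in> Z2 \<longleftrightarrow> sum \<phi>2 X = 0"
      using B.coordinate_embedding[OF r(2)] by metis
    have i1: "inj_on \<phi>1 E1" using \<phi>1 A(1,2) by (rule A.embedding_inj(1))
    have z1: "0 \<notin> \<phi>1 ` E1" using \<phi>1 A(1,2) by (rule A.embedding_inj(2))
    have i2: "inj_on \<phi>2 E2" using \<phi>2 B(1,2) by (rule B.embedding_inj(1))
    have z2: "0 \<notin> \<phi>2 ` E2" using \<phi>2 B(1,2) by (rule B.embedding_inj(2))
    have iso: "matroid_iso A.M B.M"
      if "inj T" "\<And>x y. T (x + y) = T x + T y" "T ` \<phi>1 ` E1 = \<phi>2 ` E2" for T :: "bit ^ 3 \<Rightarrow> bit ^ 3"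
      using A.cycle_space_axioms B.cycle_space_axioms \<phi>1 \<phi>2 i1 i2 that by (rule embedding_iso)
    let ?N = "UNIV - {0 :: bit ^ 3}"
    have "finite (UNIV :: (bit ^ 3) set)" by (rule card_ge_0_finite) (simp add: CARD_bit)
    then have N: "finite ?N" "card ?N = 7" by (simp_all add: card_Diff_subset CARD_bit)
    have c: "card (\<phi>1 ` E1) = card E1" "card (\<phi>2 ` E2) = card E2" using i1 i2 card_image by auto
    have "\<phi>1 ` E1 = \<phi>2 ` E2 \<or> (\<exists>p q. \<phi>1 ` E1 = ?N - {p} \<and> \<phi>2 ` E2 = ?N - {q} \<and> p \<in> ?N \<and> q \<in> ?N)"
      by (rule equal_or_misses_one[OF N(1)]) (use z1 z2 c card N(2) A(3) 1 in auto)
    then show ?thesis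
    proof (elim disjE exE conjE)
      assume "\<phi>1 ` E1 = \<phi>2 ` E2"
      then show ?thesis by (intro iso[of id]) auto
    next
      fix p q assume pq: "\<phi>1 ` E1 = ?N - {p}" "\<phi>2 ` E2 = ?N - {q}" "p \<in> ?N" "q \<in> ?N"
      have pq0: "p \<noteq> 0" "q \<noteq> 0" using pq(3,4) by simp_all
      obtain a :: "bit ^ 3 \<Rightarrow> bit" where a: "(\<forall>x y. a (x + y) = a x + a y) \<and> a p = 1 \<and> a q = 1"
        using separating_functional[OF pq0] ..
      then have a': "\<And>x y. a (x + y) = a x + a y" "a p = 1" "a q = 1" by simp_all
      obtain T where "bij T \<and> (\<forall>x y. T (x + y) = T x + T y) \<and> T p = q \<and> (\<forall>x. a (T x) = a x)"
        using transvection[OF a'] ..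
      then have T: "bij T" "\<And>x y. T (x + y) = T x + T y" "T p = q" by simp_all
      have T0: "T 0 = 0" using T(2)[of 0 0] by simp
      have "inj T" "range T = UNIV" using T(1) by (auto simp: bij_def)
      then have "T ` (?N - {p}) = ?N - {q}"
        using T0 T(3) by (simp add: image_set_diff)
      then have "T ` \<phi>1 ` E1 = \<phi>2 ` E2" using pq(1,2) by simp
      then show ?thesis by (rule iso[OF \<open>inj T\<close> T(2)])
    qed
  next
    case 2
    have r: "rk A.M E1 = CARD(4)" "rk B.M E2 = CARD(4)" using 2 rk by simp_all
    have evA: "even (card X)" if "X \<in> Z1" for X using A.paving_rank4_even[OF A(1) 2 _ that] A by simp
    have evB: "even (card X)" if "X \<in> Z2" for X
      using B.paving_rank4_even[OF B(1) _ _ that] B 2 rk by simp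
    obtain \<phi>1 :: "'a \<Rightarrow> bit ^ 4" where \<phi>1: "\<And>X. X \<subseteq> E1 \<Longrightarrow> X \<in> Z1 \<longleftrightarrow> sum \<phi>1 X = 0"
      and o1: "\<And>e. e \<in> E1 \<Longrightarrow> (\<Sum>i\<in>UNIV. \<phi>1 e $ i) = 1"
      using A.coordinate_embedding[OF r(1)] evA by metis
    obtain \<phi>2 :: "'b \<Rightarrow> bit ^ 4" where \<phi>2: "\<And>X. X \<subseteq> E2 \<Longrightarrow> X \<in> Z2 \<longleftrightarrow> sum \<phi>2 X = 0"
      and o2: "\<And>e. e \<in> E2 \<Longrightarrow> (\<Sum>i\<in>UNIV. \<phi>2 e $ i) = 1"
      using B.coordinate_embedding[OF r(2)] evB by metis
    have i1: "inj_on \<phi>1 E1" using \<phi>1 A(1,2) by (rule A.embedding_inj(1))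
    have z1: "0 \<notin> \<phi>1 ` E1" using \<phi>1 A(1,2) by (rule A.embedding_inj(2))
    have i2: "inj_on \<phi>2 E2" using \<phi>2 B(1,2) by (rule B.embedding_inj(1))
    have z2: "0 \<notin> \<phi>2 ` E2" using \<phi>2 B(1,2) by (rule B.embedding_inj(2))
    have iso: "matroid_iso A.M B.M"
      if "inj T" "\<And>x y. T (x + y) = T x + T y" "T ` \<phi>1 ` E1 = \<phi>2 ` E2" for T :: "bit ^ 4 \<Rightarrow> bit ^ 4"
      using A.cycle_space_axioms B.cycle_space_axioms \<phi>1 \<phi>2 i1 i2 that by (rule embedding_iso)
    let ?a = "\<lambda>x :: bit ^ 4. \<Sum>i\<in>UNIV. x $ i"
    let ?N = "{x. ?a x = 1}"
    have "finite (UNIV :: (bit ^ 4) set)" by (rule card_ge_0_finite) (simp add: CARD_bit)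
    then have N: "finite ?N" "card ?N = 8"
      using card_odd_vectors[where 'n = 4] by (auto intro: finite_subset[OF subset_UNIV])
    have c: "card (\<phi>1 ` E1) = card E1" "card (\<phi>2 ` E2) = card E2" using i1 i2 card_image by auto
    have "\<phi>1 ` E1 = \<phi>2 ` E2 \<or> (\<exists>p q. \<phi>1 ` E1 = ?N - {p} \<and> \<phi>2 ` E2 = ?N - {q} \<and> p \<in> ?N \<and> q \<in> ?N)"
      by (rule equal_or_misses_one[OF N(1)]) (use o1 o2 c card N(2) A(3) 2 in auto)
    then show ?thesis
    proof (elim disjE exE conjE)
      assume "\<phi>1 ` E1 = \<phi>2 ` E2"
      then show ?thesis by (intro iso[of id]) auto
    next
      fix p q assume pq: "\<phi>1 ` E1 = ?N - {p}" "\<phi>2 ` E2 = ?N - {q}" "p \<in> ?N" "q \<in> ?N"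
      have add: "?a (x + y) = ?a x + ?a y" for x y
        unfolding vector_add_component by (rule sum.distrib)
      have pq1: "?a p = 1" "?a q = 1" using pq(3,4) by simp_all
      obtain T where "bij T \<and> (\<forall>x y. T (x + y) = T x + T y) \<and> T p = q \<and> (\<forall>x. ?a (T x) = ?a x)"
        using transvection[of ?a p q, OF add pq1] ..
      then have T: "bij T" "\<And>x y. T (x + y) = T x + T y" "T p = q" "\<And>x. ?a (T x) = ?a x"
        by simp_all
      have injT: "inj T" and surjT: "range T = UNIV" using T(1) by (auto simp: bij_def)
      have "T ` ?N = ?N"
      proof
        show "?N \<subseteq> T ` ?N"
        proof
          fix y assume y: "y \<in> ?N"
          obtain x where x: "y = T x" using surjT by (metis rangeE UNIV_I)
          then have "x \<in> ?N" using y T(4)[of x] by simp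
          then show "y \<in> T ` ?N" using x by simp
        qed
      qed (use T(4) in auto)
      then have "T ` (?N - {p}) = ?N - {q}"
        using T(3) injT by (simp add: image_set_diff)
      then have "T ` \<phi>1 ` E1 = \<phi>2 ` E2" using pq(1,2) by simp
      then show ?thesis by (rule iso[OF injT T(2)])
    qed
  qed
qed

section \<open>Circuits with a parallel class\<close>

lemma parallel_series_cycles_iff:
  assumes "P \<inter> S = {}" "S \<noteq> {}"
  shows "X \<in> parallel_series_cycles P S \<longleftrightarrow> X \<subseteq> P \<union> S \<and> (X \<inter> S = {} \<or> S \<subseteq> X) \<and>
    (even (card (X \<inter> P)) \<longleftrightarrow> X \<inter> S = {})"
  using assms unfolding parallel_series_cycles_def by auto

lemma parallel_pair_cycle:
  assumes "p \<in> P" "q \<in> P" "p \<noteq> q" "P \<inter> S = {}"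
  shows "{p, q} \<in> parallel_series_cycles P S"
proof -
  have "{p, q} \<inter> P = {p, q}" "{p, q} \<inter> S = {}" using assms by auto
  moreover have "card {p, q} = 2" using assms(3) by simp
  ultimately show ?thesis unfolding parallel_series_cycles_def using assms(1,2) by simp
qed

lemma series_cycle:
  assumes "p \<in> P" "P \<inter> S = {}"
  shows "insert p S \<in> parallel_series_cycles P S"
proof -
  have eq: "insert p S \<inter> P = {p}" using assms by blast
  show ?thesis
    unfolding parallel_series_cycles_def mem_Collect_eq eq using assms(1) by auto
qed

lemma cycle_space_parallel_series:
  assumes "finite (P \<union> S)" "P \<inter> S = {}" "S \<noteq> {}"
  shows "cycle_space (P \<union> S) (parallel_series_cycles P S)"
proof
  fix X Y assume "X \<in> parallel_series_cycles P S" "Y \<in> parallel_series_cycles P S"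
  then have X: "X \<subseteq> P \<union> S" "X \<inter> S = {} \<or> S \<subseteq> X" "even (card (X \<inter> P)) \<longleftrightarrow> X \<inter> S = {}"
    and Y: "Y \<subseteq> P \<union> S" "Y \<inter> S = {} \<or> S \<subseteq> Y" "even (card (Y \<inter> P)) \<longleftrightarrow> Y \<inter> S = {}"
    unfolding parallel_series_cycles_iff[OF assms(2,3)] by simp_all
  have fin: "finite (X \<inter> P)" "finite (Y \<inter> P)" using assms(1) by (auto intro: finite_subset)
  have "sym_diff X Y \<inter> P = sym_diff (X \<inter> P) (Y \<inter> P)" by auto
  then have ev: "even (card (sym_diff X Y \<inter> P)) \<longleftrightarrow> (X \<inter> S = {} \<longleftrightarrow> Y \<inter> S = {})"
    using X(3) Y(3) even_card_sym_diff[OF fin] by simp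
  have "sym_diff X Y \<subseteq> P \<union> S" using X(1) Y(1) by auto
  moreover have "(X \<inter> S = {} \<longleftrightarrow> Y \<inter> S = {}) \<longleftrightarrow> sym_diff X Y \<inter> S = {}" using X(2) Y(2) assms(3) by auto
  moreover have "sym_diff X Y \<inter> S = {} \<or> S \<subseteq> sym_diff X Y" using X(2) Y(2) by auto
  ultimately show "sym_diff X Y \<in> parallel_series_cycles P S"
    unfolding parallel_series_cycles_iff[OF assms(2,3)] using ev by simp
qed (use assms in \<open>auto simp: parallel_series_cycles_def\<close>)

lemma indep_parallel_series:
  assumes fin: "finite (P \<union> S)" and PS: "P \<inter> S = {}" "S \<noteq> {}"
  shows "I \<in> indeps (matroid_of_cycles (P \<union> S) (parallel_series_cycles P S)) \<longleftrightarrow>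
    I \<subseteq> P \<union> S \<and> card (I \<inter> P) \<le> 1 \<and> \<not> (S \<subseteq> I \<and> I \<inter> P \<noteq> {})"
proof -
  interpret cycle_space "P \<union> S" "parallel_series_cycles P S" by (rule cycle_space_parallel_series[OF assms])
  note Z = parallel_series_cycles_iff[OF PS]
  show ?thesis
  proof
    assume I: "I \<in> indeps M"
    then have IE: "I \<subseteq> P \<union> S" and max: "\<And>X. X \<in> parallel_series_cycles P S \<Longrightarrow> X \<subseteq> I \<Longrightarrow> X = {}"
      unfolding indep_iff by auto
    have finI: "finite (I \<inter> P)" using fin by (auto intro: finite_subset)
    have "card (I \<inter> P) \<le> 1"
    proof (rule ccontr)
      assume "\<not> card (I \<inter> P) \<le> 1"
      then obtain p q where pq: "p \<in> I \<inter> P" "q \<in> I \<inter> P" "p \<noteq> q"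
        by (metis card_le_Suc0_iff_eq finI One_nat_def)
      then have "{p, q} \<in> parallel_series_cycles P S" using parallel_pair_cycle[OF _ _ pq(3) PS(1)] pq(1,2) by simp
      then show False using max[of "{p, q}"] pq by simp
    qed
    moreover have "\<not> (S \<subseteq> I \<and> I \<inter> P \<noteq> {})"
    proof
      assume *: "S \<subseteq> I \<and> I \<inter> P \<noteq> {}"
      then obtain p where p: "p \<in> I" "p \<in> P" by auto
      then have "insert p S \<in> parallel_series_cycles P S" using series_cycle[OF p(2) PS(1)] by simp
      then show False using max[of "insert p S"] p * by simp
    qed
    ultimately show "I \<subseteq> P \<union> S \<and> card (I \<inter> P) \<le> 1 \<and> \<not> (S \<subseteq> I \<and> I \<inter> P \<noteq> {})" using IE by blast
  next
    assume I: "I \<subseteq> P \<union> S \<and> card (I \<inter> P) \<le> 1 \<and> \<not> (S \<subseteq> I \<and> I \<inter> P \<noteq> {})"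
    show "I \<in> indeps M"
      unfolding indep_iff
    proof (intro conjI ballI impI)
      fix X assume X: "X \<in> parallel_series_cycles P S" "X \<subseteq> I"
      have finI: "finite (I \<inter> P)" using fin by (auto intro: finite_subset)
      have "card (X \<inter> P) \<le> card (I \<inter> P)" using X(2) finI by (intro card_mono) auto
      then have le: "card (X \<inter> P) \<le> 1" using I by simp
      show "X = {}"
      proof (cases "X \<inter> S = {}")
        case True
        then have "even (card (X \<inter> P))" using X(1) unfolding Z by simp
        then have "card (X \<inter> P) = 0" using le by (metis le_neq_implies_less less_one odd_one)
        moreover have "finite (X \<inter> P)" using fin by (auto intro: finite_subset)
        ultimately show ?thesis using True X(1) unfolding Z by auto
      next
        case False
        then have S: "S \<subseteq> X" "odd (card (X \<inter> P))" using X(1) unfolding Z by auto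
        then have "X \<inter> P \<noteq> {}" by auto
        then show ?thesis using I S X(2) by auto
      qed
    qed (use I in auto)
  qed
qed

text \<open>
  The element \<open>e\<close> and its copies \<open>P\<close> form the parallel class; the other elements of the circuit are in series.
\<close>

lemma add_parallel_uniform:
  assumes "2 \<le> r" "e < r" "finite P" "P \<inter> {..<r} = {}"
  shows "add_parallel (uniform_matroid (r - 1) r) e P =
    matroid_of_cycles (insert e P \<union> ({..<r} - {e})) (parallel_series_cycles (insert e P) ({..<r} - {e}))"
    (is "?N = matroid_of_cycles (?P \<union> ?S) _")
proof -
  have un: "?P \<union> ?S = {..<r} \<union> P" using assms(2) by auto
  have disj: "?P \<inter> ?S = {}" using assms(4) by auto
  have "card ?S = r - 1" using assms(2) by simp
  then have ne: "?S \<noteq> {}" using assms(1) by (metis One_nat_def Suc_1 card.empty diff_is_0_eq not_less_eq_eq)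
  have fin: "finite (?P \<union> ?S)" using assms(3) by simp
  have "?N = matroid_of_cycles (?P \<union> ?S) (parallel_series_cycles ?P ?S)"
  proof (rule indep_system_eqI)
    fix I assume "I \<subseteq> ground ?N"
    then have I: "I \<subseteq> {..<r} \<union> P" by (simp add: add_parallel_def uniform_matroid_def)
    let ?g = "\<lambda>x. if x \<in> P then e else x"
    have gI: "?g ` I \<subseteq> {..<r}" using I assms(2) by auto
    have "card (?g ` I) \<le> r - 1 \<longleftrightarrow> ?g ` I \<noteq> {..<r}"
    proof
      assume "card (?g ` I) \<le> r - 1"
      then have "card (?g ` I) \<noteq> card {..<r}" using assms(1) by simp
      then show "?g ` I \<noteq> {..<r}" by metis
    next
      assume "?g ` I \<noteq> {..<r}"
      then have "?g ` I \<subset> {..<r}" using gI by auto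
      then have "card (?g ` I) < card {..<r}" by (intro psubset_card_mono) auto
      then show "card (?g ` I) \<le> r - 1" by simp
    qed
    also have "?g ` I \<noteq> {..<r} \<longleftrightarrow> \<not> (?S \<subseteq> I \<and> I \<inter> ?P \<noteq> {})"
    proof -
      have "?g ` I = {..<r} \<longleftrightarrow> {..<r} \<subseteq> ?g ` I" using gI by auto
      also have "\<dots> \<longleftrightarrow> e \<in> ?g ` I \<and> ?S \<subseteq> ?g ` I" using assms(2) by auto
      also have "e \<in> ?g ` I \<longleftrightarrow> I \<inter> ?P \<noteq> {}" by auto
      also have "?S \<subseteq> ?g ` I \<longleftrightarrow> ?S \<subseteq> I"
      proof
        assume l: "?S \<subseteq> ?g ` I"
        show "?S \<subseteq> I"
        proof
          fix x assume x: "x \<in> ?S"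
          then obtain y where "y \<in> I" "x = ?g y" using l by blast
          then show "x \<in> I" using x by (auto split: if_splits)
        qed
      next
        assume r: "?S \<subseteq> I"
        show "?S \<subseteq> ?g ` I"
        proof
          fix x assume x: "x \<in> ?S"
          then have x': "?g x = x" "x \<in> I" using r assms(4) by auto
          show "x \<in> ?g ` I" by (rule image_eqI[of x ?g x]) (use x' in simp_all)
        qed
      qed
      finally show ?thesis by blast
    qed
    finally have "card (?g ` I) \<le> r - 1 \<longleftrightarrow> \<not> (?S \<subseteq> I \<and> I \<inter> ?P \<noteq> {})" .
    moreover have "I \<in> indeps ?N \<longleftrightarrow> card (I \<inter> ?P) \<le> 1 \<and> card (?g ` I) \<le> r - 1"
      using I gI by (simp add: add_parallel_def uniform_matroid_def)
    ultimately show "I \<in> indeps ?N \<longleftrightarrow> I \<in> indeps (matroid_of_cycles (?P \<union> ?S) (parallel_series_cycles ?P ?S))"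
      unfolding indep_parallel_series[OF fin disj ne] using I un by simp
  qed (use un in \<open>auto simp: add_parallel_def uniform_matroid_def matroid_of_cycles_def\<close>)
  then show ?thesis .
qed

lemma card_image_Int:
  assumes "inj_on f E" "X \<subseteq> E" "P \<subseteq> E"
  shows "f ` X \<inter> f ` P = f ` (X \<inter> P)" "card (f ` X \<inter> f ` P) = card (X \<inter> P)"
proof -
  show *: "f ` X \<inter> f ` P = f ` (X \<inter> P)" using inj_on_image_Int[OF assms] by simp
  have "inj_on f (X \<inter> P)" using assms by (meson inj_on_subset le_infI1)
  then show "card (f ` X \<inter> f ` P) = card (X \<inter> P)" using * card_image by metis
qed

lemma parallel_series_cycles_image:
  assumes inj: "inj_on f (P \<union> S)" and PS: "P \<inter> S = {}" "S \<noteq> {}" and X: "X \<subseteq> P \<union> S"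
  shows "X \<in> parallel_series_cycles P S \<longleftrightarrow> f ` X \<in> parallel_series_cycles (f ` P) (f ` S)"
proof -
  have sub: "P \<subseteq> P \<union> S" "S \<subseteq> P \<union> S" by auto
  have PS': "f ` P \<inter> f ` S = {}" "f ` S \<noteq> {}" using card_image_Int(1)[OF inj sub] PS by auto
  have "f ` X \<subseteq> f ` P \<union> f ` S" using X by auto
  moreover have "f ` S \<subseteq> f ` X \<longleftrightarrow> S \<subseteq> X" 
    using inj_on_image_mem_iff[OF inj _ X] sub(2) by blast
  ultimately show ?thesis
    unfolding parallel_series_cycles_iff[OF PS] parallel_series_cycles_iff[OF PS']
    using X card_image_Int[OF inj X sub(1)] card_image_Int(1)[OF inj X sub(2)] by simp
qed

text \<open>
  Transport along a bijection; together with \<open>iso_cycles\<close> it shows that the family is closed under isomorphism.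
\<close>

lemma parallel_series_pullback:
  assumes "bij_betw f E E'" "parallel_series E' Z'"
  shows "parallel_series E {X. X \<subseteq> E \<and> f ` X \<in> Z'}"
proof -
  obtain P' S' where PS': "P' \<inter> S' = {}" "P' \<noteq> {}" "S' \<noteq> {}" "E' = P' \<union> S'"
    "Z' = parallel_series_cycles P' S'" using assms(2) unfolding parallel_series_def by auto
  have inj: "inj_on f E" and im: "f ` E = E'" using assms(1) by (auto simp: bij_betw_def)
  define P where "P = {x \<in> E. f x \<in> P'}"
  define S where "S = {x \<in> E. f x \<in> S'}"
  have im': "f ` P = P'" "f ` S = S'" using im PS'(4) unfolding P_def S_def by auto
  have E: "E = P \<union> S" using im PS'(4) unfolding P_def S_def by auto
  have disj: "P \<inter> S = {}" using PS'(1) unfolding P_def S_def by auto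
  have ne: "P \<noteq> {}" "S \<noteq> {}" using im' PS'(2,3) by auto
  have "X \<in> parallel_series_cycles P S \<longleftrightarrow> f ` X \<in> Z'" if "X \<subseteq> E" for X
    using parallel_series_cycles_image[of f P S X] inj E disj ne that im' PS'(5) by simp
  moreover have "X \<in> parallel_series_cycles P S \<Longrightarrow> X \<subseteq> E" for X
    unfolding parallel_series_cycles_def E by simp
  ultimately have "{X. X \<subseteq> E \<and> f ` X \<in> Z'} = parallel_series_cycles P S" by auto
  then show ?thesis unfolding parallel_series_def using E disj ne by blast
qed

lemma in_list_a_parallel_series:
  assumes "matroid M" "in_list_a M"
  obtains Z where "cycle_space (ground M) Z" "M = matroid_of_cycles (ground M) Z" "parallel_series (ground M) Z"
proof -
  obtain r e P where r: "2 \<le> r" "e < r" "finite P" "P \<inter> {..<r} = {}"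
    "matroid_iso M (add_parallel (uniform_matroid (r - 1) r) e P)"
    using assms(2) by (auto simp: in_list_a_def)
  let ?P = "insert e P" and ?S = "{..<r} - {e}"
  let ?Z = "parallel_series_cycles ?P ?S"
  have disj: "?P \<inter> ?S = {}" using r(4) by auto
  have "card ?S = r - 1" using r(2) by simp
  then have ne: "?S \<noteq> {}" using r(1) by (metis One_nat_def Suc_1 card.empty diff_is_0_eq not_less_eq_eq)
  have fin: "finite (?P \<union> ?S)" using r(3) by simp
  have ps: "parallel_series (?P \<union> ?S) ?Z" unfolding parallel_series_def using disj ne by blast
  have "matroid_iso M (matroid_of_cycles (?P \<union> ?S) ?Z)" using r add_parallel_uniform[OF r(1-4)] by simp
  then obtain f where "bij_betw f (ground M) (?P \<union> ?S)"
    "cycle_space (ground M) {X. X \<subseteq> ground M \<and> f ` X \<in> ?Z}"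
    "M = matroid_of_cycles (ground M) {X. X \<subseteq> ground M \<and> f ` X \<in> ?Z}"
    by (rule iso_cycles[OF assms(1) _ cycle_space_parallel_series[OF fin disj ne]])
  then show ?thesis using that parallel_series_pullback[OF _ ps] by blast
qed

lemma parallel_series_in_list_a:
  assumes "cycle_space E Z" "parallel_series E Z"
  shows "in_list_a (matroid_of_cycles E Z)"
proof -
  interpret cycle_space E Z by fact
  obtain P S where PS: "P \<inter> S = {}" "P \<noteq> {}" "S \<noteq> {}" "E = P \<union> S" "Z = parallel_series_cycles P S"
    using assms(2) unfolding parallel_series_def by auto
  have fin: "finite P" "finite S" using finite_ground PS by auto
  \<comment> \<open>\<open>S\<close> goes to \<open>{..<s}\<close>, and \<open>s\<close> is the element of the circuit that is copied\<close>
  define s where "s = card S"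
  define p where "p = card P"
  have pos: "0 < s" "0 < p" unfolding s_def p_def using fin PS by (auto simp: card_gt_0_iff)
  have cs: "card S = card {..<s}" "card P = card {s..<s + p}" by (simp_all add: s_def p_def)
  obtain g where g: "bij_betw g S {..<s}"
    using finite_same_card_bij[OF fin(2) finite_lessThan cs(1)] ..
  obtain h where h: "bij_betw h P {s..<s + p}"
    using finite_same_card_bij[OF fin(1) finite_atLeastLessThan cs(2)] ..
  define f where "f x = (if x \<in> S then g x else h x)" for x
  have fS: "bij_betw f S {..<s}"
    by (rule bij_betw_cong[THEN iffD1, OF _ g]) (simp add: f_def)
  have fP: "bij_betw f P {s..<s + p}"
    by (rule bij_betw_cong[THEN iffD1, OF _ h]) (use PS(1) in \<open>auto simp: f_def\<close>)
  have "bij_betw f (P \<union> S) ({s..<s + p} \<union> {..<s})" by (rule bij_betw_combine[OF fP fS]) auto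
  moreover have sp: "{s..<s + p} = insert s {Suc s..<s + p}" using pos by auto
  moreover have ss: "{..<s} = {..<Suc s} - {s}" by auto
  ultimately have f: "bij_betw f E (insert s {Suc s..<s + p} \<union> ({..<Suc s} - {s}))" using PS(4) by simp
  have add: "add_parallel (uniform_matroid (Suc s - 1) (Suc s)) s {Suc s..<s + p} =
     matroid_of_cycles (insert s {Suc s..<s + p} \<union> ({..<Suc s} - {s}))
       (parallel_series_cycles (insert s {Suc s..<s + p}) ({..<Suc s} - {s}))"
    by (rule add_parallel_uniform) (use pos in auto)
  have im: "f ` P = insert s {Suc s..<s + p}" "f ` S = {..<Suc s} - {s}"
    using fP fS sp ss by (simp_all add: bij_betw_def)
  have "matroid_iso M (add_parallel (uniform_matroid (Suc s - 1) (Suc s)) s {Suc s..<s + p})"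
    unfolding add
  proof (rule matroid_of_cycles_iso[OF assms(1) _ f])
    show "cycle_space (insert s {Suc s..<s + p} \<union> ({..<Suc s} - {s}))
       (parallel_series_cycles (insert s {Suc s..<s + p}) ({..<Suc s} - {s}))"
      by (rule cycle_space_parallel_series) (use pos in auto)
    show "X \<in> Z \<longleftrightarrow> f ` X \<in> parallel_series_cycles (insert s {Suc s..<s + p}) ({..<Suc s} - {s})"
      if "X \<subseteq> E" for X
      using parallel_series_cycles_image[of f P S X] f PS that im by (simp add: bij_betw_def)
  qed
  moreover have "2 \<le> Suc s" "s < Suc s" "finite {Suc s..<s + p}" "{Suc s..<s + p} \<inter> {..<Suc s} = {}"
    using pos by auto
  ultimately show ?thesis unfolding in_list_a_def by blast
qed

context cycle_space
begin

lemma split_flacet_cycle: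
  assumes "split_flacet M F" "x \<in> F"
  shows "\<exists>X\<in>Z. x \<in> X \<and> X \<subseteq> F"
proof -
  have F: "F \<subseteq> E" "2 \<le> card F" "matroid_connected (restriction M F)"
    using assms unfolding split_flacet_def flat_iff by auto
  interpret R: cycle_space F "Z \<inter> Pow F" by (rule cycle_space_restrict[OF cycle_space_axioms F(1)])
  have "matroid_connected R.M" using F by (simp add: restriction_cycles[OF F(1)])
  then show ?thesis using R.connected_in_cycle[OF _ F(2) assms(2)] by blast
qed

lemma flat_cycle:
  assumes "flat M F" "X \<in> Z" "X \<subseteq> insert e F"
  shows "X \<subseteq> F"
proof (rule ccontr)
  assume "\<not> X \<subseteq> F"
  then have "X - F = {e}" using assms(3) by auto
  then show False using cl_not_single[of F X e] assms unfolding flat_iff by simp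
qed

lemma connectedI:
  assumes "E \<noteq> {}" "\<And>K e f. separator K \<Longrightarrow> e \<in> K \<Longrightarrow> f \<in> E \<Longrightarrow> f \<in> K"
  shows "matroid_connected M"
  unfolding connected_iff
proof (intro allI impI)
  fix K assume K: "separator K"
  show "K = {} \<or> K = E"
  proof (cases "K = {}")
    case False
    then obtain e where "e \<in> K" by auto
    then have "E \<subseteq> K" using assms(2)[OF K] by auto
    then show ?thesis using K unfolding separator_def by auto
  qed simp
qed

lemma parallel_series_connected_split:
  assumes "parallel_series E Z"
  shows "matroid_connected M" "split_matroid M"
proof -
  obtain P S where PS: "P \<inter> S = {}" "P \<noteq> {}" "S \<noteq> {}" "E = P \<union> S" and Z: "Z = parallel_series_cycles P S"
    using assms unfolding parallel_series_def by auto
  note Ziff = parallel_series_cycles_iff[OF PS(1,3), folded Z]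
  have pair: "{p, q} \<in> Z" if "p \<in> P" "q \<in> P" "p \<noteq> q" for p q
    unfolding Z using that PS(1) by (rule parallel_pair_cycle)
  have ser: "insert p S \<in> Z" if "p \<in> P" for p
    unfolding Z using that PS(1) by (rule series_cycle)
  show "matroid_connected M"
  proof (rule connectedI)
    show "E \<noteq> {}" using PS by auto
    fix K e f assume K: "separator K" and e: "e \<in> K" and f: "f \<in> E"
    have KE: "K \<subseteq> E" and tr: "\<And>X. X \<in> Z \<Longrightarrow> X \<inter> K \<in> Z" using K by (auto simp: separator_def)
    have 1: "S \<subseteq> K" if p: "p \<in> P" "p \<in> K" for p
    proof -
      have "(insert p S \<inter> K) \<inter> P = {p}" using p PS by auto
      then have "S \<subseteq> insert p S \<inter> K" using tr[OF ser[OF p(1)]] unfolding Ziff by auto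
      then show ?thesis by auto
    qed
    have 2: "p \<in> K" if p: "p \<in> P" and s: "s \<in> S" "s \<in> K" for p s
    proof (rule ccontr)
      assume "p \<notin> K"
      then have "(insert p S \<inter> K) \<inter> P = {}" using PS by auto
      then have "(insert p S \<inter> K) \<inter> S = {}" using tr[OF ser[OF p]] unfolding Ziff by simp
      then show False using s by auto
    qed
    show "f \<in> K" using 1 2 e f KE PS by blast
  qed
  \<comment> \<open>\<open>P\<close> is the only possible split flacet, so nothing has to be compatible\<close>
  have "F = P" if F: "split_flacet M F" for F
  proof -
    have fl: "flat M F" and FE: "F \<noteq> E" "F \<subseteq> E" and F2: "2 \<le> card F"
      using F unfolding split_flacet_def flat_iff by auto
    have PF: "P \<subseteq> F" if p: "p \<in> P" "p \<in> F" for p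
    proof
      fix q assume q: "q \<in> P"
      show "q \<in> F"
      proof (cases "q = p")
        case False
        then show ?thesis using flat_cycle[OF fl pair[OF q p(1) False], of q] p by auto
      qed (use p in simp)
    qed
    have "F \<inter> S = {}"
    proof (rule ccontr)
      assume "F \<inter> S \<noteq> {}"
      then obtain s where s: "s \<in> F" "s \<in> S" by auto
      then obtain X where X: "X \<in> Z" "s \<in> X" "X \<subseteq> F" using split_flacet_cycle[OF F] by blast
      then have "S \<subseteq> X" "odd (card (X \<inter> P))" using s unfolding Ziff by auto
      moreover then have "X \<inter> P \<noteq> {}" by auto
      ultimately have "P \<union> S \<subseteq> F" using PF X(3) by blast
      then show False using FE PS by auto
    qed
    moreover have "F \<noteq> {}" using F2 by auto
    ultimately show ?thesis using PF FE PS by blast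
  qed
  then show "split_matroid M" unfolding split_matroid_def by metis
qed

end

section \<open>Three parallel or series classes\<close>

lemma card_insert_Int:
  assumes "finite F" "x \<notin> F"
  shows "card (insert x F \<inter> T) = of_bool (x \<in> T) + card (F \<inter> T)"
  using assms by (cases "x \<in> T") auto

lemma cycle_space_three_parallel:
  assumes "finite E" "tripartition E A B C"
  shows "cycle_space E (three_parallel_cycles A B C)"
proof
  have E: "E = A \<union> B \<union> C" using assms by (simp add: tripartition_def)
  fix X Y assume X: "X \<in> three_parallel_cycles A B C" and Y: "Y \<in> three_parallel_cycles A B C"
  have sub: "X \<subseteq> E" "Y \<subseteq> E" using X Y E by (auto simp: three_parallel_cycles_def)
  have ev: "even (card (sym_diff X Y \<inter> T)) \<longleftrightarrow> (even (card (X \<inter> T)) \<longleftrightarrow> even (card (Y \<inter> T)))" for T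
  proof -
    have "sym_diff X Y \<inter> T = sym_diff (X \<inter> T) (Y \<inter> T)" by auto
    moreover have "finite (X \<inter> T)" "finite (Y \<inter> T)" using sub assms(1) by (auto intro: finite_subset)
    ultimately show ?thesis by (simp add: even_card_sym_diff)
  qed
  show "sym_diff X Y \<in> three_parallel_cycles A B C"
    using X Y sub E unfolding three_parallel_cycles_def mem_Collect_eq ev by auto
qed (use assms in \<open>auto simp: three_parallel_cycles_def tripartition_def\<close>)

lemma card_Int_Un_disjoint:
  assumes "finite X" "A \<inter> B = {}"
  shows "card (X \<inter> (A \<union> B)) = card (X \<inter> A) + card (X \<inter> B)"
proof -
  have "X \<inter> (A \<union> B) = (X \<inter> A) \<union> (X \<inter> B)" by auto
  then show ?thesis using assms by (simp only:) (rule card_Un_disjoint, auto)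
qed

lemma three_parallel_pair:
  assumes "tripartition E A B C" "x \<in> E" "y \<in> E" "x \<noteq> y"
  shows "{x, y} \<in> three_parallel_cycles A B C \<longleftrightarrow>
    (x \<in> A \<longleftrightarrow> y \<in> A) \<and> (x \<in> B \<longleftrightarrow> y \<in> B) \<and> (x \<in> C \<longleftrightarrow> y \<in> C)"
proof -
  have "card ({x, y} \<inter> T) = of_bool (x \<in> T) + of_bool (y \<in> T)" for T
    using assms(4) by (subst card_insert_Int, simp, simp, subst card_insert_Int) simp_all
  then have c: "even (card ({x, y} \<inter> T)) \<longleftrightarrow> (x \<in> T \<longleftrightarrow> y \<in> T)" for T
    by simp
  show ?thesis
    using assms(1-3) unfolding three_parallel_cycles_def mem_Collect_eq c tripartition_def
    by auto
qed

lemma three_parallel_single: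
  assumes "tripartition E A B C"
  shows "{x} \<notin> three_parallel_cycles A B C"
proof
  assume x: "{x} \<in> three_parallel_cycles A B C"
  have c: "even (card ({x} \<inter> T)) \<longleftrightarrow> x \<notin> T" for T by (cases "x \<in> T") auto
  show False
    using x assms unfolding three_parallel_cycles_def mem_Collect_eq c tripartition_def
    by auto
qed

lemma three_parallel_triple:
  assumes "tripartition E A B C" "a \<in> A" "b \<in> B" "c \<in> C"
  shows "{a, b, c} \<in> three_parallel_cycles A B C"
proof -
  have eq: "{a, b, c} \<inter> A = {a}" "{a, b, c} \<inter> B = {b}" "{a, b, c} \<inter> C = {c}"
    using assms by (auto simp: tripartition_def)
  show ?thesis unfolding three_parallel_cycles_def mem_Collect_eq eq using assms by simp
qed

lemma cocycles_three_parallel: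
  assumes fin: "finite E" and t: "tripartition E A B C"
  shows "cocycles E (three_parallel_cycles A B C) = three_series_cycles A B C"
proof
  have disj: "A \<inter> B = {}" "A \<inter> C = {}" "B \<inter> C = {}" and E: "E = A \<union> B \<union> C"
    and ne: "A \<noteq> {}" "B \<noteq> {}" "C \<noteq> {}"
    using t by (simp_all add: tripartition_def)
  show "three_series_cycles A B C \<subseteq> cocycles E (three_parallel_cycles A B C)"
  proof
    fix D assume D: "D \<in> three_series_cycles A B C"
    show "D \<in> cocycles E (three_parallel_cycles A B C)"
      unfolding cocycles_def
    proof (intro CollectI conjI ballI)
      show "D \<subseteq> E" using D E by (auto simp: three_series_cycles_def)
      fix X assume X: "X \<in> three_parallel_cycles A B C"
      then have "X \<subseteq> E" using E by (auto simp: three_parallel_cycles_def)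
      then have finX: "finite X" using fin finite_subset by blast
      show "even (card (X \<inter> D))"
        using D X unfolding three_series_cycles_def three_parallel_cycles_def
        by (auto simp: card_Int_Un_disjoint[OF finX] disj)
    qed
  qed
  show "cocycles E (three_parallel_cycles A B C) \<subseteq> three_series_cycles A B C"
  proof
    fix D assume "D \<in> cocycles E (three_parallel_cycles A B C)"
    then have DE: "D \<subseteq> E" and even: "\<And>X. X \<in> three_parallel_cycles A B C \<Longrightarrow> even (card (X \<inter> D))"
      by (auto simp: cocycles_def)
    have pair: "x \<in> D \<longleftrightarrow> y \<in> D" if "x \<in> E" "y \<in> E" "{x, y} \<in> three_parallel_cycles A B C" for x y
    proof (cases "x = y")
      case False
      then have "even (card ({x, y} \<inter> D))" using even that by blast
      then show ?thesis using False by (cases "x \<in> D"; cases "y \<in> D") auto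
    qed simp
    have cls: "D \<inter> T = {} \<or> T \<subseteq> D" if T: "T = A \<or> T = B \<or> T = C" for T
    proof -
      have "x \<in> D \<longleftrightarrow> y \<in> D" if xy: "x \<in> T" "y \<in> T" for x y
      proof (cases "x = y")
        case False
        have "x \<in> E" "y \<in> E" using xy T E by auto
        moreover have "{x, y} \<in> three_parallel_cycles A B C"
          using three_parallel_pair[OF t calculation False] xy T disj by auto
        ultimately show ?thesis using pair by blast
      qed simp
      then show ?thesis by blast
    qed
    obtain a b c where abc: "a \<in> A" "b \<in> B" "c \<in> C" using ne by auto
    have dist: "a \<noteq> b" "a \<noteq> c" "b \<noteq> c" using abc disj by auto
    have "even (card ({a, b, c} \<inter> D))" using even three_parallel_triple[OF t abc] by blast
    moreover have "card ({a, b, c} \<inter> D) = of_bool (a \<in> D) + (of_bool (b \<in> D) + of_bool (c \<in> D))"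
      using dist by (subst card_insert_Int, simp, simp, subst card_insert_Int, simp, simp,
        subst card_insert_Int) simp_all
    ultimately have par: "even (of_bool (a \<in> D) + (of_bool (b \<in> D) + of_bool (c \<in> D)) :: nat)" by simp
    obtain u v w where uvw: "u \<longleftrightarrow> a \<in> D" "v \<longleftrightarrow> b \<in> D" "w \<longleftrightarrow> c \<in> D" by simp
    have traces: "D \<inter> A = (if u then A else {})" "D \<inter> B = (if v then B else {})"
      "D \<inter> C = (if w then C else {})"
      using cls[of A] cls[of B] cls[of C] abc uvw by auto
    have "D = (D \<inter> A) \<union> (D \<inter> B) \<union> (D \<inter> C)" using DE E by auto
    then have "D = (if u then A else {}) \<union> (if v then B else {}) \<union> (if w then C else {})"
      unfolding traces .
    moreover have "even (of_bool u + (of_bool v + of_bool w) :: nat)" unfolding uvw by (rule par)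
    ultimately show "D \<in> three_series_cycles A B C"
      unfolding three_series_cycles_def by (cases u; cases v; cases w) simp_all
  qed
qed

lemma three_class_rank2_three_parallel:
  assumes fin: "finite E" and t: "tripartition E A B C"
  shows "three_class_rank2 (matroid_of_cycles E (three_parallel_cycles A B C))"
proof -
  let ?Z = "three_parallel_cycles A B C"
  interpret cycle_space E ?Z using cycle_space_three_parallel[OF assms] .
  have disj: "A \<inter> B = {}" "A \<inter> C = {}" "B \<inter> C = {}" and E: "E = A \<union> B \<union> C"
    and ne: "A \<noteq> {}" "B \<noteq> {}" "C \<noteq> {}"
    using t by (simp_all add: tripartition_def)
  have single: "{x} \<in> indeps M" if "x \<in> E" for x
    unfolding indep_iff using three_parallel_single[OF t] that by (auto simp: subset_singleton_iff)
  have clx: "e \<in> cl {x} \<longleftrightarrow> (x \<in> A \<longleftrightarrow> e \<in> A) \<and> (x \<in> B \<longleftrightarrow> e \<in> B) \<and> (x \<in> C \<longleftrightarrow> e \<in> C)"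
    if x: "x \<in> E" and e: "e \<in> E" for x e
  proof (cases "e = x")
    case True
    then show ?thesis using subset_cl[of "{x}"] x by auto
  next
    case False
    have "e \<in> cl {x} \<longleftrightarrow> (\<exists>W\<subseteq>{x}. e \<notin> W \<and> insert e W \<in> ?Z)"
      using in_cl_iff[of "{x}" e] x False by simp
    also have "\<dots> \<longleftrightarrow> {e} \<in> ?Z \<or> {e, x} \<in> ?Z" using False by (auto simp: subset_singleton_iff)
    finally show ?thesis using three_parallel_single[OF t] three_parallel_pair[OF t e x False] by blast
  qed
  have clT: "cl {x} = T" if "T = A \<or> T = B \<or> T = C" "x \<in> T" for x T
  proof
    have xE: "x \<in> E" using that E by auto
    show "cl {x} \<subseteq> T"
    proof
      fix e assume e: "e \<in> cl {x}"
      then have "e \<in> E" using cl_subset_ground by blast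
      then show "e \<in> T" using clx[OF xE] e that by blast
    qed
    show "T \<subseteq> cl {x}"
    proof
      fix e assume "e \<in> T"
      then show "e \<in> cl {x}" using clx[OF xE, of e] that E disj by blast
    qed
  qed
  obtain a b c where abc: "a \<in> A" "b \<in> B" "c \<in> C" using ne by auto
  have abcE: "a \<in> E" "b \<in> E" "c \<in> E" using abc E by auto
  have ab: "basis_in E {a, b}"
    unfolding basis_in_def
  proof (intro conjI)
    have bn: "b \<notin> {a}" "b \<notin> cl {a}" using abc disj clT[of A a] by auto
    then have "insert b {a} \<in> indeps M" using indep_insert_iff[OF single[OF abcE(1)] abcE(2)] by simp
    then show "{a, b} \<in> indeps M" by (simp add: insert_commute)
    have sub: "{a, b} \<subseteq> E" using abcE by simp
    show "{a, b} \<subseteq> E" by (rule sub)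
    have "cl {a} \<subseteq> cl {a, b}" "cl {b} \<subseteq> cl {a, b}" by (rule cl_mono, simp)+
    then have AB: "A \<subseteq> cl {a, b}" "B \<subseteq> cl {a, b}" using clT[of A a] clT[of B b] abc by simp_all
    have "C \<subseteq> cl {a, b}"
    proof
      fix z assume z: "z \<in> C"
      have "{a, b, z} \<in> ?Z" using three_parallel_triple[OF t abc(1,2) z] .
      moreover have "{a, b, z} = insert z {a, b}" by auto
      moreover have "z \<notin> {a, b}" using z abc disj by auto
      ultimately show "z \<in> cl {a, b}" unfolding in_cl_iff[OF sub] by (metis subset_refl)
    qed
    then show "E \<subseteq> cl {a, b}" using AB E by blast
  qed
  have "a \<noteq> b" using abc disj by auto
  then have rk2: "rk M E = 2" using rk_basis_in[OF ab] by simp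
  have "loopless M" unfolding loopless_def using rk_indep[OF single] by simp
  moreover have "parallel_classes M = {A, B, C}"
  proof
    show "{A, B, C} \<subseteq> parallel_classes M"
    proof
      fix T assume "T \<in> {A, B, C}"
      then obtain x where x: "x \<in> T" "T = A \<or> T = B \<or> T = C" using abc by auto
      then have xE: "x \<in> E" "{x} \<subseteq> E" using E by auto
      have "cl {x} = T" using clT x by blast
      then have "cl T = T" "rk M T = 1" using cl_cl[OF xE(2)] rk_cl[OF xE(2)] rk_indep[OF single[OF xE(1)]] by auto
      then show "T \<in> parallel_classes M" unfolding parallel_classes_def flat_iff using x E by auto
    qed
    show "parallel_classes M \<subseteq> {A, B, C}"
    proof
      fix T assume "T \<in> parallel_classes M"
      then have T: "T \<subseteq> E" "cl T = T" "rk M T = 1" unfolding parallel_classes_def flat_iff by auto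
      obtain I where I: "basis_in T I" "card I = 1" using basis_in_exists[OF T(1)] T(3) by metis
      then obtain x where x: "I = {x}" by (auto simp: card_1_singleton_iff)
      then have "x \<in> T" using I by (auto simp: basis_in_def)
      have "T = cl {x}" using basis_in_cl[OF I(1) T(1)] T(2) x by simp
      moreover have "x \<in> A \<or> x \<in> B \<or> x \<in> C" using \<open>x \<in> T\<close> T(1) E by auto
      ultimately show "T \<in> {A, B, C}" using clT by blast
    qed
  qed
  moreover have "A \<noteq> B" "A \<noteq> C" "B \<noteq> C" using disj ne by auto
  then have "card {A, B, C} = 3" by simp
  ultimately show ?thesis unfolding three_class_rank2_def using matroid_M rk2 by simp
qed

lemma rk_ge_card:
  assumes "matroid N" "I \<in> indeps N" "I \<subseteq> X"
  shows "card I \<le> rk N X"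
proof -
  have "finite {I \<in> indeps N. I \<subseteq> X}"
    by (rule finite_subset[of _ "Pow (ground N)"]) (use assms in \<open>auto simp: matroid_def\<close>)
  then show ?thesis unfolding rk_def using assms by (intro Max_ge) auto
qed

lemma rk_attained:
  assumes "matroid N"
  obtains I where "I \<in> indeps N" "I \<subseteq> X" "card I = rk N X"
proof -
  let ?S = "card ` {I \<in> indeps N. I \<subseteq> X}"
  have "finite {I \<in> indeps N. I \<subseteq> X}"
    by (rule finite_subset[of _ "Pow (ground N)"]) (use assms in \<open>auto simp: matroid_def\<close>)
  moreover have "{} \<in> {I \<in> indeps N. I \<subseteq> X}" using assms by (auto simp: matroid_def)
  ultimately have "Max ?S \<in> ?S" by (intro Max_in) auto
  then show ?thesis using that unfolding rk_def by auto
qed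

text \<open>
  A matroid with these properties is not assumed to be binary. Being equal or dependent is an equivalence
  relation by the augmentation axiom, its classes are the rank-one flats, and a pair is independent
  exactly if its elements lie in different classes.
\<close>

lemma three_class_rank2_cycles:
  assumes N: "three_class_rank2 N"
  obtains A B C where "tripartition (ground N) A B C"
    "N = matroid_of_cycles (ground N) (three_parallel_cycles A B C)"
proof -
  let ?E = "ground N"
  have mat: "matroid N" and loopless: "\<And>e. e \<in> ?E \<Longrightarrow> rk N {e} = 1" and rk2: "rk N ?E = 2"
    and card3: "card (parallel_classes N) = 3"
    using N by (auto simp: three_class_rank2_def loopless_def)
  have fin: "finite ?E" and sub: "\<And>I. I \<in> indeps N \<Longrightarrow> I \<subseteq> ?E" and empty: "{} \<in> indeps N"
    and down: "\<And>I J. I \<in> indeps N \<Longrightarrow> J \<subseteq> I \<Longrightarrow> J \<in> indeps N"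
    and aug: "\<And>I J. I \<in> indeps N \<Longrightarrow> J \<in> indeps N \<Longrightarrow> card I < card J \<Longrightarrow> \<exists>e\<in>J - I. insert e I \<in> indeps N"
    using mat unfolding matroid_def by auto
  have le2: "card I \<le> 2" if "I \<in> indeps N" for I using rk_ge_card[OF mat that sub[OF that]] rk2 by simp
  have single: "{e} \<in> indeps N" if e: "e \<in> ?E" for e
  proof -
    obtain I where I: "I \<in> indeps N" "I \<subseteq> {e}" "card I = rk N {e}" using rk_attained[OF mat] .
    then have "I = {e}" using loopless[OF e] by (auto simp: subset_singleton_iff)
    then show ?thesis using I by simp
  qed
  define par where "par e f \<longleftrightarrow> e = f \<or> {e, f} \<notin> indeps N" for e f
  have sym: "par e f \<longleftrightarrow> par f e" for e f unfolding par_def by (auto simp: insert_commute)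
  have trans: "par e g" if ef: "par e f" "par f g" and E: "f \<in> ?E" for e f g
  proof (rule ccontr)
    assume "\<not> par e g"
    then have eg: "e \<noteq> g" "{e, g} \<in> indeps N" by (auto simp: par_def)
    have "card {f} < card {e, g}" using eg by simp
    then obtain x where "x \<in> {e, g} - {f}" "insert x {f} \<in> indeps N"
      using aug[OF single[OF E] eg(2)] by blast
    then show False using ef eg unfolding par_def by (auto simp: insert_commute)
  qed
  define cls where "cls e = {f \<in> ?E. par e f}" for e
  have self: "e \<in> cls e" if "e \<in> ?E" for e using that by (simp add: cls_def par_def)
  have cls_eq: "cls e = cls f" if "par e f" "e \<in> ?E" "f \<in> ?E" for e f
    unfolding cls_def using trans[of f e] trans[of e f] sym that by blast
  have rk_cls: "rk N X = 1" if X: "X \<subseteq> cls e" "X \<noteq> {}" and eE: "e \<in> ?E" for X e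
  proof -
    obtain I where I: "I \<in> indeps N" "I \<subseteq> X" "card I = rk N X" using rk_attained[OF mat] .
    have finI: "finite I" using sub[OF I(1)] fin finite_subset by blast
    have "x = y" if xy: "x \<in> I" "y \<in> I" for x y
    proof (rule ccontr)
      assume "x \<noteq> y"
      have E: "par e x" "par e y" using xy I(2) X(1) by (auto simp: cls_def)
      have "par x y" using trans[OF _ E(2) eE] E(1) sym by blast
      moreover have "{x, y} \<in> indeps N" using down[OF I(1), of "{x, y}"] xy by simp
      ultimately show False using \<open>x \<noteq> y\<close> by (simp add: par_def)
    qed
    then have "card I \<le> Suc 0" using card_le_Suc0_iff_eq[OF finI] by blast
    moreover obtain x where x: "x \<in> X" using X by auto
    have "card {x} \<le> rk N X" by (rule rk_ge_card[OF mat single]) (use x X in \<open>auto simp: cls_def\<close>)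
    ultimately show ?thesis using I(3) by simp
  qed
  have classes: "parallel_classes N = cls ` ?E"
  proof
    show "cls ` ?E \<subseteq> parallel_classes N"
    proof
      fix F assume "F \<in> cls ` ?E"
      then obtain e where e: "F = cls e" "e \<in> ?E" by (rule imageE)
      have rkF: "rk N F = 1" using rk_cls[of F e] self[OF e(2)] e by auto
      have "rk N F < rk N (insert g F)" if g: "g \<in> ?E - F" for g
      proof -
        have "\<not> par e g" using g e by (simp add: cls_def)
        then have eg: "e \<noteq> g" "{e, g} \<in> indeps N" by (auto simp: par_def)
        have "card {e, g} \<le> rk N (insert g F)"
          by (rule rk_ge_card[OF mat eg(2)]) (use self[OF e(2)] e in auto)
        then show ?thesis using rkF eg(1) by simp
      qed
      then show "F \<in> parallel_classes N"
        unfolding parallel_classes_def flat_def using rkF e by (auto simp: cls_def)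
    qed
    show "parallel_classes N \<subseteq> cls ` ?E"
    proof
      fix F assume "F \<in> parallel_classes N"
      then have F: "F \<subseteq> ?E" "rk N F = 1" "\<And>g. g \<in> ?E - F \<Longrightarrow> rk N F < rk N (insert g F)"
        unfolding parallel_classes_def flat_def by auto
      obtain I where "I \<in> indeps N" "I \<subseteq> F" "card I = rk N F" using rk_attained[OF mat] .
      then obtain e where e: "e \<in> F" using F(2) by fastforce
      then have eE: "e \<in> ?E" using F by auto
      have "F \<subseteq> cls e"
      proof
        fix f assume f: "f \<in> F"
        show "f \<in> cls e"
        proof (rule ccontr)
          assume "f \<notin> cls e"
          then have "\<not> par e f" using f F by (auto simp: cls_def)
          then have ef: "e \<noteq> f" "{e, f} \<in> indeps N" by (auto simp: par_def)
          have "card {e, f} \<le> rk N F" by (rule rk_ge_card[OF mat ef(2)]) (use e f in auto)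
          then show False using F(2) ef(1) by simp
        qed
      qed
      moreover have "cls e \<subseteq> F"
      proof
        fix g assume g: "g \<in> cls e"
        show "g \<in> F"
        proof (rule ccontr)
          assume "g \<notin> F"
          moreover have "g \<in> ?E" using g by (simp add: cls_def)
          ultimately have "rk N F < rk N (insert g F)" using F(3) by blast
          moreover have "rk N (insert g F) = 1"
            by (rule rk_cls[of _ e]) (use g \<open>F \<subseteq> cls e\<close> eE in auto)
          ultimately show False using F(2) by simp
        qed
      qed
      ultimately show "F \<in> cls ` ?E" using eE by blast
    qed
  qed
  then have "card (cls ` ?E) = 3" using card3 by simp
  then obtain A B C where ABC: "cls ` ?E = {A, B, C}" "A \<noteq> B" "B \<noteq> C" "A \<noteq> C"
    by (auto simp: card_3_iff)
  have "A \<in> cls ` ?E" "B \<in> cls ` ?E" "C \<in> cls ` ?E" using ABC by simp_all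
  then obtain a b c where abc: "A = cls a" "a \<in> ?E" "B = cls b" "b \<in> ?E" "C = cls c" "c \<in> ?E"
    by (metis imageE)
  have disj: "cls e \<inter> cls f = {}" if "cls e \<noteq> cls f" "e \<in> ?E" "f \<in> ?E" for e f
  proof (rule ccontr)
    assume "cls e \<inter> cls f \<noteq> {}"
    then obtain g where g: "g \<in> ?E" "par e g" "par f g" by (auto simp: cls_def)
    then have "par e f" using trans[of e g f] sym by blast
    then show False using cls_eq that by blast
  qed
  have cover: "?E = A \<union> B \<union> C"
  proof
    show "?E \<subseteq> A \<union> B \<union> C"
    proof
      fix e assume e: "e \<in> ?E"
      then have "cls e \<in> {A, B, C}" using ABC(1) by blast
      then show "e \<in> A \<union> B \<union> C" using self[OF e] by auto
    qed
  qed (use abc in \<open>auto simp: cls_def\<close>)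
  have "A \<noteq> {}" "B \<noteq> {}" "C \<noteq> {}"
    using self[OF abc(2)] self[OF abc(4)] self[OF abc(6)] abc(1,3,5) by auto
  moreover have "A \<inter> B = {}" "A \<inter> C = {}" "B \<inter> C = {}"
    using disj[of a b] disj[of a c] disj[of b c] ABC(2-4) abc by simp_all
  ultimately have t: "tripartition ?E A B C"
    unfolding tripartition_def using cover by simp
  interpret Q: cycle_space ?E "three_parallel_cycles A B C" using cycle_space_three_parallel[OF fin t] .
  have par_cls: "par x y \<longleftrightarrow> (x \<in> A \<longleftrightarrow> y \<in> A) \<and> (x \<in> B \<longleftrightarrow> y \<in> B) \<and> (x \<in> C \<longleftrightarrow> y \<in> C)"
    if xy: "x \<in> ?E" "y \<in> ?E" for x y
  proof
    assume p: "par x y"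
    have "x \<in> cls e \<longleftrightarrow> y \<in> cls e" for e
      using trans[of e x y] trans[of e y x] p sym[of x y] xy by (auto simp: cls_def)
    then show "(x \<in> A \<longleftrightarrow> y \<in> A) \<and> (x \<in> B \<longleftrightarrow> y \<in> B) \<and> (x \<in> C \<longleftrightarrow> y \<in> C)" using abc by simp
  next
    assume r: "(x \<in> A \<longleftrightarrow> y \<in> A) \<and> (x \<in> B \<longleftrightarrow> y \<in> B) \<and> (x \<in> C \<longleftrightarrow> y \<in> C)"
    have "\<exists>e\<in>?E. x \<in> cls e \<and> y \<in> cls e" using r xy cover abc by auto
    then obtain e where "e \<in> ?E" "par e x" "par e y" by (auto simp: cls_def)
    then show "par x y" using trans[of x e y] sym by blast
  qed
  have "N = Q.M"
  proof (rule indep_system_eqI)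
    fix I assume IE: "I \<subseteq> ?E"
    have finI: "finite I" using IE fin finite_subset by blast
    have pairs: "I \<in> indeps N \<Longrightarrow> x \<in> I \<Longrightarrow> y \<in> I \<Longrightarrow> x \<noteq> y \<Longrightarrow> \<not> par x y" for x y
      using down[of I "{x, y}"] by (simp add: par_def)
    show "I \<in> indeps N \<longleftrightarrow> I \<in> indeps Q.M"
    proof
      assume I: "I \<in> indeps N"
      show "I \<in> indeps Q.M"
        unfolding Q.indep_iff
      proof (intro conjI ballI impI IE, rule ccontr)
        fix X assume X: "X \<in> three_parallel_cycles A B C" "X \<subseteq> I" "X \<noteq> {}"
        have finX: "finite X" using X(2) finI finite_subset by blast
        have "card X \<le> 2" using le2[OF down[OF I X(2)]] .
        moreover have "card X \<noteq> 0" using X(3) finX by simp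
        ultimately consider "card X = 1" | "card X = 2" by linarith
        then show False
        proof cases
          case 1
          then show False using X(1) three_parallel_single[OF t] by (auto simp: card_1_singleton_iff)
        next
          case 2
          then obtain x y where xy: "X = {x, y}" "x \<noteq> y" by (auto simp: card_2_iff)
          then have E: "x \<in> ?E" "y \<in> ?E" "x \<in> I" "y \<in> I" using X(2) IE by auto
          have "par x y" using three_parallel_pair[OF t E(1,2) xy(2)] X(1) xy(1) par_cls[OF E(1,2)] by simp
          then show False using pairs[OF I E(3,4) xy(2)] by simp
        qed
      qed
    next
      assume I: "I \<in> indeps Q.M"
      have npar: "\<not> par x y" if xy: "x \<in> I" "y \<in> I" "x \<noteq> y" for x y
      proof
        assume "par x y"
        have E: "x \<in> ?E" "y \<in> ?E" using xy IE by auto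
        have "{x, y} \<in> three_parallel_cycles A B C"
          using three_parallel_pair[OF t E xy(3)] par_cls[OF E] \<open>par x y\<close> by simp
        moreover have "{x, y} \<subseteq> I" using xy by simp
        ultimately have "{x, y} = {}" using I unfolding Q.indep_iff by blast
        then show False by simp
      qed
      have "rk Q.M ?E = 2"
        using three_class_rank2_three_parallel[OF fin t] by (simp add: three_class_rank2_def)
      then have "card I \<le> 2" using Q.indep_card_le_rk[OF I IE subset_refl] by simp
      then consider "card I = 0" | "card I = 1" | "card I = 2" by linarith
      then show "I \<in> indeps N"
      proof cases
        case 1
        then show ?thesis using finI empty by simp
      next
        case 2
        then show ?thesis using single IE by (auto simp: card_1_singleton_iff)
      next
        case 3
        then obtain x y where xy: "I = {x, y}" "x \<noteq> y" by (auto simp: card_2_iff)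
        then have "\<not> par x y" using npar by simp
        then show ?thesis using xy by (simp add: par_def)
      qed
    qed
  qed (use sub in \<open>auto simp: matroid_of_cycles_def\<close>)
  then show ?thesis using that[OF t] by blast
qed

lemma three_series_cycle_space:
  assumes "finite E" "tripartition E A B C"
  shows "cycle_space E (three_series_cycles A B C)"
  using cycle_space.cycle_space_cocycles[OF cycle_space_three_parallel[OF assms]]
  unfolding cocycles_three_parallel[OF assms] .

lemma tripartition_pullback:
  assumes f: "bij_betw f E E'" and t: "tripartition E' A' B' C'"
  obtains A B C where "tripartition E A B C"
    "{X. X \<subseteq> E \<and> f ` X \<in> three_parallel_cycles A' B' C'} = three_parallel_cycles A B C"
    "{X. X \<subseteq> E \<and> f ` X \<in> three_series_cycles A' B' C'} = three_series_cycles A B C"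
proof -
  have inj: "inj_on f E" and im: "f ` E = E'" using f by (auto simp: bij_betw_def)
  have E': "E' = A' \<union> B' \<union> C'" and ne': "A' \<noteq> {}" "B' \<noteq> {}" "C' \<noteq> {}"
    and disj': "A' \<inter> B' = {}" "A' \<inter> C' = {}" "B' \<inter> C' = {}"
    using t by (simp_all add: tripartition_def)
  define pre where "pre T = {x \<in> E. f x \<in> T}" for T
  have pre: "f ` pre T = T" "pre T \<subseteq> E" if "T \<subseteq> E'" for T using im that unfolding pre_def by auto
  have sub: "A' \<subseteq> E'" "B' \<subseteq> E'" "C' \<subseteq> E'" using E' by auto
  have "pre A' \<noteq> {}" "pre B' \<noteq> {}" "pre C' \<noteq> {}"
    using pre(1)[OF sub(1)] pre(1)[OF sub(2)] pre(1)[OF sub(3)] ne' by auto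
  moreover have "pre A' \<inter> pre B' = {}" "pre A' \<inter> pre C' = {}" "pre B' \<inter> pre C' = {}"
    using disj' unfolding pre_def by auto
  moreover have E: "E = pre A' \<union> pre B' \<union> pre C'" using im E' unfolding pre_def by auto
  ultimately have t': "tripartition E (pre A') (pre B') (pre C')" unfolding tripartition_def by simp
  have c: "card (f ` X \<inter> T) = card (X \<inter> pre T)" if "X \<subseteq> E" "T \<subseteq> E'" for X T
    using card_image_Int(2)[OF inj that(1) pre(2)[OF that(2)]] pre(1)[OF that(2)] by simp
  have "{X. X \<subseteq> E \<and> f ` X \<in> three_parallel_cycles A' B' C'} = three_parallel_cycles (pre A') (pre B') (pre C')"
  proof (rule set_eqI)
    fix X
    show "X \<in> {X. X \<subseteq> E \<and> f ` X \<in> three_parallel_cycles A' B' C'} \<longleftrightarrow>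
      X \<in> three_parallel_cycles (pre A') (pre B') (pre C')"
    proof (cases "X \<subseteq> E")
      case True
      then have "f ` X \<subseteq> E'" using im by auto
      then show ?thesis
        unfolding three_parallel_cycles_def mem_Collect_eq E'[symmetric] E[symmetric]
          c[OF True sub(1)] c[OF True sub(2)] c[OF True sub(3)] using True by simp
    next
      case False
      then show ?thesis unfolding three_parallel_cycles_def mem_Collect_eq E[symmetric] by simp
    qed
  qed
  moreover have "{X. X \<subseteq> E \<and> f ` X \<in> three_series_cycles A' B' C'} = three_series_cycles (pre A') (pre B') (pre C')"
  proof -
    have eq: "f ` X = T \<longleftrightarrow> X = pre T" if "X \<subseteq> E" "T \<subseteq> E'" for X T
      using inj_on_image_eq_iff[OF inj that(1) pre(2)[OF that(2)]] pre(1)[OF that(2)] by simp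
    have un: "pre (S \<union> T) = pre S \<union> pre T" for S T unfolding pre_def by auto
    have subs: "A' \<union> B' \<subseteq> E'" "A' \<union> C' \<subseteq> E'" "B' \<union> C' \<subseteq> E'" using E' by auto
    show ?thesis
    proof (rule set_eqI)
      fix X
      show "X \<in> {X. X \<subseteq> E \<and> f ` X \<in> three_series_cycles A' B' C'} \<longleftrightarrow>
        X \<in> three_series_cycles (pre A') (pre B') (pre C')"
      proof (cases "X \<subseteq> E")
        case True
        then show ?thesis
          unfolding three_series_cycles_def mem_Collect_eq insert_iff empty_iff image_is_empty
            eq[OF True subs(1)] eq[OF True subs(2)] eq[OF True subs(3)] un by simp
      next
        case False
        then show ?thesis using E unfolding three_series_cycles_def by auto
      qed
    qed
  qed
  ultimately show ?thesis using that[OF t'] by simp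
qed

lemma in_list_b_cycles:
  assumes "matroid M" "in_list_b M"
  obtains A B C where "tripartition (ground M) A B C"
    "M = matroid_of_cycles (ground M) (three_parallel_cycles A B C) \<or>
     M = matroid_of_cycles (ground M) (three_series_cycles A B C)"
proof -
  obtain N :: "'a indep_system" where N: "three_class_rank2 N" "matroid_iso M N \<or> matroid_iso M (dual N)"
    using assms(2) by (auto simp: in_list_b_def)
  have fin: "finite (ground N)" using N(1) by (simp add: three_class_rank2_def matroid_def)
  obtain A B C where t: "tripartition (ground N) A B C"
    and Neq: "N = matroid_of_cycles (ground N) (three_parallel_cycles A B C)"
    using three_class_rank2_cycles[OF N(1)] by metis
  note cs = cycle_space_three_parallel[OF fin t]
  have "dual (matroid_of_cycles (ground N) (three_parallel_cycles A B C)) =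
      matroid_of_cycles (ground N) (three_series_cycles A B C)"
    using cycle_space.dual_cycles[OF cs] cocycles_three_parallel[OF fin t] by simp
  then have dN: "dual N = matroid_of_cycles (ground N) (three_series_cycles A B C)"
    using Neq by simp
  show ?thesis
    using N(2)
  proof
    assume "matroid_iso M N"
    then have "matroid_iso M (matroid_of_cycles (ground N) (three_parallel_cycles A B C))"
      using Neq by simp
    then obtain f where f: "bij_betw f (ground M) (ground N)"
      "M = matroid_of_cycles (ground M) {X. X \<subseteq> ground M \<and> f ` X \<in> three_parallel_cycles A B C}"
      by (rule iso_cycles[OF assms(1) _ cs])
    obtain A2 B2 C2 where t2: "tripartition (ground M) A2 B2 C2"
      "{X. X \<subseteq> ground M \<and> f ` X \<in> three_parallel_cycles A B C} = three_parallel_cycles A2 B2 C2"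
      "{X. X \<subseteq> ground M \<and> f ` X \<in> three_series_cycles A B C} = three_series_cycles A2 B2 C2"
      by (rule tripartition_pullback[OF f(1) t])
    have "M = matroid_of_cycles (ground M) (three_parallel_cycles A2 B2 C2)" using f(2) unfolding t2(2) .
    then show ?thesis by (intro that[OF t2(1)] disjI1)
  next
    assume "matroid_iso M (dual N)"
    then have "matroid_iso M (matroid_of_cycles (ground N) (three_series_cycles A B C))"
      using dN by simp
    then obtain f where f: "bij_betw f (ground M) (ground N)"
      "M = matroid_of_cycles (ground M) {X. X \<subseteq> ground M \<and> f ` X \<in> three_series_cycles A B C}"
      by (rule iso_cycles[OF assms(1) _ three_series_cycle_space[OF fin t]])
    obtain A2 B2 C2 where t2: "tripartition (ground M) A2 B2 C2"
      "{X. X \<subseteq> ground M \<and> f ` X \<in> three_parallel_cycles A B C} = three_parallel_cycles A2 B2 C2"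
      "{X. X \<subseteq> ground M \<and> f ` X \<in> three_series_cycles A B C} = three_series_cycles A2 B2 C2"
      by (rule tripartition_pullback[OF f(1) t])
    have "M = matroid_of_cycles (ground M) (three_series_cycles A2 B2 C2)" using f(2) unfolding t2(3) .
    then show ?thesis by (intro that[OF t2(1)] disjI2)
  qed
qed

lemma three_parallel_in_list_b:
  assumes "finite E" "tripartition E A B C"
  shows "in_list_b (matroid_of_cycles E (three_parallel_cycles A B C))"
  unfolding in_list_b_def using three_class_rank2_three_parallel[OF assms] matroid_iso_refl by blast

lemma three_series_in_list_b:
  assumes "finite E" "tripartition E A B C"
  shows "in_list_b (matroid_of_cycles E (three_series_cycles A B C))"
proof -
  have "dual (matroid_of_cycles E (three_parallel_cycles A B C)) =
      matroid_of_cycles E (three_series_cycles A B C)"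
    using cycle_space.dual_cycles[OF cycle_space_three_parallel[OF assms]]
      cocycles_three_parallel[OF assms] by simp
  then show ?thesis
    unfolding in_list_b_def using three_class_rank2_three_parallel[OF assms] matroid_iso_refl by metis
qed

context cycle_space
begin

lemma three_parallel_connected_split:
  assumes t: "tripartition E A B C" and Z: "Z = three_parallel_cycles A B C"
  shows "matroid_connected M" "split_matroid M"
proof -
  have disj: "A \<inter> B = {}" "A \<inter> C = {}" "B \<inter> C = {}" and E: "E = A \<union> B \<union> C"
    and ne: "A \<noteq> {}" "B \<noteq> {}" "C \<noteq> {}"
    using t by (simp_all add: tripartition_def)
  show conn: "matroid_connected M"
  proof (rule connectedI)
    show "E \<noteq> {}" using E ne by auto
    fix K e f assume K: "separator K" and e: "e \<in> K" and f: "f \<in> E"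
    have KE: "K \<subseteq> E" and tr: "\<And>X. X \<in> Z \<Longrightarrow> X \<inter> K \<in> Z" using K by (auto simp: separator_def)
    have triple: "a \<in> K \<and> b \<in> K \<and> c \<in> K" if abc: "a \<in> A" "b \<in> B" "c \<in> C" and x: "x \<in> {a, b, c}" "x \<in> K"
      for a b c x
    proof -
      have Y: "{a, b, c} \<inter> K \<in> Z" using tr three_parallel_triple[OF t abc] Z by simp
      have "{a, b, c} \<inter> K \<inter> A = {a} \<inter> K" "{a, b, c} \<inter> K \<inter> B = {b} \<inter> K" "{a, b, c} \<inter> K \<inter> C = {c} \<inter> K"
        using abc disj by auto
      moreover have "even (card ({z} \<inter> K)) \<longleftrightarrow> z \<notin> K" for z by (cases "z \<in> K") auto
      ultimately have "a \<notin> K \<longleftrightarrow> c \<notin> K" "b \<notin> K \<longleftrightarrow> c \<notin> K"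
        using Y unfolding Z three_parallel_cycles_def mem_Collect_eq by simp_all
      then show ?thesis using x by auto
    qed
    obtain a b c where abc: "a \<in> A" "b \<in> B" "c \<in> C" using ne by auto
    have "e \<in> E" using e KE by auto
    then consider "e \<in> A" | "e \<in> B" | "e \<in> C" using E by auto
    then have abcK: "a \<in> K \<and> b \<in> K \<and> c \<in> K"
    proof cases
      case 1
      then have "b \<in> K" using triple[of e b c e] abc e by simp
      then show ?thesis using triple[of a b c b] abc by simp
    next
      case 2
      then have "a \<in> K" using triple[of a e c e] abc e by simp
      then show ?thesis using triple[of a b c a] abc by simp
    next
      case 3
      then have "a \<in> K" using triple[of a b e e] abc e by simp
      then show ?thesis using triple[of a b c a] abc by simp
    qed
    consider "f \<in> A" | "f \<in> B" | "f \<in> C" using f E by auto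
    then show "f \<in> K"
    proof cases
      case 1
      then show ?thesis using triple[of f b c b] abc abcK by simp
    next
      case 2
      then show ?thesis using triple[of a f c a] abc abcK by simp
    next
      case 3
      then show ?thesis using triple[of a b f a] abc abcK by simp
    qed
  qed
  have "rk M (ground M) = 2"
    using three_class_rank2_three_parallel[OF finite_ground t] unfolding Z three_class_rank2_def by blast
  then have r: "rk M E = 2" unfolding ground_M .
  show "split_matroid M"
    unfolding split_matroid_def ground_M
  proof (intro allI impI)
    fix F G assume "split_flacet M F \<and> split_flacet M G \<and> F \<noteq> G"
    then have F: "F \<subseteq> E" "cl F = F" "rk M F \<noteq> 0" "F \<noteq> E"
      and G: "G \<subseteq> E" "cl G = G" "rk M G \<noteq> 0" "G \<noteq> E" and FG: "F \<noteq> G"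
      unfolding split_flacet_def flat_iff ground_M by auto
    have cls: "H = cl {x}" if H: "H \<subseteq> E" "cl H = H" "rk M H \<noteq> 0" "H \<noteq> E" and x: "x \<in> H" for H x
    proof -
      have "rk M H < 2" using rk_proper_cl[OF H(1)] H r by simp
      then have rH: "rk M H = 1" using H(3) by simp
      have "{x} \<in> indeps M"
        unfolding indep_iff using three_parallel_single[OF t] Z x H(1) by (auto simp: subset_singleton_iff)
      then obtain I where I: "basis_in H I" "{x} \<subseteq> I" using basis_in_extends[of "{x}" H] x H(1) by auto
      have "card I = 1" using rk_basis_in[OF I(1)] rH by simp
      then have "I = {x}" using I(2) by (auto simp: card_1_singleton_iff)
      then show ?thesis using basis_in_cl[OF I(1) H(1)] H(2) by simp
    qed
    have "F \<inter> G = {}" using cls[OF F] cls[OF G] FG by blast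
    then show "card (F \<inter> G) + rk M E \<le> rk M F + rk M G" using r F(3) G(3) by simp
  qed
qed

text \<open>
  Submodularity of the rank in the special case that is needed.
\<close>

lemma cover_indep_Int_rk:
  assumes FG: "F \<subseteq> E" "G \<subseteq> E" "F \<union> G = E" and ind: "F \<inter> G \<in> indeps M"
  shows "card (F \<inter> G) + rk M E \<le> rk M F + rk M G"
proof -
  obtain I where I: "basis_in F I" "F \<inter> G \<subseteq> I" using basis_in_extends[OF ind _ FG(1)] by auto
  obtain J where J: "basis_in G J" "card J = rk M G" using basis_in_exists[OF FG(2)] by metis
  obtain B where B: "basis_in E B" "card B = rk M E" using basis_in_exists[of E] by auto
  have IJ: "I \<subseteq> F" "F \<subseteq> cl I" "J \<subseteq> G" "G \<subseteq> cl J" using I J by (auto simp: basis_in_def)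
  let ?U = "J \<union> (I - G)"
  have UE: "?U \<subseteq> E" using IJ FG by auto
  have clJ: "cl J \<subseteq> cl ?U" by (rule cl_mono) auto
  then have "I \<subseteq> cl ?U" using subset_cl[OF UE] IJ by blast
  then have "cl I \<subseteq> cl ?U" using cl_subset_cl UE by blast
  then have "E \<subseteq> cl ?U" using clJ IJ FG(3) by blast
  moreover have finU: "finite ?U" "finite I" "finite J" using UE IJ FG finite_subset_ground by (meson finite_subset finite_ground subset_trans)+
  moreover have "B \<in> indeps M" "B \<subseteq> E" using B by (auto simp: basis_in_def)
  ultimately have "card B \<le> card ?U" by (intro card_indep_le) auto
  also have "\<dots> \<le> card J + card (I - G)" by (rule card_Un_le)
  finally have "rk M E \<le> rk M G + card (I - G)" using B J by simp
  moreover have "card I = card (I \<inter> G) + card (I - G)" using card_Int_Diff[OF finU(2)] .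
  moreover have "card (F \<inter> G) \<le> card (I \<inter> G)" using I(2) finU(2) by (intro card_mono) auto
  ultimately show ?thesis using rk_basis_in[OF I(1)] by simp
qed

lemma three_series_connected_split:
  assumes t: "tripartition E A B C" and Z: "Z = three_series_cycles A B C"
  shows "matroid_connected M" "split_matroid M"
proof -
  have disj: "A \<inter> B = {}" "A \<inter> C = {}" "B \<inter> C = {}" and E: "E = A \<union> B \<union> C"
    and ne: "A \<noteq> {}" "B \<noteq> {}" "C \<noteq> {}"
    using t by (simp_all add: tripartition_def)
  have Zc: "X = {} \<or> X = A \<union> B \<or> X = A \<union> C \<or> X = B \<union> C" if "X \<in> Z" for X
    using that unfolding Z three_series_cycles_def by simp
  show "matroid_connected M"
    unfolding connected_iff
  proof (intro allI impI)
    fix K assume K: "separator K"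
    have KE: "K \<subseteq> E" and tr: "\<And>X. X \<in> Z \<Longrightarrow> X \<inter> K \<in> Z" using K by (auto simp: separator_def)
    have mem: "A \<union> B \<in> Z" "A \<union> C \<in> Z" unfolding Z three_series_cycles_def by simp_all
    have "(A \<union> B) \<inter> K = {} \<or> A \<union> B \<subseteq> K"
    proof -
      have "C \<inter> ((A \<union> B) \<inter> K) = {}" using disj by auto
      then show ?thesis using Zc[OF tr[OF mem(1)]] ne disj by auto
    qed
    moreover have "(A \<union> C) \<inter> K = {} \<or> A \<union> C \<subseteq> K"
    proof -
      have "B \<inter> ((A \<union> C) \<inter> K) = {}" using disj by auto
      then show ?thesis using Zc[OF tr[OF mem(2)]] ne disj by auto
    qed
    ultimately show "K = {} \<or> K = E" using KE E ne by auto
  qed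
  have flac: "F = A \<union> B \<or> F = A \<union> C \<or> F = B \<union> C" if F: "split_flacet M F" for F
  proof -
    have FE: "F \<noteq> E" "F \<subseteq> E" and F2: "2 \<le> card F"
      using F unfolding split_flacet_def flat_iff by auto
    have "F \<noteq> {}" using F2 by auto
    then obtain x where x: "x \<in> F" by auto
    obtain X where X: "X \<in> Z" "x \<in> X" "X \<subseteq> F" using split_flacet_cycle[OF F x] by auto
    have "F = X"
    proof (rule ccontr)
      assume "F \<noteq> X"
      then obtain y where y: "y \<in> F" "y \<notin> X" using X by auto
      then obtain Y where Y: "Y \<in> Z" "y \<in> Y" "Y \<subseteq> F" using split_flacet_cycle[OF F] by blast
      have "X \<noteq> {}" "X \<noteq> Y" "Y \<noteq> {}" using X Y y by auto
      then have "X \<union> Y = E" using Zc[OF X(1)] Zc[OF Y(1)] E by auto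
      then show False using X Y FE by auto
    qed
    then show ?thesis using Zc[OF X(1)] X(2) by auto
  qed
  have ind: "T \<in> indeps M" if T: "T = A \<or> T = B \<or> T = C" for T
    unfolding indep_iff
  proof (intro conjI ballI impI)
    show "T \<subseteq> E" using T E by auto
    fix X assume X: "X \<in> Z" "X \<subseteq> T"
    show "X = {}" using Zc[OF X(1)] X(2) T ne disj by auto
  qed
  show "split_matroid M"
    unfolding split_matroid_def ground_M
  proof (intro allI impI)
    fix F G assume "split_flacet M F \<and> split_flacet M G \<and> F \<noteq> G"
    then have F: "F = A \<union> B \<or> F = A \<union> C \<or> F = B \<union> C" and G: "G = A \<union> B \<or> G = A \<union> C \<or> G = B \<union> C"
      and FG: "F \<noteq> G" using flac by auto
    have "(A \<union> B) \<inter> (A \<union> C) = A" "(A \<union> B) \<inter> (B \<union> C) = B" "(A \<union> C) \<inter> (B \<union> C) = C"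
      using disj by auto
    then have "F \<inter> G = A \<or> F \<inter> G = B \<or> F \<inter> G = C"
      using F G FG by (elim disjE) (simp_all add: Int_commute)
    then have "F \<inter> G \<in> indeps M" using ind by auto
    moreover have "F \<subseteq> E" "G \<subseteq> E" "F \<union> G = E" using F G FG E by auto
    ultimately show "card (F \<inter> G) + rk M E \<le> rk M F + rk M G" using cover_indep_Int_rk by simp
  qed
qed

end

section \<open>The four large paving matroids\<close>

text \<open>
  The upper bounds are the numbers of nonzero vectors of dimension three and of odd vectors of dimension four.
\<close>

lemma large_paving_cases:
  assumes "large_paving E Z"
  shows "rk (matroid_of_cycles E Z) E = 3 \<and> card E \<in> {6, 7} \<or>
         rk (matroid_of_cycles E Z) E = 4 \<and> card E \<in> {7, 8}"
proof -
  interpret cycle_space E Z using assms by (simp add: large_paving_def)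
  have L: "paving M" "3 \<le> rk M E" "rk M E + 3 \<le> card E" using assms by (auto simp: large_paving_def)
  have "rk M E \<le> 4" using paving_rank_le_4 L by simp
  then consider "rk M E = 3" | "rk M E = 4" using L by linarith
  then show ?thesis
  proof cases
    case 1
    then have r: "rk M E = CARD(3)" by simp
    obtain \<phi> :: "'a \<Rightarrow> bit ^ 3" where \<phi>: "\<And>X. X \<subseteq> E \<Longrightarrow> X \<in> Z \<longleftrightarrow> sum \<phi> X = 0"
      using coordinate_embedding[OF r] by metis
    have inj: "inj_on \<phi> E" using \<phi> L(1,2) by (rule embedding_inj(1))
    have nz: "0 \<notin> \<phi> ` E" using \<phi> L(1,2) by (rule embedding_inj(2))
    have "finite (UNIV :: (bit ^ 3) set)" by (rule card_ge_0_finite) (simp add: CARD_bit)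
    then have N: "finite (UNIV - {0 :: bit ^ 3})" "card (UNIV - {0 :: bit ^ 3}) = 7"
      by (simp_all add: card_Diff_subset CARD_bit)
    have "card (\<phi> ` E) \<le> card (UNIV - {0 :: bit ^ 3})" using N(1) nz by (intro card_mono) auto
    then have "card E \<le> 7" using card_image[OF inj] N(2) by simp
    then have "card E = 6 \<or> card E = 7" using L(3) 1 by linarith
    then show ?thesis using 1 by simp
  next
    case 2
    then have r: "rk M E = CARD(4)" by simp
    have ev: "even (card X)" if "X \<in> Z" for X using paving_rank4_even[OF L(1) 2 _ that] L by simp
    obtain \<phi> :: "'a \<Rightarrow> bit ^ 4" where \<phi>: "\<And>X. X \<subseteq> E \<Longrightarrow> X \<in> Z \<longleftrightarrow> sum \<phi> X = 0"
      and odd: "\<And>e. e \<in> E \<Longrightarrow> (\<Sum>i\<in>UNIV. \<phi> e $ i) = 1"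
      using coordinate_embedding[OF r] ev by metis
    have inj: "inj_on \<phi> E" using \<phi> L(1,2) by (rule embedding_inj(1))
    let ?N = "{x :: bit ^ 4. (\<Sum>i\<in>UNIV. x $ i) = 1}"
    have "finite (UNIV :: (bit ^ 4) set)" by (rule card_ge_0_finite) (simp add: CARD_bit)
    then have N: "finite ?N" "card ?N = 8"
      using card_odd_vectors[where 'n = 4] by (auto intro: finite_subset[OF subset_UNIV])
    have "\<phi> ` E \<subseteq> ?N"
    proof
      fix y assume "y \<in> \<phi> ` E"
      then obtain e where e: "y = \<phi> e" "e \<in> E" by (rule imageE)
      show "y \<in> ?N" unfolding e(1) mem_Collect_eq by (rule odd[OF e(2)])
    qed
    then have "card (\<phi> ` E) \<le> card ?N" using N(1) by (intro card_mono)
    then have "card E \<le> 8" using card_image[OF inj] N(2) by simp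
    then have "card E = 7 \<or> card E = 8" using L(3) 2 by linarith
    then show ?thesis using 2 by simp
  qed
qed

lemma large_paving_pullback:
  assumes "matroid M" "matroid_iso M (matroid_of_cycles E' Z')" "large_paving E' Z'"
  obtains Z where "large_paving (ground M) Z" "M = matroid_of_cycles (ground M) Z"
proof -
  interpret B: cycle_space E' Z' using assms(3) by (simp add: large_paving_def)
  obtain f where f: "bij_betw f (ground M) E'"
    and cs: "cycle_space (ground M) {X. X \<subseteq> ground M \<and> f ` X \<in> Z'}"
    and M: "M = matroid_of_cycles (ground M) {X. X \<subseteq> ground M \<and> f ` X \<in> Z'}"
    by (rule iso_cycles[OF assms(1,2) B.cycle_space_axioms])
  let ?E = "ground M" and ?Z = "{X. X \<subseteq> ground M \<and> f ` X \<in> Z'}"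
  interpret A: cycle_space ?E ?Z by (rule cs)
  have rk: "rk A.M ?E = rk B.M E'" using rk_ground_iso[OF assms(2)] M B.ground_M by metis
  have card: "card ?E = card E'" using f by (rule bij_betw_same_card)
  have "paving A.M"
    unfolding A.paving_iff
  proof (intro ballI impI)
    fix X assume X: "X \<in> ?Z" "X \<noteq> {}"
    then have "inj_on f X" using f by (auto simp: bij_betw_def intro: inj_on_subset)
    then have "card (f ` X) = card X" by (rule card_image)
    moreover have "rk B.M E' \<le> card (f ` X)"
      using assms(3) X B.pavingD[of "f ` X"] by (simp add: large_paving_def)
    ultimately show "rk A.M ?E \<le> card X" using rk by simp
  qed
  then have "large_paving ?E ?Z" unfolding large_paving_def using assms(3) cs rk card by (simp add: large_paving_def)
  then show ?thesis using that M by blast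
qed

lemma sum_bit_coefficients:
  fixes g :: "'a \<Rightarrow> bit ^ 'n" and c :: "'a \<Rightarrow> bit"
  assumes "finite X"
  shows "(\<Sum>x\<in>X. c x *s g x) = sum g {x \<in> X. c x \<noteq> 0}"
    and "(\<Sum>x\<in>X. c x) = of_bool (odd (card {x \<in> X. c x \<noteq> 0}))"
proof -
  have one: "c x = 1" if "c x \<noteq> 0" for x using that by (cases "c x") auto
  show "(\<Sum>x\<in>X. c x *s g x) = sum g {x \<in> X. c x \<noteq> 0}"
    using assms one by (intro sum.mono_neutral_cong_right) auto
  have "(\<Sum>x\<in>X. c x) = (\<Sum>x\<in>X. of_bool (c x \<noteq> 0))"
    using one by (intro sum.cong) auto
  also have "\<dots> = of_bool (odd (card {x \<in> X. c x \<noteq> 0}))" by (rule sum_of_bool_bit[OF assms])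
  finally show "(\<Sum>x\<in>X. c x) = of_bool (odd (card {x \<in> X. c x \<noteq> 0}))" .
qed

lemma finite_UNIV_bit_vec: "finite (UNIV :: (bit ^ 'n) set)"
  by (rule card_ge_0_finite) (simp add: CARD_bit)

lemma finite_bit_vec_set: "finite (X :: (bit ^ 'n) set)"
  by (rule finite_subset[OF subset_UNIV finite_UNIV_bit_vec])

lemma bit_vec_add_eq_0_iff: "x + y = 0 \<longleftrightarrow> x = y" for x y :: "bit ^ 'n"
proof
  assume "x + y = 0"
  then have "x + (y + y) = y" by (simp only: add.assoc[symmetric] add_0_left)
  then show "x = y" by (simp only: bit_vec_add_self add_0_right)
qed (simp only: bit_vec_add_self)

lemma independent_bit_vec_iff:
  fixes X :: "(bit ^ 'n) set"
  shows "vec.independent X \<longleftrightarrow> (\<forall>Y\<subseteq>X. \<Sum>Y = 0 \<longrightarrow> Y = {})"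
proof -
  have fin: "finite X" by (rule finite_bit_vec_set)
  show ?thesis
  proof
    assume ind: "vec.independent X"
    show "\<forall>Y\<subseteq>X. \<Sum>Y = 0 \<longrightarrow> Y = {}"
    proof (intro allI impI, rule ccontr)
      fix Y assume Y: "Y \<subseteq> X" "\<Sum>Y = 0" "Y \<noteq> {}"
      let ?c = "\<lambda>x. of_bool (x \<in> Y) :: bit"
      have "{x \<in> X. ?c x \<noteq> 0} = Y" using Y(1) by auto
      then have "(\<Sum>x\<in>X. ?c x *s x) = 0" using sum_bit_coefficients(1)[OF fin, of ?c "\<lambda>x. x"] Y(2) by simp
      moreover have "\<exists>v\<in>X. ?c v \<noteq> 0" using Y by auto
      ultimately have "vec.dependent X" unfolding vec.dependent_finite[OF fin]
        by (intro exI[of _ ?c] conjI)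
      then show False using ind by simp
    qed
  next
    assume r: "\<forall>Y\<subseteq>X. \<Sum>Y = 0 \<longrightarrow> Y = {}"
    show "vec.independent X"
    proof
      assume "vec.dependent X"
      then obtain u where "(\<exists>v\<in>X. u v \<noteq> 0) \<and> (\<Sum>v\<in>X. u v *s v) = 0"
        unfolding vec.dependent_finite[OF fin] ..
      then obtain v where u: "v \<in> X" "u v \<noteq> 0" "(\<Sum>v\<in>X. u v *s v) = 0" by auto
      have "\<Sum>{x \<in> X. u x \<noteq> 0} = 0" using sum_bit_coefficients(1)[OF fin, of u "\<lambda>x. x"] u(3) by simp
      then have "{x \<in> X. u x \<noteq> 0} = {}" using r[rule_format, of "{x \<in> X. u x \<noteq> 0}"] by simp
      then show False using u(1,2) by blast
    qed
  qed
qed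

lemma affinely_independent_iff:
  "affinely_independent X \<longleftrightarrow> (\<forall>Y\<subseteq>X. even (card Y) \<and> \<Sum>Y = 0 \<longrightarrow> Y = {})"
proof -
  have fin: "finite X" by (rule finite_bit_vec_set)
  show ?thesis
  proof
    assume ind: "affinely_independent X"
    show "\<forall>Y\<subseteq>X. even (card Y) \<and> \<Sum>Y = 0 \<longrightarrow> Y = {}"
    proof (intro allI impI, rule ccontr)
      fix Y assume Y: "Y \<subseteq> X" "even (card Y) \<and> \<Sum>Y = 0" "Y \<noteq> {}"
      let ?c = "\<lambda>x. of_bool (x \<in> Y) :: bit"
      have eq: "{x \<in> X. ?c x \<noteq> 0} = Y" using Y(1) by auto
      have "(\<Sum>x\<in>X. ?c x *s x) = 0"
        unfolding sum_bit_coefficients(1)[OF fin, of ?c "\<lambda>x. x"] eq using Y(2) by simp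
      moreover have "(\<Sum>x\<in>X. ?c x) = 0"
        unfolding sum_bit_coefficients(2)[OF fin, of ?c] eq using Y(2) by simp
      ultimately have "\<forall>x\<in>X. ?c x = 0" using ind[unfolded affinely_independent_def, rule_format, of ?c] by blast
      then show False using Y by auto
    qed
  next
    assume r: "\<forall>Y\<subseteq>X. even (card Y) \<and> \<Sum>Y = 0 \<longrightarrow> Y = {}"
    show "affinely_independent X"
      unfolding affinely_independent_def
    proof (intro allI impI)
      fix c :: "bit ^ 3 \<Rightarrow> bit" assume c: "(\<Sum>x\<in>X. c x) = 0 \<and> (\<Sum>x\<in>X. c x *s x) = 0"
      have "\<Sum>{x \<in> X. c x \<noteq> 0} = 0" using sum_bit_coefficients(1)[OF fin, of c "\<lambda>x. x"] c by simp
      moreover have "of_bool (odd (card {x \<in> X. c x \<noteq> 0})) = (0 :: bit)"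
        unfolding sum_bit_coefficients(2)[OF fin, of c, symmetric] using c by simp
      then have "even (card {x \<in> X. c x \<noteq> 0})" by (simp only: of_bool_eq_0_iff not_not)
      ultimately have "{x \<in> X. c x \<noteq> 0} = {}" using r[rule_format, of "{x \<in> X. c x \<noteq> 0}"] by simp
      then show "\<forall>x\<in>X. c x = 0" by simp
    qed
  qed
qed

text \<open>
  A map that separates the classes of sets modulo cycles is injective on the subsets of an independent set.
\<close>

lemma (in cycle_space) indep_card_le_log:
  assumes I: "I \<in> indeps M" and g: "\<And>X Y. X \<subseteq> E \<Longrightarrow> Y \<subseteq> E \<Longrightarrow> g X = g Y \<Longrightarrow> sym_diff X Y \<in> Z"
    and "g ` Pow I \<subseteq> T" "finite T" "card T = 2 ^ k"
  shows "card I \<le> k"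
proof -
  have IE: "I \<subseteq> E" using I by (simp add: indep_iff)
  have inj: "inj_on g (Pow I)"
  proof (rule inj_onI)
    fix X Y assume XY: "X \<in> Pow I" "Y \<in> Pow I" "g X = g Y"
    then have "sym_diff X Y \<in> Z" using g IE by (meson PowD subset_trans)
    moreover have "sym_diff X Y \<subseteq> I" using XY by auto
    ultimately have "sym_diff X Y = {}" using I unfolding indep_iff by metis
    then show "X = Y" by auto
  qed
  have "card (Pow I) \<le> card T" using card_inj_on_le[OF inj assms(3,4)] .
  then have "(2::nat) ^ card I \<le> 2 ^ k" using IE finite_subset_ground assms(5) by (simp add: card_Pow)
  then show ?thesis by simp
qed

lemma (in cycle_space) rk_eqI:
  assumes "I \<in> indeps M" "card I = k" "\<And>J. J \<in> indeps M \<Longrightarrow> card J \<le> k"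
  shows "rk M E = k"
proof -
  obtain B where B: "basis_in E B" "card B = rk M E" using basis_in_exists[of E] by auto
  then have "rk M E \<le> k" using assms(3)[of B] by (simp add: basis_in_def)
  moreover have "k \<le> rk M E" using indep_card_le_rk[OF assms(1), of E] assms(1,2) by (simp add: indep_iff)
  ultimately show ?thesis by simp
qed

text \<open>
  The cycles of the Fano matroid and of \<open>AG32\<close>: sets of vectors with sum zero and, in the affine case, with
  an even number of elements.
\<close>

definition fano_cycles :: "(bit ^ 3) set set" where
  "fano_cycles = {X. X \<subseteq> UNIV - {0} \<and> \<Sum>X = 0}"

definition ag_cycles :: "(bit ^ 3) set set" where
  "ag_cycles = {X. even (card X) \<and> \<Sum>X = 0}"

lemma Sum_sym_diff: "\<Sum>(sym_diff X Y) = \<Sum>X + \<Sum>Y" for X Y :: "(bit ^ 'n) set"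
  by (rule sum_sym_diff) (rule bit_vec_add_self finite_bit_vec_set)+

lemma Fano_cycles: "Fano = matroid_of_cycles (UNIV - {0}) fano_cycles"
proof (rule indep_system_eqI)
  fix I assume I: "I \<subseteq> ground Fano"
  then have "I \<subseteq> UNIV - {0}" by (simp add: Fano_def)
  then show "I \<in> indeps Fano \<longleftrightarrow> I \<in> indeps (matroid_of_cycles (UNIV - {0}) fano_cycles)"
    unfolding Fano_def matroid_of_cycles_def fano_cycles_def
    by (simp add: independent_bit_vec_iff) (metis subset_trans)
qed (auto simp: Fano_def matroid_of_cycles_def)

lemma AG32_cycles: "AG32 = matroid_of_cycles UNIV ag_cycles"
proof -
  have "affinely_independent I \<longleftrightarrow> (\<forall>X\<in>ag_cycles. X \<subseteq> I \<longrightarrow> X = {})" for I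
    unfolding affinely_independent_iff ag_cycles_def by auto
  then have "Collect affinely_independent = {I. \<forall>X\<in>ag_cycles. X \<subseteq> I \<longrightarrow> X = {}}"
    by (rule Collect_cong)
  then show ?thesis unfolding AG32_def matroid_of_cycles_def by simp
qed

lemma small_zero_sum:
  fixes X :: "(bit ^ 'n) set"
  assumes "\<Sum>X = 0" "card X \<le> 2" "X \<noteq> {}"
  shows "X = {0}"
proof -
  have fin: "finite X" by (rule finite_bit_vec_set)
  then have "card X \<noteq> 0" using assms by simp
  then consider "card X = 1" | "card X = 2" using assms(2) by linarith
  then show ?thesis
  proof cases
    case 1
    then show ?thesis using assms(1) by (auto simp: card_1_singleton_iff)
  next
    case 2
    then obtain x y where xy: "X = {x, y}" "x \<noteq> y" by (auto simp: card_2_iff)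
    then have "x + y = 0" using assms(1) by simp
    then show ?thesis using xy bit_vec_add_eq_0_iff by blast
  qed
qed

lemma Fano_large_paving:
  shows "large_paving (UNIV - {0}) fano_cycles"
    and "rk (matroid_of_cycles (UNIV - {0}) fano_cycles) (UNIV - {0}) = 3"
    and "card (UNIV - {0 :: bit ^ 3}) = 7"
proof -
  let ?E = "UNIV - {0 :: bit ^ 3}"
  show card: "card ?E = 7" using finite_UNIV_bit_vec by (simp add: card_Diff_subset CARD_bit)
  have fin: "finite X" for X :: "(bit ^ 3) set" by (rule finite_bit_vec_set)
  interpret cycle_space ?E fano_cycles
    by unfold_locales (use fin in \<open>auto simp: fano_cycles_def Sum_sym_diff\<close>)
  have three: "3 \<le> card X" if X: "X \<in> fano_cycles" "X \<noteq> {}" for X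
  proof (rule ccontr)
    assume "\<not> 3 \<le> card X"
    then have "X = {0}" using small_zero_sum[of X] X by (simp add: fano_cycles_def)
    then show False using X by (simp add: fano_cycles_def)
  qed
  have "card {0 :: bit ^ 3} < CARD(bit ^ 3)" by (simp add: CARD_bit)
  then obtain x :: "bit ^ 3" where x: "x \<notin> {0}" by (metis UNIV_eq_I less_irrefl)
  have "card {0, x} < CARD(bit ^ 3)" by (simp add: CARD_bit card_insert_if)
  then obtain y where y: "y \<notin> {0, x}" by (metis UNIV_eq_I less_irrefl)
  \<comment> \<open>\<open>z\<close> is chosen outside the plane spanned by \<open>x\<close> and \<open>y\<close>\<close>
  have "card {0, x, y, x + y} < CARD(bit ^ 3)"
    using card_length[of "[0, x, y, x + y]"] by (simp add: CARD_bit)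
  then obtain z where z: "z \<notin> {0, x, y, x + y}" by (metis UNIV_eq_I less_irrefl)
  have c3: "card {x, y, z} = 3" using x y z by (auto simp: card_insert_if)
  have "{x, y, z} \<in> indeps M"
    unfolding indep_iff
  proof (intro conjI ballI impI, goal_cases)
    case 1
    then show ?case using x y z by auto
  next
    case (2 X)
    show ?case
    proof (rule ccontr)
      assume "X \<noteq> {}"
      then have "card {x, y, z} \<le> card X" using three[OF 2(1)] c3 by simp
      then have "X = {x, y, z}" using card_seteq[OF fin 2(2)] by simp
      moreover have "x \<noteq> y" "x \<noteq> z" "y \<noteq> z" "0 \<noteq> x" "0 \<noteq> y" "0 \<noteq> z" using x y z by auto
      ultimately have "x + (y + z) = 0" using 2(1) by (simp add: fano_cycles_def)
      then have "(x + y) + z = 0" by (simp only: add.assoc)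
      then have "x + y = z" unfolding bit_vec_add_eq_0_iff .
      then show False using z by simp
    qed
  qed
  moreover have "card J \<le> 3" if J: "J \<in> indeps M" for J
    by (rule indep_card_le_log[OF J, of "\<lambda>X. \<Sum>X" UNIV])
      (auto simp: fano_cycles_def Sum_sym_diff bit_vec_add_self finite_UNIV_bit_vec CARD_bit)
  ultimately show r: "rk M ?E = 3" by (rule rk_eqI[OF _ c3])
  show "large_paving ?E fano_cycles"
    unfolding large_paving_def paving_iff r card using cycle_space_axioms three by simp
qed

lemma AG32_large_paving:
  shows "large_paving UNIV ag_cycles"
    and "rk (matroid_of_cycles UNIV ag_cycles) UNIV = 4"
    and "card (UNIV :: (bit ^ 3) set) = 8"
proof -
  let ?E = "UNIV :: (bit ^ 3) set"
  show card: "card ?E = 8" by (simp add: CARD_bit)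
  have fin: "finite X" for X :: "(bit ^ 3) set" by (rule finite_bit_vec_set)
  interpret cycle_space ?E ag_cycles
    by unfold_locales (use fin in \<open>auto simp: ag_cycles_def Sum_sym_diff even_card_sym_diff\<close>)
  have four: "4 \<le> card X" if X: "X \<in> ag_cycles" "X \<noteq> {}" for X
  proof (rule ccontr)
    assume n4: "\<not> 4 \<le> card X"
    have ev: "even (card X)" "\<Sum>X = 0" using X by (simp_all add: ag_cycles_def)
    then have "card X \<noteq> 3" by auto
    then have "card X \<le> 2" using n4 by linarith
    then have "X = {0}" using small_zero_sum[of X] X ev by simp
    then show False using ev by simp
  qed
  have "card {0 :: bit ^ 3} < CARD(bit ^ 3)" by (simp add: CARD_bit)
  then obtain x :: "bit ^ 3" where x: "x \<notin> {0}" by (metis UNIV_eq_I less_irrefl)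
  have "card {0, x} < CARD(bit ^ 3)" by (simp add: CARD_bit card_insert_if)
  then obtain y where y: "y \<notin> {0, x}" by (metis UNIV_eq_I less_irrefl)
  \<comment> \<open>\<open>z\<close> is chosen outside the plane spanned by \<open>x\<close> and \<open>y\<close>\<close>
  have "card {0, x, y, x + y} < CARD(bit ^ 3)"
    using card_length[of "[0, x, y, x + y]"] by (simp add: CARD_bit)
  then obtain z where z: "z \<notin> {0, x, y, x + y}" by (metis UNIV_eq_I less_irrefl)
  have c4: "card {0, x, y, z} = 4" using x y z by (auto simp: card_insert_if)
  have "{0, x, y, z} \<in> indeps M"
    unfolding indep_iff
  proof (intro conjI ballI impI, goal_cases)
    case (2 X)
    show ?case
    proof (rule ccontr)
      assume "X \<noteq> {}"
      then have "card {0, x, y, z} \<le> card X" using four[OF 2(1)] c4 by simp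
      then have "X = {0, x, y, z}" using card_seteq[OF fin 2(2)] by simp
      moreover have "x \<noteq> y" "x \<noteq> z" "y \<noteq> z" "0 \<noteq> x" "0 \<noteq> y" "0 \<noteq> z" using x y z by auto
      ultimately have "x + (y + z) = 0" using 2(1) by (simp add: ag_cycles_def)
      then have "(x + y) + z = 0" by (simp only: add.assoc)
      then have "x + y = z" unfolding bit_vec_add_eq_0_iff .
      then show False using z by simp
    qed
  qed simp
  moreover have "card J \<le> 4" if J: "J \<in> indeps M" for J
  proof (rule indep_card_le_log[OF J, of "\<lambda>X. (odd (card X), \<Sum>X)" UNIV])
    show "sym_diff X Y \<in> ag_cycles" if "(odd (card X), \<Sum>X) = (odd (card Y), \<Sum>Y)" for X Y :: "(bit ^ 3) set"
      using that by (auto simp: ag_cycles_def Sum_sym_diff bit_vec_add_self even_card_sym_diff[OF fin fin])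
    show "finite (UNIV :: (bool \<times> (bit ^ 3)) set)"
      by (rule card_ge_0_finite) (simp add: CARD_bit card_UNIV_bool)
    show "card (UNIV :: (bool \<times> (bit ^ 3)) set) = 2 ^ 4" by (simp add: CARD_bit card_UNIV_bool)
  qed simp
  ultimately show r: "rk M ?E = 4" by (rule rk_eqI[OF _ c4])
  show "large_paving ?E ag_cycles"
    unfolding large_paving_def paving_iff r card using cycle_space_axioms four by simp
qed

lemma dual_large_paving:
  assumes "large_paving E Z"
  shows "large_paving E (cocycles E Z)"
    and "rk (matroid_of_cycles E (cocycles E Z)) E = card E - rk (matroid_of_cycles E Z) E"
proof -
  interpret cycle_space E Z using assms by (simp add: large_paving_def)
  show r: "rk (matroid_of_cycles E (cocycles E Z)) E = card E - rk M E"
    using corank_eq by (simp add: corank_def dual_cycles)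
  have "paving (matroid_of_cycles E (cocycles E Z))"
    using paving_dual_paving assms(1) by (simp add: large_paving_def dual_cycles)
  then show "large_paving E (cocycles E Z)"
    unfolding large_paving_def r using cycle_space_cocycles assms by (auto simp: large_paving_def)
qed

lemma closed_walk_edges_3: "closed_walk_edges [a, b, c] = {{a, b}, {b, c}, {c, a}}"
proof -
  have "{i. i < length [a, b, c]} = {0, 1, 2}" by auto
  moreover have "closed_walk_edges [a, b, c] =
      (\<lambda>i. {[a, b, c] ! i, [a, b, c] ! (Suc i mod length [a, b, c])}) ` {i. i < length [a, b, c]}"
    unfolding closed_walk_edges_def by blast
  ultimately show ?thesis by simp
qed

lemma closed_walk_edges_4: "closed_walk_edges [a, b, c, d] = {{a, b}, {b, c}, {c, d}, {d, a}}"
proof -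
  have "{i. i < length [a, b, c, d]} = {0, 1, 2, 3}" by auto
  moreover have "closed_walk_edges [a, b, c, d] =
      (\<lambda>i. {[a, b, c, d] ! i, [a, b, c, d] ! (Suc i mod length [a, b, c, d])}) ` {i. i < length [a, b, c, d]}"
    unfolding closed_walk_edges_def by blast
  ultimately show ?thesis by simp
qed

text \<open>The edges of the complete graph on four vertices.\<close>

abbreviation edges4 :: "nat set set" where
  "edges4 \<equiv> complete_graph_edges {..<4}"

text \<open>The cycle space of this graph: the edge sets in which all vertices have even degree.\<close>

definition even_subgraphs4 :: "nat set set set" where
  "even_subgraphs4 = {X. X \<subseteq> edges4 \<and> (\<forall>v. even (card {e \<in> X. v \<in> e}))}"

lemma edges4E:
  assumes "e \<in> edges4"
  obtains a b where "e = {a, b}" "a \<noteq> b" "a < 4" "b < 4"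
  using assms unfolding complete_graph_edges_def by (auto simp: card_2_iff)

lemma edges4_iff: "{a, b} \<in> edges4 \<longleftrightarrow> a < 4 \<and> b < 4 \<and> a \<noteq> b"
  unfolding complete_graph_edges_def by (auto simp: card_2_iff doubleton_eq_iff)

lemma finite_edges4: "finite edges4"
  by (rule finite_subset[of _ "Pow {..<4}"]) (auto simp: complete_graph_edges_def)

lemma triangle_even:
  assumes "distinct [a, b, c]" "a < 4" "b < 4" "c < 4"
  shows "{{a, b}, {b, c}, {c, a}} \<in> even_subgraphs4"
proof -
  have dist: "{a, b} \<noteq> {b, c}" "{a, b} \<noteq> {c, a}" "{b, c} \<noteq> {c, a}"
    using assms by (auto simp: doubleton_eq_iff)
  have "card {e \<in> {{a, b}, {b, c}, {c, a}}. v \<in> e} =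
      of_bool (v \<in> {a, b}) + (of_bool (v \<in> {b, c}) + of_bool (v \<in> {c, a}))" for v
  proof -
    have "{e \<in> {{a, b}, {b, c}, {c, a}}. v \<in> e} = {{a, b}, {b, c}, {c, a}} \<inter> {e. v \<in> e}" by auto
    then show ?thesis using dist
      by (simp only:) (subst card_insert_Int, simp, simp, subst card_insert_Int, simp, simp,
        subst card_insert_Int, simp_all)
  qed
  moreover have "even (of_bool (v \<in> {a, b}) + (of_bool (v \<in> {b, c}) + of_bool (v \<in> {c, a})) :: nat)" for v
    using assms(1) by (cases "v = a"; cases "v = b"; cases "v = c") auto
  ultimately show ?thesis unfolding even_subgraphs4_def using assms edges4_iff by simp
qed

lemma square_even:
  assumes "distinct [a, b, c, d]" "a < 4" "b < 4" "c < 4" "d < 4"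
  shows "{{a, b}, {b, c}, {c, d}, {d, a}} \<in> even_subgraphs4"
proof -
  have dist: "{a, b} \<noteq> {b, c}" "{a, b} \<noteq> {c, d}" "{a, b} \<noteq> {d, a}" "{b, c} \<noteq> {c, d}"
      "{b, c} \<noteq> {d, a}" "{c, d} \<noteq> {d, a}"
    using assms by (auto simp: doubleton_eq_iff)
  have "card {e \<in> {{a, b}, {b, c}, {c, d}, {d, a}}. v \<in> e} =
      of_bool (v \<in> {a, b}) + (of_bool (v \<in> {b, c}) + (of_bool (v \<in> {c, d}) + of_bool (v \<in> {d, a})))" for v
  proof -
    have "{e \<in> {{a, b}, {b, c}, {c, d}, {d, a}}. v \<in> e} = {{a, b}, {b, c}, {c, d}, {d, a}} \<inter> {e. v \<in> e}" by auto
    then show ?thesis using dist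
      by (simp only:) (subst card_insert_Int, simp, simp, subst card_insert_Int, simp, simp,
        subst card_insert_Int, simp, simp, subst card_insert_Int, simp_all)
  qed
  moreover have "even (of_bool (v \<in> {a, b}) + (of_bool (v \<in> {b, c}) + (of_bool (v \<in> {c, d}) + of_bool (v \<in> {d, a}))) :: nat)" for v
    using assms(1) by (cases "v = a"; cases "v = b"; cases "v = c"; cases "v = d") auto
  ultimately show ?thesis unfolding even_subgraphs4_def using assms edges4_iff by simp
qed

lemma even_subgraph_next_edge:
  assumes "X \<in> even_subgraphs4" "{a, b} \<in> X"
  obtains c where "{a, c} \<in> X" "c \<noteq> b" "c \<noteq> a" "c < 4"
proof -
  have X: "X \<subseteq> edges4" "even (card {e \<in> X. a \<in> e})" using assms(1) by (auto simp: even_subgraphs4_def)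
  have "{e \<in> X. a \<in> e} \<noteq> {{a, b}}"
  proof
    assume "{e \<in> X. a \<in> e} = {{a, b}}"
    then have "card {e \<in> X. a \<in> e} = 1" by simp
    then show False using X(2) by simp
  qed
  then obtain e where e: "e \<in> X" "a \<in> e" "e \<noteq> {a, b}" using assms(2) by auto
  have eE: "e \<in> edges4" using e(1) X(1) by auto
  obtain c d where cd: "e = {c, d}" "c \<noteq> d" "c < 4" "d < 4" by (rule edges4E[OF eE])
  show ?thesis
  proof (cases "a = c")
    case True
    then show ?thesis using that[of d] cd e by auto
  next
    case False
    then have "a = d" using cd e(2) by auto
    then show ?thesis using that[of c] cd e by (auto simp: insert_commute)
  qed
qed

lemma cycle_space_even_subgraphs4: "cycle_space edges4 even_subgraphs4"
proof
  fix X Y assume XY: "X \<in> even_subgraphs4" "Y \<in> even_subgraphs4"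
  have fin: "finite X" "finite Y"
    using XY by (auto simp: even_subgraphs4_def intro: finite_subset[OF _ finite_edges4])
  have "even (card {e \<in> sym_diff X Y. v \<in> e})" for v
  proof -
    have "{e \<in> sym_diff X Y. v \<in> e} = sym_diff {e \<in> X. v \<in> e} {e \<in> Y. v \<in> e}" by auto
    then show ?thesis using XY fin by (simp add: even_card_sym_diff even_subgraphs4_def)
  qed
  then show "sym_diff X Y \<in> even_subgraphs4" using XY by (auto simp: even_subgraphs4_def)
qed (use finite_edges4 in \<open>auto simp: even_subgraphs4_def\<close>)

text \<open>
  Distinct vertices force a closed walk to be a triangle or a square, which are even subgraphs. Conversely, take an
  edge \<open>ab\<close> of a nonempty even subgraph. It continues to edges \<open>ac\<close> and \<open>bd\<close>; if \<open>c\<close> and \<open>d\<close> differ, the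
  edge after \<open>bd\<close> goes to \<open>a\<close> or \<open>c\<close>, as there are only four vertices, and closes a triangle or a square.
\<close>

lemma contains_cycle_iff:
  assumes X: "X \<subseteq> edges4"
  shows "(\<exists>vs. distinct vs \<and> 3 \<le> length vs \<and> closed_walk_edges vs \<subseteq> X) \<longleftrightarrow>
    (\<exists>Y\<in>even_subgraphs4. Y \<subseteq> X \<and> Y \<noteq> {})"
proof
  assume "\<exists>vs. distinct vs \<and> 3 \<le> length vs \<and> closed_walk_edges vs \<subseteq> X"
  then obtain vs where vs: "distinct vs" "3 \<le> length vs" "closed_walk_edges vs \<subseteq> X" by auto
  have "set vs \<subseteq> {..<4}"
  proof
    fix v assume "v \<in> set vs"
    then obtain i where i: "i < length vs" "v = vs ! i" by (metis in_set_conv_nth)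
    then have "{vs ! i, vs ! (Suc i mod length vs)} \<in> closed_walk_edges vs"
      unfolding closed_walk_edges_def by blast
    then have "{vs ! i, vs ! (Suc i mod length vs)} \<in> edges4" using vs(3) X by blast
    then show "v \<in> {..<4}" using i(2) edges4_iff by simp
  qed
  then have "length vs \<le> 4" using distinct_card[OF vs(1)] card_mono[of "{..<4::nat}" "set vs"] by simp
  then consider "length vs = 3" | "length vs = 4" using vs(2) by linarith
  then show "\<exists>Y\<in>even_subgraphs4. Y \<subseteq> X \<and> Y \<noteq> {}"
  proof cases
    case 1
    then obtain a b c where v: "vs = [a, b, c]" by (auto simp: length_Suc_conv numeral_3_eq_3)
    have "{{a, b}, {b, c}, {c, a}} \<in> even_subgraphs4"
      by (rule triangle_even) (use vs(1) v \<open>set vs \<subseteq> {..<4}\<close> in auto)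
    then show ?thesis using vs(3) unfolding v closed_walk_edges_3 by blast
  next
    case 2
    then obtain a b c d where v: "vs = [a, b, c, d]" by (auto simp: length_Suc_conv eval_nat_numeral)
    have "{{a, b}, {b, c}, {c, d}, {d, a}} \<in> even_subgraphs4"
      by (rule square_even) (use vs(1) v \<open>set vs \<subseteq> {..<4}\<close> in auto)
    then show ?thesis using vs(3) unfolding v closed_walk_edges_4 by blast
  qed
next
  assume "\<exists>Y\<in>even_subgraphs4. Y \<subseteq> X \<and> Y \<noteq> {}"
  then obtain Y e where Y: "Y \<in> even_subgraphs4" "Y \<subseteq> X" "e \<in> Y" by auto
  then have eE: "e \<in> edges4" using X by auto
  obtain a b where ab: "e = {a, b}" "a \<noteq> b" "a < 4" "b < 4" by (rule edges4E[OF eE])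
  have abY: "{a, b} \<in> Y" "{b, a} \<in> Y" using Y ab by (auto simp: insert_commute)
  obtain c where c: "{a, c} \<in> Y" "c \<noteq> b" "c \<noteq> a" "c < 4" using even_subgraph_next_edge[OF Y(1) abY(1)] .
  obtain d where d: "{b, d} \<in> Y" "d \<noteq> a" "d \<noteq> b" "d < 4" using even_subgraph_next_edge[OF Y(1) abY(2)] .
  show "\<exists>vs. distinct vs \<and> 3 \<le> length vs \<and> closed_walk_edges vs \<subseteq> X"
  proof (cases "c = d")
    case True
    have "closed_walk_edges [a, b, c] \<subseteq> X"
      unfolding closed_walk_edges_3 using Y(2) abY c d True by (auto simp: insert_commute)
    moreover have "distinct [a, b, c]" using ab c by auto
    ultimately show ?thesis by (intro exI[of _ "[a, b, c]"]) simp
  next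
    case False
    have dbY: "{d, b} \<in> Y" using d(1) by (simp add: insert_commute)
    obtain x where x: "{d, x} \<in> Y" "x \<noteq> b" "x \<noteq> d" "x < 4" using even_subgraph_next_edge[OF Y(1) dbY] .
    have "card {a, b, c, d} = 4" using ab c d False by auto
    moreover have "{a, b, c, d} \<subseteq> {..<4}" using ab c d by auto
    ultimately have "{a, b, c, d} = {..<4}" by (intro card_subset_eq) auto
    then have "x = a \<or> x = c" using x by auto
    then show ?thesis
    proof
      assume "x = a"
      then have "closed_walk_edges [a, b, d] \<subseteq> X"
        unfolding closed_walk_edges_3 using Y(2) abY d x by auto
      moreover have "distinct [a, b, d]" using ab d by auto
      ultimately show ?thesis by (intro exI[of _ "[a, b, d]"]) simp
    next
      assume "x = c"
      then have "closed_walk_edges [a, b, d, c] \<subseteq> X"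
        unfolding closed_walk_edges_4 using Y(2) abY c d x by (auto simp: insert_commute)
      moreover have "distinct [a, b, d, c]" using ab c d False by auto
      ultimately show ?thesis by (intro exI[of _ "[a, b, d, c]"]) simp
    qed
  qed
qed

lemma M_K4_cycles: "M_K4 = matroid_of_cycles edges4 even_subgraphs4"
proof (rule indep_system_eqI)
  fix I assume "I \<subseteq> ground M_K4"
  then have I: "I \<subseteq> edges4" by (simp add: M_K4_def cycle_matroid_def)
  have "I \<in> indeps M_K4 \<longleftrightarrow> \<not> (\<exists>vs. distinct vs \<and> 3 \<le> length vs \<and> closed_walk_edges vs \<subseteq> I)"
    using I by (simp add: M_K4_def cycle_matroid_def)
  also have "\<dots> \<longleftrightarrow> I \<in> indeps (matroid_of_cycles edges4 even_subgraphs4)"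
    unfolding contains_cycle_iff[OF I] using I by (auto simp: matroid_of_cycles_def)
  finally show "I \<in> indeps M_K4 \<longleftrightarrow> I \<in> indeps (matroid_of_cycles edges4 even_subgraphs4)" .
qed (auto simp: M_K4_def cycle_matroid_def matroid_of_cycles_def)

lemma M_K4_large_paving:
  shows "large_paving edges4 even_subgraphs4"
    and "rk (matroid_of_cycles edges4 even_subgraphs4) edges4 = 3"
    and "card edges4 = 6"
proof -
  interpret cycle_space edges4 even_subgraphs4 by (rule cycle_space_even_subgraphs4)
  show card: "card edges4 = 6"
    unfolding complete_graph_edges_def using n_subsets[of "{..<4::nat}" 2] by (simp add: choose_two)
  have three: "3 \<le> card X" if X: "X \<in> even_subgraphs4" "X \<noteq> {}" for X
  proof -
    have XE: "X \<subseteq> edges4" using cycle_subset[OF X(1)] .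
    obtain e where e: "e \<in> X" using X by auto
    then have eE: "e \<in> edges4" using XE by auto
    obtain a b where ab: "e = {a, b}" "a \<noteq> b" by (rule edges4E[OF eE])
    have abX: "{a, b} \<in> X" "{b, a} \<in> X" using e ab by (auto simp: insert_commute)
    obtain c where c: "{a, c} \<in> X" "c \<noteq> b" "c \<noteq> a" using even_subgraph_next_edge[OF X(1) abX(1)] .
    obtain d where d: "{b, d} \<in> X" "d \<noteq> a" "d \<noteq> b" using even_subgraph_next_edge[OF X(1) abX(2)] .
    have "card {{a, b}, {a, c}, {b, d}} = 3"
      using ab c d by (auto simp: card_insert_if doubleton_eq_iff)
    moreover have "{{a, b}, {a, c}, {b, d}} \<subseteq> X" using abX c d by simp
    then have "card {{a, b}, {a, c}, {b, d}} \<le> card X" using finite_subset_ground[OF XE] by (rule card_mono[rotated])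
    ultimately show ?thesis by simp
  qed
  \<comment> \<open>the star of the vertex \<open>0\<close>, a spanning tree\<close>
  let ?B = "{{0, 1}, {0, 2}, {0, 3}} :: nat set set"
  have BE: "?B \<subseteq> edges4" using edges4_iff by simp
  have "?B \<in> indeps M"
    unfolding indep_iff
  proof (intro conjI ballI impI BE, rule ccontr)
    fix X assume X: "X \<in> even_subgraphs4" "X \<subseteq> ?B" "X \<noteq> {}"
    then obtain e where e: "e \<in> X" by auto
    then obtain i where i: "e = {0, i}" "i \<in> {1, 2, 3}" using X(2) by blast
    then have "{i, 0} \<in> X" using e by (simp add: insert_commute)
    then obtain c where c: "{i, c} \<in> X" "c \<noteq> 0" "c \<noteq> i" by (rule even_subgraph_next_edge[OF X(1)])
    then have "0 \<in> {i, c}" using X(2) by blast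
    then show False using c i(2) by auto
  qed
  moreover have "edges4 \<subseteq> cl ?B"
  proof
    fix e assume eE: "e \<in> edges4"
    obtain a b where ab: "e = {a, b}" "a \<noteq> b" "a < 4" "b < 4" by (rule edges4E[OF eE])
    have star: "{0, i} \<in> ?B" if "i < 4" "i \<noteq> 0" for i :: nat
    proof -
      have "i = 1 \<or> i = 2 \<or> i = 3" using that by linarith
      then show ?thesis by auto
    qed
    consider "a = 0" | "b = 0" | "a \<noteq> 0" "b \<noteq> 0" by auto
    then show "e \<in> cl ?B"
    proof cases
      case 1
      then have "e \<in> ?B" using star[of b] ab by simp
      then show ?thesis using subset_cl[OF BE] by blast
    next
      case 2
      then have "e \<in> ?B" using star[of a] ab by (simp add: insert_commute)
      then show ?thesis using subset_cl[OF BE] by blast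
    next
      case 3
      let ?W = "{{0, a}, {0, b}}"
      have "{{a, b}, {b, 0}, {0, a}} \<in> even_subgraphs4" by (rule triangle_even) (use ab 3 in auto)
      moreover have "{{a, b}, {b, 0}, {0, a}} = insert e ?W" using ab(1) by (auto simp: insert_commute)
      moreover have "?W \<subseteq> ?B" using star[of a] star[of b] ab 3 by simp
      moreover have "e \<notin> ?W" using ab 3 by (auto simp: doubleton_eq_iff)
      ultimately show ?thesis unfolding in_cl_iff[OF BE] by metis
    qed
  qed
  ultimately have "basis_in edges4 ?B" using BE by (simp add: basis_in_def)
  then have "rk M edges4 = card ?B" by (rule rk_basis_in)
  also have "\<dots> = 3" by (simp add: card_insert_if doubleton_eq_iff)
  finally show r: "rk M edges4 = 3" .
  show "large_paving edges4 even_subgraphs4"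
    unfolding large_paving_def paving_iff r card using cycle_space_axioms three by simp
qed

lemma in_list_c_iff_large_paving:
  assumes "matroid M"
  shows "in_list_c M \<longleftrightarrow> (\<exists>Z. large_paving (ground M) Z \<and> M = matroid_of_cycles (ground M) Z)"
proof -
  note F = Fano_large_paving
  have "dual Fano = matroid_of_cycles (UNIV - {0}) (cocycles (UNIV - {0}) fano_cycles)"
    unfolding Fano_cycles using F(1) by (simp add: large_paving_def cycle_space.dual_cycles)
  moreover have "large_paving (UNIV - {0}) (cocycles (UNIV - {0}) fano_cycles)"
    "rk (matroid_of_cycles (UNIV - {0}) (cocycles (UNIV - {0}) fano_cycles)) (UNIV - {0}) = 4"
    using dual_large_paving[OF F(1)] F(2,3) by simp_all
  moreover note Fd = calculation
  show ?thesis
  proof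
    assume "in_list_c M"
    then consider "matroid_iso M M_K4" | "matroid_iso M Fano" | "matroid_iso M (dual Fano)" | "matroid_iso M AG32"
      by (auto simp: in_list_c_def)
    then show "\<exists>Z. large_paving (ground M) Z \<and> M = matroid_of_cycles (ground M) Z"
    proof cases
      case 1
      then show ?thesis using large_paving_pullback[OF assms _ M_K4_large_paving(1)] M_K4_cycles by metis
    next
      case 2
      then show ?thesis using large_paving_pullback[OF assms _ F(1)] Fano_cycles by metis
    next
      case 3
      then show ?thesis using large_paving_pullback[OF assms _ Fd(2)] Fd(1) by metis
    next
      case 4
      then show ?thesis using large_paving_pullback[OF assms _ AG32_large_paving(1)] AG32_cycles by metis
    qed
  next
    assume "\<exists>Z. large_paving (ground M) Z \<and> M = matroid_of_cycles (ground M) Z"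
    then obtain Z where Z: "large_paving (ground M) Z" and M: "M = matroid_of_cycles (ground M) Z" by auto
    let ?N = "matroid_of_cycles (ground M) Z"
    consider "rk ?N (ground M) = 3" "card (ground M) = 6" | "rk ?N (ground M) = 3" "card (ground M) = 7"
      | "rk ?N (ground M) = 4" "card (ground M) = 7" | "rk ?N (ground M) = 4" "card (ground M) = 8"
      using large_paving_cases[OF Z] by auto
    then have "matroid_iso ?N M_K4 \<or> matroid_iso ?N Fano \<or> matroid_iso ?N (dual Fano) \<or> matroid_iso ?N AG32"
    proof cases
      case 1
      then have "matroid_iso ?N M_K4"
        unfolding M_K4_cycles using M_K4_large_paving Z by (intro large_paving_unique) simp_all
      then show ?thesis by simp
    next
      case 2
      then have "matroid_iso ?N Fano"
        unfolding Fano_cycles using F Z by (intro large_paving_unique) simp_all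
      then show ?thesis by simp
    next
      case 3
      then have "matroid_iso ?N (dual Fano)"
        unfolding Fd(1) using Fd(2,3) F(3) Z by (intro large_paving_unique) simp_all
      then show ?thesis by simp
    next
      case 4
      then have "matroid_iso ?N AG32"
        unfolding AG32_cycles using AG32_large_paving Z by (intro large_paving_unique) simp_all
      then show ?thesis by simp
    qed
    then show "in_list_c M" unfolding in_list_c_def using M by metis
  qed
qed

section \<open>The classification\<close>

lemma (in cycle_space) connected_split_cases:
  assumes conn: "matroid_connected M" and split: "split_matroid M" and E2: "2 \<le> card E"
  shows "parallel_series E Z \<or>
    (\<exists>A B C. tripartition E A B C \<and> (Z = three_parallel_cycles A B C \<or> Z = three_series_cycles A B C)) \<or>
    large_paving E Z"
proof (cases "paving M")
  case False
  then obtain C where C: "circuit M C" "card C < rk M E" by (auto simp: paving_def)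
  then show ?thesis using split_nonpaving[OF conn split E2 C] corank2_three_series[OF conn E2] by metis
next
  case True
  obtain B where B: "basis_in E B" "card B = rk M E" using basis_in_exists[of E] by auto
  have BE: "B \<subseteq> E" "B \<in> indeps M" using B by (auto simp: basis_in_def)
  have "E \<noteq> {}" using E2 by auto
  then obtain e where e: "e \<in> E" by auto
  have "{e} \<in> indeps M"
    unfolding indep_iff using e connected_no_loop[OF conn E2] by (auto simp: subset_singleton_iff)
  then have r0: "rk M E \<noteq> 0" using indep_card_le_rk[of "{e}" E] e by auto
  have "card E \<noteq> rk M E"
  proof
    assume "card E = rk M E"
    then have "B = E" using BE B finite_ground by (intro card_subset_eq) auto
    moreover obtain X where "X \<in> Z" "e \<in> X" using connected_in_cycle[OF conn E2 e] .
    ultimately show False using BE(2) cycle_subset unfolding indep_iff by blast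
  qed
  moreover have "rk M E \<le> card E" using rk_le_card by simp
  ultimately consider "rk M E = 1" | "rk M E = 2" | "card E = rk M E + 1" | "card E = rk M E + 2"
    | "3 \<le> rk M E" "rk M E + 3 \<le> card E" using r0 by linarith
  then show ?thesis
  proof cases
    case 1
    then show ?thesis using rank1_parallel_series[OF conn E2] by simp
  next
    case 2
    then show ?thesis using rank2_three_parallel[OF conn E2] by metis
  next
    case 3
    then show ?thesis using corank1_parallel_series[OF conn E2] by simp
  next
    case 4
    then show ?thesis using corank2_three_series[OF conn E2] by metis
  next
    case 5
    then show ?thesis using True cycle_space_axioms by (simp add: large_paving_def)
  qed
qed

lemma large_paving_iff_corank:
  assumes "cycle_space E Z"
  shows "large_paving E Z \<longleftrightarrow> paving (matroid_of_cycles E Z) \<and>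
    3 \<le> rk (matroid_of_cycles E Z) E \<and> 3 \<le> corank (matroid_of_cycles E Z)"
proof -
  interpret cycle_space E Z by fact
  have "rk M E \<le> card E" using rk_le_card by simp
  then show ?thesis unfolding large_paving_def corank_eq using assms by auto
qed

lemma large_paving_properties:
  assumes "large_paving E Z"
  shows "matroid_connected (matroid_of_cycles E Z)" "binary (matroid_of_cycles E Z)"
    "split_matroid (matroid_of_cycles E Z)" "sparse_paving (matroid_of_cycles E Z)"
    "3 \<le> rk (matroid_of_cycles E Z) E" "3 \<le> corank (matroid_of_cycles E Z)"
proof -
  interpret cycle_space E Z using assms by (simp add: large_paving_def)
  have L: "paving M" "3 \<le> rk M E" "rk M E + 3 \<le> card E" using assms by (auto simp: large_paving_def)
  show "matroid_connected M" by (rule paving_connected[OF L])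
  show "binary M" by (rule binary_M)
  show "split_matroid M" by (rule paving_split[OF L(1,2)])
  show "sparse_paving M" using L paving_dual_paving by (simp add: sparse_paving_def)
  show "3 \<le> rk M E" by (rule L(2))
  show "3 \<le> corank M" using L(3) by (simp add: corank_eq)
qed

lemma connected_binary_split_in_list:
  assumes mat: "matroid M" and card2: "2 \<le> card (ground M)"
    and M: "matroid_connected M" "binary M" "split_matroid M"
  shows "in_list_a M \<or> in_list_b M \<or> in_list_c M"
proof -
  obtain Z where Z: "cycle_space (ground M) Z" and eq: "M = matroid_of_cycles (ground M) Z"
    using cycles_of_binary[OF mat M(2)] .
  interpret Q: cycle_space "ground M" Z by (rule Z)
  have "matroid_connected Q.M" "split_matroid Q.M" using M(1,3) eq by simp_all
  note Q.connected_split_cases[OF this card2]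
  then consider "parallel_series (ground M) Z"
    | A B C where "tripartition (ground M) A B C" "Z = three_parallel_cycles A B C"
    | A B C where "tripartition (ground M) A B C" "Z = three_series_cycles A B C"
    | "large_paving (ground M) Z" by metis
  then show ?thesis
  proof cases
    case 1
    then have "in_list_a Q.M" by (rule parallel_series_in_list_a[OF Z])
    then show ?thesis using eq by simp
  next
    case 2
    then have "in_list_b Q.M" using three_parallel_in_list_b[OF Q.finite_ground] by simp
    then show ?thesis using eq by simp
  next
    case 3
    then have "in_list_b Q.M" using three_series_in_list_b[OF Q.finite_ground] by simp
    then show ?thesis using eq by simp
  next
    case 4
    then show ?thesis using in_list_c_iff_large_paving[OF mat] eq by blast
  qed
qed

lemma in_list_connected_binary_split:
  assumes mat: "matroid M" and list: "in_list_a M \<or> in_list_b M \<or> in_list_c M"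
  shows "matroid_connected M \<and> binary M \<and> split_matroid M"
  using list
proof (elim disjE)
  assume "in_list_a M"
  then obtain Z where Z: "cycle_space (ground M) Z" and eq: "M = matroid_of_cycles (ground M) Z"
    and ps: "parallel_series (ground M) Z"
    using in_list_a_parallel_series[OF mat] by metis
  interpret Q: cycle_space "ground M" Z by (rule Z)
  show ?thesis using Q.parallel_series_connected_split[OF ps] Q.binary_M eq by simp
next
  assume b: "in_list_b M"
  have fin: "finite (ground M)" using mat by (simp add: matroid_def)
  obtain A B C where t: "tripartition (ground M) A B C"
    and eq: "M = matroid_of_cycles (ground M) (three_parallel_cycles A B C) \<or>
       M = matroid_of_cycles (ground M) (three_series_cycles A B C)"
    by (rule in_list_b_cycles[OF mat b])
  interpret P: cycle_space "ground M" "three_parallel_cycles A B C" by (rule cycle_space_three_parallel[OF fin t])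
  interpret S: cycle_space "ground M" "three_series_cycles A B C" by (rule three_series_cycle_space[OF fin t])
  show ?thesis
    using P.three_parallel_connected_split[OF t refl] P.binary_M
      S.three_series_connected_split[OF t refl] S.binary_M eq by metis
next
  assume "in_list_c M"
  then obtain Z where Z: "large_paving (ground M) Z" and eq: "M = matroid_of_cycles (ground M) Z"
    using in_list_c_iff_large_paving[OF mat] by auto
  show ?thesis using large_paving_properties(1-3)[OF Z] eq by simp
qed

lemma connected_binary_paving_iff_in_list_c:
  assumes mat: "matroid M"
  shows "matroid_connected M \<and> binary M \<and> paving M \<and> 3 \<le> rk M (ground M) \<and> 3 \<le> corank M \<longleftrightarrow> in_list_c M"
    and "matroid_connected M \<and> binary M \<and> sparse_paving M \<and> 3 \<le> rk M (ground M) \<and> 3 \<le> corank M \<longleftrightarrow> in_list_c M"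
proof -
  have 1: "in_list_c M" if M: "binary M" "paving M" "3 \<le> rk M (ground M)" "3 \<le> corank M"
  proof -
    obtain Z where Z: "cycle_space (ground M) Z" and eq: "M = matroid_of_cycles (ground M) Z"
      using cycles_of_binary[OF mat M(1)] .
    have "large_paving (ground M) Z" using large_paving_iff_corank[OF Z] M(2-4) eq by simp
    then show ?thesis using in_list_c_iff_large_paving[OF mat] eq by blast
  qed
  have 2: "matroid_connected M \<and> binary M \<and> sparse_paving M \<and> 3 \<le> rk M (ground M) \<and> 3 \<le> corank M"
    if c: "in_list_c M"
  proof -
    obtain Z where Z: "large_paving (ground M) Z" and eq: "M = matroid_of_cycles (ground M) Z"
      using c in_list_c_iff_large_paving[OF mat] by auto
    show ?thesis using large_paving_properties[OF Z] eq by simp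
  qed
  show "matroid_connected M \<and> binary M \<and> paving M \<and> 3 \<le> rk M (ground M) \<and> 3 \<le> corank M \<longleftrightarrow> in_list_c M"
    using 1 2 unfolding sparse_paving_def by blast
  show "matroid_connected M \<and> binary M \<and> sparse_paving M \<and> 3 \<le> rk M (ground M) \<and> 3 \<le> corank M \<longleftrightarrow> in_list_c M"
    using 1 2 unfolding sparse_paving_def by blast
qed

theorem theorem13:
  fixes M :: "'a indep_system"
  assumes "matroid M"
    and "2 \<le> card (ground M)"
  shows "(matroid_connected M \<and> binary M \<and> split_matroid M \<longleftrightarrow>
            in_list_a M \<or> in_list_b M \<or> in_list_c M) \<and>
         (matroid_connected M \<and> binary M \<and> paving M \<and> 3 \<le> rk M (ground M) \<and> 3 \<le> corank M \<longleftrightarrow>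
            in_list_c M) \<and>
         (matroid_connected M \<and> binary M \<and> sparse_paving M \<and> 3 \<le> rk M (ground M) \<and> 3 \<le> corank M \<longleftrightarrow>
            in_list_c M)"

proof (intro conjI)
  show "matroid_connected M \<and> binary M \<and> split_matroid M \<longleftrightarrow> in_list_a M \<or> in_list_b M \<or> in_list_c M"
    using connected_binary_split_in_list[OF assms] in_list_connected_binary_split[OF assms(1)] by blast
qed (rule connected_binary_paving_iff_in_list_c[OF assms(1)])+

end
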